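(* Let $n \geq 3$ be an integer. The function $F_n : \mathbf{R}_+ \to \mathbf{R}_+$ satisfies the following. (1) There exists a constant $C_n > 0$ such that for all $l > 0$ $$F_n(l) \leq \frac{C_n}{(e^l - 1)^{n-2}}.$$ (2) $F_n$ is continuous and monotonically decreasing. (3) $$\lim_{l \to 0^+} l^{n-2} F_n(l) = K_n = \frac{2\,\pi^{\frac{n-3}{2}}\, P_{n-2}(1)\, \Gamma\left(\frac{n}{2}+1\right) \Gamma\left(\frac{n}{2}-1\right)}{n\, \Gamma\left(\frac{n+1}{2}\right) \Gamma(n-1)}.$$ (4) $$\lim_{l \to \infty} \frac{e^{(n-1)l}}{l} F_n(l) = \frac{(n-2)\,\pi^{\frac{n-2}{2}}\, \Gamma\left(\frac{n}{2}-1\right)}{\left(\Gamma\left(\frac{n+1}{2}\right)\right)^2}.$$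
   Context: $\mathbf{R}_+$ denotes the positive real numbers and $\Gamma$ the Gamma function. For $k \geq 0$, $V_k$ denotes the $k$-dimensional volume of the unit sphere $\mathbf{S}^k \subset \mathbf{R}^{k+1}$ (so $V_0 = 2$). $P_m(z) = \sum_{k=1}^m \frac{z^k}{k}$ for $m \geq 1$, so $P_{m}(1) = 1 + \frac12 + \cdots + \frac1m$. For $n \geq 3$ and $b > 1$ define $$M_n(b) = \int_{-1}^{1} du \int_{b}^{\infty} \frac{\log\left(\frac{(v^2-1)(u^2-b^2)}{(v^2-b^2)(u^2-1)}\right)}{(v-u)^{n}}\, dv.$$ For $n \geq 3$ and $l > 0$, with $a = e^l$, the function $F_n$ is given by $$F_n(l) = \frac{2 V_{n-2} V_{n-3}}{V_{n-1}} \int_0^1 \frac{r^{n-3}}{\left(\sqrt{1-r^2}\right)^{n-2}}\, M_n\left(\sqrt{\frac{a^2-r^2}{1-r^2}}\right) dr .$$ *)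

theory Defs
  imports "HOL-Analysis.Analysis"
begin

text \<open>
  The dimension varies with \<open>n\<close>, so the points of \<open>(k+1)\<close>-dimensional Euclidean space are the
  extensional functions on \<open>{..k}\<close>, with the norm \<open>L2_set\<close> and with the product
  Lebesgue measure.
\<close>

definition unit_sphere :: "nat \<Rightarrow> (nat \<Rightarrow> real) set" where
  "unit_sphere k = {x \<in> {..k} \<rightarrow>\<^sub>E UNIV. L2_set x {..k} = 1}"

definition tube :: "nat \<Rightarrow> (nat \<Rightarrow> real) set \<Rightarrow> real \<Rightarrow> (nat \<Rightarrow> real) set" where
  "tube k S e = {x \<in> {..k} \<rightarrow>\<^sub>E UNIV. \<exists>y\<in>S. L2_set (\<lambda>i. x i - y i) {..k} \<le> e}"

text \<open>
  The \<open>k\<close>-dimensional volume of the unit sphere in dimension \<open>k+1\<close>, as the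
  \<open>k\<close>-dimensional Minkowski content, which for a compact smooth hypersurface is its
  Riemannian volume. The limit exists and has the usual value, see \<open>sphere_vol_eq\<close> below.
\<close>

definition sphere_vol :: "nat \<Rightarrow> real" where
  "sphere_vol k = Lim (at_right 0)
     (\<lambda>e. measure (\<Pi>\<^sub>M i\<in>{..k}. lborel) (tube k (unit_sphere k) e) / (2 * e))"

definition P :: "nat \<Rightarrow> real \<Rightarrow> real" where
  "P m z = (\<Sum>k=1..m. z ^ k / real k)"

text \<open>
  In the ranges \<open>n \<ge> 3\<close>, \<open>b > 1\<close>, \<open>l > 0\<close> all integrands below are positive almost everywhere and
  all integrals converge absolutely, so that the value \<open>0\<close> of a divergent integral plays no role.
  The integrals are over open intervals, so the integrands are evaluated only where the
  denominators are nonzero and the argument of \<open>ln\<close> is positive.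
\<close>

definition M :: "nat \<Rightarrow> real \<Rightarrow> real" where
  "M n b = (LBINT u=-1..1. (LBINT v=ereal b..\<infinity>.
     ln (((v\<^sup>2 - 1) * (u\<^sup>2 - b\<^sup>2)) / ((v\<^sup>2 - b\<^sup>2) * (u\<^sup>2 - 1))) / (v - u) ^ n))"

definition F :: "nat \<Rightarrow> real \<Rightarrow> real" where
  "F n l = 2 * sphere_vol (n - 2) * sphere_vol (n - 3) / sphere_vol (n - 1) *
     (LBINT r=0..1. r ^ (n - 3) / sqrt (1 - r\<^sup>2) ^ (n - 2) *
        M n (sqrt (((exp l)\<^sup>2 - r\<^sup>2) / (1 - r\<^sup>2))))"


lemma tube_unit_sphere:
  assumes "0 < e" "e < 1"
  shows "tube k (unit_sphere k) e =
    {x \<in> {..k} \<rightarrow>\<^sub>E UNIV. 1 - e \<le> L2_set x {..k} \<and> L2_set x {..k} \<le> 1 + e}"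
proof (intro set_eqI iffI)
  fix x assume "x \<in> tube k (unit_sphere k) e"
  then obtain y where x: "x \<in> {..k} \<rightarrow>\<^sub>E UNIV" and y: "L2_set y {..k} = 1"
    and xy: "L2_set (\<lambda>i. x i - y i) {..k} \<le> e"
    unfolding tube_def unit_sphere_def by auto
  have yx: "L2_set (\<lambda>i. y i - x i) {..k} = L2_set (\<lambda>i. x i - y i) {..k}"
    by (simp add: L2_set_def power2_commute)
  have "L2_set (\<lambda>i. y i + (x i - y i)) {..k} \<le> 1 + e"
    using L2_set_triangle_ineq[of y "\<lambda>i. x i - y i" "{..k}"] y xy by linarith
  moreover have "L2_set (\<lambda>i. x i + (y i - x i)) {..k} \<le> L2_set x {..k} + e"
    using L2_set_triangle_ineq[of x "\<lambda>i. y i - x i" "{..k}"] yx xy by linarith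
  ultimately show "x \<in> {x \<in> {..k} \<rightarrow>\<^sub>E UNIV. 1 - e \<le> L2_set x {..k} \<and> L2_set x {..k} \<le> 1 + e}"
    using x y by simp
next
  fix x assume "x \<in> {x \<in> {..k} \<rightarrow>\<^sub>E UNIV. 1 - e \<le> L2_set x {..k} \<and> L2_set x {..k} \<le> 1 + e}"
  then have x: "x \<in> {..k} \<rightarrow>\<^sub>E UNIV" and le: "1 - e \<le> L2_set x {..k}" "L2_set x {..k} \<le> 1 + e"
    by auto
  define s where "s = L2_set x {..k}"
  have s: "s > 0" using le assms by (simp add: s_def)
  define y where "y = restrict (\<lambda>i. (1 / s) * x i) {..k}"
  have "L2_set y {..k} = L2_set (\<lambda>i. (1 / s) * x i) {..k}"
    by (rule L2_set_cong) (auto simp: y_def)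
  also have "\<dots> = (1 / s) * L2_set x {..k}"
    using s by (subst L2_set_right_distrib) auto
  also have "\<dots> = 1" using s by (simp add: s_def)
  finally have "y \<in> unit_sphere k" by (simp add: unit_sphere_def y_def)
  moreover have "L2_set (\<lambda>i. x i - y i) {..k} \<le> e"
  proof -
    have "L2_set (\<lambda>i. x i - y i) {..k} = L2_set (\<lambda>i. \<bar>1 - 1 / s\<bar> * x i) {..k}"
      unfolding L2_set_def
      by (intro arg_cong[where f = sqrt] sum.cong)
         (auto simp: y_def power_mult_distrib[of "\<bar>_\<bar>"] power2_eq_square algebra_simps)
    also have "\<dots> = \<bar>1 - 1 / s\<bar> * s"
      by (subst L2_set_right_distrib[symmetric]) (auto simp: s_def)
    also have "\<dots> = \<bar>s - 1\<bar>"
      using s by (simp add: abs_if field_simps)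
    also have "\<dots> \<le> e" using le by (simp add: s_def abs_le_iff)
    finally show ?thesis .
  qed
  ultimately show "x \<in> tube k (unit_sphere k) e" using x by (auto simp: tube_def)
qed

lemma
  fixes r :: real and k :: nat
  assumes r: "r > 0"
  defines "L \<equiv> \<Pi>\<^sub>M i\<in>{..k}. (lborel :: real measure)"
  shows measure_PiM_cball:
      "{x \<in> {..k} \<rightarrow>\<^sub>E UNIV. L2_set x {..k} \<le> r} \<in> fmeasurable L"
      "measure L {x \<in> {..k} \<rightarrow>\<^sub>E UNIV. L2_set x {..k} \<le> r} = unit_ball_vol (real (k + 1)) * r ^ (k + 1)"
    and measure_PiM_ball:
      "{x \<in> {..k} \<rightarrow>\<^sub>E UNIV. L2_set x {..k} < r} \<in> fmeasurable L"
      "measure L {x \<in> {..k} \<rightarrow>\<^sub>E UNIV. L2_set x {..k} < r} = unit_ball_vol (real (k + 1)) * r ^ (k + 1)"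
proof -
  let ?C = "\<lambda>r. {x \<in> {..k} \<rightarrow>\<^sub>E UNIV. L2_set x {..k} \<le> r}"
  let ?B = "{x \<in> {..k} \<rightarrow>\<^sub>E UNIV. L2_set x {..k} < r}"
  have sp: "space L = {..k} \<rightarrow>\<^sub>E UNIV" by (simp add: L_def space_PiM)
  have [measurable]: "(\<lambda>x. L2_set x {..k}) \<in> borel_measurable L"
    unfolding L2_set_def L_def by measurable
  have Ceq: "?C r = {f. sqrt (\<Sum>i\<in>{..k}. (f i)\<^sup>2) \<le> r} \<inter> space L" for r
    by (auto simp: sp L2_set_def)
  have em: "emeasure L (?C r) = ennreal (unit_ball_vol (real (k + 1)) * r ^ (k + 1))"
    if "r > 0" for r
    using emeasure_cball_aux[of "{..k}" r] that unfolding Ceq L_def by simp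
  have Csets: "?C r \<in> sets L" for r
    unfolding sp[symmetric] by measurable
  have C: "?C r \<in> fmeasurable L" if "r > 0" for r
    using Csets em[OF that] by (auto simp: fmeasurable_def)
  have mC: "measure L (?C r) = unit_ball_vol (real (k + 1)) * r ^ (k + 1)" if "r > 0" for r
    using em[OF that] that by (simp add: measure_def del: of_nat_add)
  show "?C r \<in> fmeasurable L"
    "measure L (?C r) = unit_ball_vol (real (k + 1)) * r ^ (k + 1)"
    using C mC r by blast+
  have "?B \<in> sets L" unfolding sp[symmetric] by measurable
  then show B: "?B \<in> fmeasurable L"
    by (rule fmeasurableI2[OF C[OF r], rotated]) auto
  have "measure L ?B \<le> unit_ball_vol (real (k + 1)) * r ^ (k + 1)"
    unfolding mC[OF r, symmetric]
    by (rule measure_mono_fmeasurable) (use B C[OF r] in \<open>auto simp: fmeasurableD\<close>)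
  moreover have "unit_ball_vol (real (k + 1)) * r ^ (k + 1) \<le> measure L ?B"
  proof (rule tendsto_upperbound)
    show "((\<lambda>s. unit_ball_vol (real (k + 1)) * s ^ (k + 1)) \<longlongrightarrow>
        unit_ball_vol (real (k + 1)) * r ^ (k + 1)) (at_left r)"
      by (intro tendsto_intros)
    show "\<forall>\<^sub>F s in at_left r. unit_ball_vol (real (k + 1)) * s ^ (k + 1) \<le> measure L ?B"
      using eventually_at_left_real[OF r]
    proof eventually_elim
      case (elim s)
      then have s: "s > 0" "s < r" by auto
      show ?case
        unfolding mC[OF s(1), symmetric]
        by (rule measure_mono_fmeasurable) (use B Csets s in auto)
    qed
  qed simp
  ultimately show "measure L ?B = unit_ball_vol (real (k + 1)) * r ^ (k + 1)" by simp
qed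

lemma sphere_vol_tendsto:
  "((\<lambda>e. measure (\<Pi>\<^sub>M i\<in>{..k}. lborel) (tube k (unit_sphere k) e) / (2 * e)) \<longlongrightarrow>
     real (k + 1) * unit_ball_vol (real (k + 1))) (at_right 0)"
proof -
  define U where "U = unit_ball_vol (real (k + 1))"
  let ?L = "\<Pi>\<^sub>M i\<in>{..k}. (lborel :: real measure)"
  have "((\<lambda>e::real. (1 + e) ^ (k + 1) - (1 - e) ^ (k + 1)) has_real_derivative
      2 * real (k + 1)) (at 0)"
    by (auto intro!: derivative_eq_intros)
  then have "((\<lambda>e::real. ((1 + e) ^ (k + 1) - (1 - e) ^ (k + 1)) / e) \<longlongrightarrow> 2 * real (k + 1)) (at 0)"
    by (simp add: DERIV_def)
  then have "((\<lambda>e::real. ((1 + e) ^ (k + 1) - (1 - e) ^ (k + 1)) / e) \<longlongrightarrow> 2 * real (k + 1)) (at_right 0)"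
    by (rule tendsto_within_subset) simp
  then have "((\<lambda>e::real. U / 2 * (((1 + e) ^ (k + 1) - (1 - e) ^ (k + 1)) / e)) \<longlongrightarrow>
      U / 2 * (2 * real (k + 1))) (at_right 0)"
    by (rule tendsto_mult_left)
  then have lim: "((\<lambda>e::real. U / 2 * (((1 + e) ^ (k + 1) - (1 - e) ^ (k + 1)) / e)) \<longlongrightarrow>
      real (k + 1) * U) (at_right 0)"
    by (rule back_subst[where P = "\<lambda>c. (_ \<longlongrightarrow> c) _"]) simp
  have "\<forall>\<^sub>F e in at_right 0. U / 2 * (((1 + e) ^ (k + 1) - (1 - e) ^ (k + 1)) / e) =
      measure ?L (tube k (unit_sphere k) e) / (2 * e)"
    using eventually_at_right_real[of 0 1, OF zero_less_one]
  proof eventually_elim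
    case (elim e)
    then have e: "0 < e" "e < 1" "0 < 1 - e" "0 < 1 + e" by auto
    have "tube k (unit_sphere k) e =
        {x \<in> {..k} \<rightarrow>\<^sub>E UNIV. L2_set x {..k} \<le> 1 + e} - {x \<in> {..k} \<rightarrow>\<^sub>E UNIV. L2_set x {..k} < 1 - e}"
      unfolding tube_unit_sphere[OF e(1,2)] by auto
    moreover have "measure ?L \<dots> = U * (1 + e) ^ (k + 1) - U * (1 - e) ^ (k + 1)"
      unfolding U_def measure_PiM_cball(2)[OF e(4), symmetric] measure_PiM_ball(2)[OF e(3), symmetric]
      by (rule measurable_measure_Diff)
         (use measure_PiM_cball(1)[OF e(4), of k] measure_PiM_ball(1)[OF e(3), of k] e
           in \<open>auto simp: fmeasurableD\<close>)
    ultimately show ?case using e by (simp add: field_simps)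
  qed
  from Lim_transform_eventually[OF lim this] show ?thesis by (simp add: U_def)
qed

lemma sphere_vol_eq: "sphere_vol k = real (k + 1) * unit_ball_vol (real (k + 1))"
  unfolding sphere_vol_def by (rule tendsto_Lim[OF _ sphere_vol_tendsto]) simp

end

theory Submission
  imports Defs
begin

text \<open>
  Put \<open>n = m + 2\<close>. The logarithm splits into a part depending on \<open>v\<close> only and a part depending on \<open>u\<close>
  only, so by Tonelli \<open>(m + 1) M\<close> is the sum of two one-dimensional integrals \<open>M_v\<close> and \<open>M_u\<close>.
  In \<open>M_v\<close> the new variable \<open>s\<close> with \<open>(v\<^sup>2 - 1) / (v\<^sup>2 - b\<^sup>2) = (1 + s) / s\<close> frees the logarithm of \<open>b\<close>,
  and the remaining weight is pointwise decreasing in \<open>b\<close>. The integrand of \<open>M_u\<close> is not pointwise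
  monotone, but it becomes so after folding \<open>u\<close> to \<open>-u\<close> and one integration by parts. At
  \<open>b = 1\<close> both parts concentrate at \<open>u = v = 1\<close> and each tends, after scaling, to
  \<open>\<integral> ln ((1 + x) / x) / (1 + x) ^ (m + 1) dx = P m 1 / m\<close> over \<open>x > 0\<close>; at infinity only
  \<open>M_u\<close> contributes to the leading term. The claims on \<open>F\<close> then follow by dominated convergence in \<open>r\<close>
  from \<open>sqrt (1 - r\<^sup>2) (b - 1) \<ge> exp l - 1\<close>, and the constants are Beta integrals.
\<close>

subsection \<open>Integration over sets of reals\<close>

text \<open>Monotonicity is the real obstacle; the limits and bounds are dominated convergence. At
  \<open>u = 0\<close> the integrand of \<open>M_u\<close> is \<open>2 * ln b / b ^ (m + 1)\<close>,
  which vanishes at \<open>b = 1\<close> and so first increases. Folding is possible because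
  \<open>psi\<close> is even in \<open>u\<close>, and it leaves only the range where
  \<open>psi\<close> increases in \<open>u\<close>. Integrating by parts against a primitive that
  vanishes at \<open>u = 1\<close> then trades the logarithm for a rational kernel times a positive
  weight free of \<open>b\<close>, plus a boundary term at \<open>u = 0\<close>. Each of the two
  contains a factor increasing in \<open>b\<close>, namely \<open>b^2 - 1\<close> or
  \<open>ln (b^2)\<close>, which has to be absorbed algebraically before the decrease becomes
  visible. In \<open>F\<close>, the lower bound on \<open>b - 1\<close> cancels the weight
  \<open>1 / sqrt (1 - r^2) ^ m\<close> exactly, so that constants serve as majorants in
  \<open>r\<close>. At infinity the scaling leaves one spare factor \<open>sqrt (1 - r^2)\<close>;
  it tames the growth of the logarithm as \<open>r\<close> tends to 1 and explains the Beta
  parameter \<open>3 / 2\<close>. The harmonic sum \<open>P m 1\<close> stems from a geometric sum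
  that appears when \<open>kern\<close> is integrated by parts.\<close>

text \<open>Supplies the strict positivity of \<open>M_u\<close> and of \<open>F\<close>: a
  nonnegative function with integral 0 vanishes almost everywhere, but a nonempty open interval is
  not a null set.\<close>

lemma set_lebesgue_integral_pos:
  fixes f :: "real \<Rightarrow> real"
  assumes f: "set_integrable lborel {a<..<b} f" and ab: "a < b"
    and pos: "\<And>x. a < x \<Longrightarrow> x < b \<Longrightarrow> f x > 0"
  shows "(LINT x:{a<..<b}|lborel. f x) > 0"
proof (rule ccontr)
  let ?g = "\<lambda>x. indicator {a<..<b} x *\<^sub>R f x"
  assume "\<not> ?thesis"
  moreover have "AE x in lborel. 0 \<le> ?g x"
    using pos by (intro AE_I2) (auto simp: indicator_def less_imp_le)
  moreover have "(LINT x:{a<..<b}|lborel. f x) \<ge> 0"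
    unfolding set_lebesgue_integral_def using pos
    by (intro integral_nonneg_AE AE_I2) (auto simp: indicator_def less_imp_le)
  ultimately have "AE x in lborel. ?g x = 0"
    using f integral_nonneg_eq_0_iff_AE[of lborel ?g]
    by (auto simp: set_integrable_def set_lebesgue_integral_def)
  then have "AE x in lborel. x \<notin> {a<..<b}"
    by eventually_elim (use pos in \<open>force simp: indicator_def\<close>)
  then have "emeasure lborel {a<..<b} = 0"
    by (subst (asm) AE_iff_measurable[where N="{a<..<b}"]) auto
  with ab show False by simp
qed

text \<open>Punctured neighbourhoods of a real are countably generated, so dominated convergence for
  sequences in \<open>S - {a}\<close> suffices. The set \<open>S\<close> confines the parameter to a
  range with a common majorant. Mere measurability is assumed because one later integrand carries a
  moving indicator.\<close>

lemma set_integral_tendsto_at_within_measurable: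
  fixes f :: "real \<Rightarrow> real \<Rightarrow> real"
  assumes f: "\<And>t. t \<in> S \<Longrightarrow> t \<noteq> a \<Longrightarrow> set_borel_measurable lborel A (f t)"
    and h: "set_borel_measurable lborel A h"
    and w: "set_integrable lborel A w"
    and le: "\<And>t x. t \<in> S \<Longrightarrow> t \<noteq> a \<Longrightarrow> x \<in> A \<Longrightarrow> \<bar>f t x\<bar> \<le> w x"
    and lim: "\<And>x. x \<in> A \<Longrightarrow> ((\<lambda>t. f t x) \<longlongrightarrow> h x) (at a within S)"
  shows "((\<lambda>t. LINT x:A|lborel. f t x) \<longlongrightarrow> (LINT x:A|lborel. h x)) (at a within S)"
  unfolding tendsto_at_iff_sequentially
proof (intro allI impI)
  fix X :: "nat \<Rightarrow> real"
  assume X: "\<forall>i. X i \<in> S - {a}" "X \<longlonglongrightarrow> a"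
  show "((\<lambda>t. LINT x:A|lborel. f t x) \<circ> X) \<longlonglongrightarrow> (LINT x:A|lborel. h x)"
    unfolding o_def set_lebesgue_integral_def
  proof (rule integral_dominated_convergence)
    show "(\<lambda>x. indicator A x *\<^sub>R h x) \<in> borel_measurable lborel"
      using h by (simp add: set_borel_measurable_def)
    show "(\<lambda>x. indicator A x *\<^sub>R f (X i) x) \<in> borel_measurable lborel" for i
      using f[of "X i"] X by (simp add: set_borel_measurable_def)
    show "integrable lborel (\<lambda>x. indicator A x *\<^sub>R w x)"
      using w by (simp add: set_integrable_def)
    show "AE x in lborel. (\<lambda>i. indicator A x *\<^sub>R f (X i) x) \<longlonglongrightarrow> indicator A x *\<^sub>R h x"
    proof (rule AE_I2)
      fix x
      show "(\<lambda>i. indicator A x *\<^sub>R f (X i) x) \<longlonglongrightarrow> indicator A x *\<^sub>R h x"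
        using lim[of x] X by (cases "x \<in> A") (auto simp: tendsto_at_iff_sequentially o_def)
    qed
    show "AE x in lborel. norm (indicator A x *\<^sub>R f (X i) x) \<le> indicator A x *\<^sub>R w x" for i
      using le X by (intro AE_I2) (auto simp: indicator_def)
  qed
qed

lemma set_borel_measurable_continuous_on:
  fixes f :: "real \<Rightarrow> real"
  shows "A \<in> sets borel \<Longrightarrow> continuous_on A f \<Longrightarrow> set_borel_measurable lborel A f"
  using borel_measurable_continuous_on_indicator[of A f] by (simp add: set_borel_measurable_def)

lemma set_integral_tendsto_at_within:
  fixes f :: "real \<Rightarrow> real \<Rightarrow> real"
  assumes A: "A \<in> sets borel"
    and f: "\<And>t. t \<in> S \<Longrightarrow> t \<noteq> a \<Longrightarrow> continuous_on A (f t)"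
    and h: "continuous_on A h"
    and w: "set_integrable lborel A w"
    and le: "\<And>t x. t \<in> S \<Longrightarrow> t \<noteq> a \<Longrightarrow> x \<in> A \<Longrightarrow> \<bar>f t x\<bar> \<le> w x"
    and lim: "\<And>x. x \<in> A \<Longrightarrow> ((\<lambda>t. f t x) \<longlongrightarrow> h x) (at a within S)"
  shows "((\<lambda>t. LINT x:A|lborel. f t x) \<longlongrightarrow> (LINT x:A|lborel. h x)) (at a within S)"
  by (rule set_integral_tendsto_at_within_measurable[OF _ _ w le lim])
     (intro set_borel_measurable_continuous_on A f h; assumption)+

lemma set_integral_tendsto_at_top:
  fixes f :: "real \<Rightarrow> real \<Rightarrow> real"
  assumes A: "A \<in> sets borel"
    and f: "\<And>t. t \<ge> T \<Longrightarrow> continuous_on A (f t)"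
    and h: "continuous_on A h"
    and w: "set_integrable lborel A w"
    and le: "\<And>t x. t \<ge> T \<Longrightarrow> x \<in> A \<Longrightarrow> \<bar>f t x\<bar> \<le> w x"
    and lim: "\<And>x. x \<in> A \<Longrightarrow> ((\<lambda>t. f t x) \<longlongrightarrow> h x) at_top"
  shows "((\<lambda>t. LINT x:A|lborel. f t x) \<longlongrightarrow> (LINT x:A|lborel. h x)) at_top"
proof -
  \<comment> \<open>Freezing the parameter below \<open>T\<close> gives measurability for every real
    \<open>t\<close> and does not affect the limit.\<close>
  let ?f = "\<lambda>t. f (max T t)"
  have "((\<lambda>t. LINT x:A|lborel. ?f t x) \<longlongrightarrow> (LINT x:A|lborel. h x)) at_top"
    unfolding set_lebesgue_integral_def
  proof (rule integral_dominated_convergence_at_top)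
    show "(\<lambda>x. indicator A x *\<^sub>R h x) \<in> borel_measurable lborel"
      using borel_measurable_continuous_on_indicator[OF A h] by simp
    show "(\<lambda>x. indicator A x *\<^sub>R ?f t x) \<in> borel_measurable lborel" for t
      using borel_measurable_continuous_on_indicator[OF A f[of "max T t"]] by simp
    show "integrable lborel (\<lambda>x. indicator A x *\<^sub>R w x)"
      using w by (simp add: set_integrable_def)
    have ev: "\<forall>\<^sub>F t in at_top. f t x = ?f t x" for x
      using eventually_ge_at_top[of T] by eventually_elim (simp add: max_def)
    show "AE x in lborel. ((\<lambda>t. indicator A x *\<^sub>R ?f t x) \<longlongrightarrow> indicator A x *\<^sub>R h x) at_top"
    proof (rule AE_I2)
      fix x
      show "((\<lambda>t. indicator A x *\<^sub>R ?f t x) \<longlongrightarrow> indicator A x *\<^sub>R h x) at_top"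
        using Lim_transform_eventually[OF lim[of x] ev[of x]] by (cases "x \<in> A") auto
    qed
    show "\<forall>\<^sub>F t in at_top. AE x in lborel. norm (indicator A x *\<^sub>R ?f t x) \<le> indicator A x *\<^sub>R w x"
      using le by (intro always_eventually allI AE_I2) (auto simp: indicator_def)
  qed
  then show ?thesis
    by (rule Lim_transform_eventually)
       (use eventually_ge_at_top[of T] in eventually_elim, simp add: max_def)
qed

lemma set_integrable_bound_continuous:
  fixes f w :: "real \<Rightarrow> real"
  assumes A: "A \<in> sets borel" and f: "continuous_on A f" and w: "set_integrable lborel A w"
    and le: "\<And>x. x \<in> A \<Longrightarrow> \<bar>f x\<bar> \<le> w x"
  shows "set_integrable lborel A f"
proof (rule set_integrable_bound[OF w])
  show "set_borel_measurable lborel A f"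
    using borel_measurable_continuous_on_indicator[OF A f] by (simp add: set_borel_measurable_def)
  show "AE x in lborel. x \<in> A \<longrightarrow> norm (f x) \<le> norm (w x)"
    using le by (intro AE_I2) force
qed

lemma set_integrable_const_Ioo: "set_integrable lborel {a<..<b} (\<lambda>_. c::real)" for a b :: real
  unfolding set_integrable_def by (intro integrable_scaleR_left integrable_real_indicator)
   (cases "a \<le> b"; simp)+

subsection \<open>The logarithmic kernel\<close>

text \<open>The common shape of both logarithms: \<open>(v^2 - 1) / (v^2 - b^2)\<close> becomes
  \<open>(1 + s) / s\<close> under \<open>v_subst\<close>, and \<open>(b - u) / (1 - u)\<close>
  becomes \<open>(1 + x) / x\<close> for \<open>u = 1 - (b - 1) * x\<close>.\<close>

definition kern :: "real \<Rightarrow> real" where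
  "kern x = ln ((1 + x) / x)"

lemma kern_nonneg: "x > 0 \<Longrightarrow> kern x \<ge> 0"
  by (simp add: kern_def)

lemma kern_deriv: "x > 0 \<Longrightarrow> (kern has_real_derivative - (1 / (x * (1 + x)))) (at x)"
  unfolding kern_def by (rule derivative_eq_intros refl | simp)+

lemma isCont_kern: "x > 0 \<Longrightarrow> isCont kern x"
  using kern_deriv DERIV_isCont by blast

lemma continuous_on_kern [continuous_intros]:
  assumes "continuous_on S f" "\<And>x. x \<in> S \<Longrightarrow> f x > 0"
  shows "continuous_on S (\<lambda>x. kern (f x))"
  by (rule continuous_on_compose2[OF _ assms(1), of "{0<..}" kern])
     (use assms(2) isCont_kern in \<open>auto intro!: continuous_at_imp_continuous_on\<close>)

lemma
  fixes m :: nat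
  assumes m: "m \<ge> 1"
  shows kern_integrable: "set_integrable lborel {0<..} (\<lambda>x. kern x / (1 + x) ^ (m + 1))"
    and kern_integral: "(LINT x:{0<..}|lborel. kern x / (1 + x) ^ (m + 1)) = P m 1 / real m"
proof -
  define q where "q = (\<lambda>x::real. 1 / (1 + x))"
  \<comment> \<open>Integration by parts: \<open>(1 - q x ^ m) / m\<close> is the primitive of
    \<open>1 / (1 + x) ^ (m + 1)\<close> that vanishes at 0, where \<open>kern\<close> is singular.
    The remaining \<open>(1 - q x ^ m) * q x / x\<close> is a geometric sum because
    \<open>1 - q x = x * q x\<close>, and the terms \<open>q x ^ (k + 1)\<close> have the primitives
    \<open>- q x ^ k / k\<close>.\<close>
  define G where "G = (\<lambda>x. ((1 - q x ^ m) * kern x - (\<Sum>k=1..m. q x ^ k / real k)) / real m)"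
  have dq: "(q has_real_derivative - (q x ^ 2)) (at x)" if "x > 0" for x
    unfolding q_def using that
    by (auto intro!: derivative_eq_intros simp: field_simps power2_eq_square)
  have dqk: "((\<lambda>x. q x ^ k) has_real_derivative - (real k * q x ^ (k + 1))) (at x)" if "x > 0" for x k
  proof (cases k)
    case (Suc j)
    have "((\<lambda>x. q x ^ k) has_real_derivative real k * (- (q x ^ 2) * q x ^ (k - 1))) (at x)"
      using DERIV_power[OF dq[OF that], of k] by simp
    with Suc show ?thesis by (simp add: power2_eq_square mult_ac)
  qed simp
  have geo: "(\<Sum>k=1..j. q x ^ (k + 1)) = (1 - q x ^ j) * q x / x" if "x > 0" for x j
  proof (induction j)
    case (Suc j)
    have x: "x * q x = 1 - q x" using that by (simp add: q_def divide_simps)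
    have "((1 - q x ^ j) * q x / x + q x ^ (j + 2)) * x = (1 - q x ^ j) * q x + q x ^ (j + 1) * (x * q x)"
      using that by (simp add: distrib_right)
    also have "\<dots> = (1 - q x ^ Suc j) * q x"
      unfolding x by (simp add: algebra_simps)
    finally have "(1 - q x ^ j) * q x / x + q x ^ (j + 2) = (1 - q x ^ Suc j) * q x / x"
      using that by (simp add: eq_divide_eq)
    with Suc show ?case by simp
  qed simp
  have dG: "(G has_real_derivative kern x / (1 + x) ^ (m + 1)) (at x)" if "x > 0" for x
  proof -
    have "((\<lambda>x. \<Sum>k=1..m. q x ^ k / real k) has_real_derivative
        (\<Sum>k=1..m. - (real k * q x ^ (k + 1)) / real k)) (at x)"
      by (intro DERIV_sum DERIV_cdivide dqk that)
    also have "(\<Sum>k=1..m. - (real k * q x ^ (k + 1)) / real k) = - (\<Sum>k=1..m. q x ^ (k + 1))"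
      unfolding sum_negf[symmetric] by (intro sum.cong) auto
    finally have s: "((\<lambda>x. \<Sum>k=1..m. q x ^ k / real k) has_real_derivative
        - ((1 - q x ^ m) * q x / x)) (at x)"
      unfolding geo[OF that] .
    have "(G has_real_derivative
       ((real m * q x ^ (m + 1)) * kern x + (1 - q x ^ m) * - (1 / (x * (1 + x)))
         - - ((1 - q x ^ m) * q x / x)) / real m) (at x)"
      unfolding G_def using m
      by (intro DERIV_cdivide DERIV_diff s)
         (rule derivative_eq_intros dqk[OF that] kern_deriv[OF that] refl | simp)+
    also have "((real m * q x ^ (m + 1)) * kern x + (1 - q x ^ m) * - (1 / (x * (1 + x)))
         - - ((1 - q x ^ m) * q x / x)) / real m = kern x * q x ^ (m + 1)"
    proof -
      have "1 / (x * (1 + x)) = q x / x" by (simp add: q_def)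
      then show ?thesis using m by simp
    qed
    also have "\<dots> = kern x / (1 + x) ^ (m + 1)"
      by (simp add: q_def power_one_over)
    finally show ?thesis .
  qed
  have q0: "(q \<longlongrightarrow> 1) (at_right 0)" "(q \<longlongrightarrow> 0) at_top"
    unfolding q_def by real_asymp+
  have k0: "((\<lambda>x. (1 - q x) * kern x) \<longlongrightarrow> 0) (at_right 0)" "(kern \<longlongrightarrow> 0) at_top"
    unfolding q_def kern_def by real_asymp+
  \<comment> \<open>With \<open>1 - q x ^ m\<close> factored, the logarithmic singularity enters
    only through \<open>(1 - q x) * kern x\<close>, which tends to 0.\<close>
  have "((\<lambda>x. ((1 - q x) * kern x * (\<Sum>i<m. q x ^ i) - (\<Sum>k=1..m. q x ^ k / real k)) / real m)
      \<longlongrightarrow> (0 * (\<Sum>i<m. 1 ^ i) - (\<Sum>k=1..m. 1 ^ k / real k)) / real m) (at_right 0)"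
    using m by (intro tendsto_intros q0 k0) auto
  also have "(\<lambda>x. ((1 - q x) * kern x * (\<Sum>i<m. q x ^ i) - (\<Sum>k=1..m. q x ^ k / real k)) / real m) = G"
    unfolding G_def one_diff_power_eq by (simp add: algebra_simps)
  also have "(0 * (\<Sum>i<m. 1 ^ i) - (\<Sum>k=1..m. 1 ^ k / real k)) / real m = - (P m 1 / real m)"
    by (simp add: P_def)
  finally have G0: "(G \<longlongrightarrow> - (P m 1 / real m)) (at_right 0)" .
  have "(G \<longlongrightarrow> ((1 - 0 ^ m) * 0 - (\<Sum>k=1..m. 0 ^ k / real k)) / real m) at_top"
    unfolding G_def using m by (intro tendsto_intros q0 k0) auto
  also have "((1 - 0 ^ m) * 0 - (\<Sum>k=1..m. 0 ^ k / real k)) / real m = 0"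
    by (simp add: zero_power)
  finally have G1: "(G \<longlongrightarrow> 0) at_top" .
  have c: "isCont (\<lambda>x. kern x / (1 + x) ^ (m + 1)) x" if "x > 0" for x
    using that by (intro continuous_intros isCont_kern) auto
  have "set_integrable lborel (einterval 0 \<infinity>) (\<lambda>x. kern x / (1 + x) ^ (m + 1))"
    "(LBINT x=0..\<infinity>. kern x / (1 + x) ^ (m + 1)) = 0 - - (P m 1 / real m)"
    by (rule interval_integral_FTC_nonneg[where F=G];
        use dG c G0 G1 in \<open>auto simp: ereal_tendsto_simps zero_ereal_def kern_nonneg
          intro!: AE_I2\<close>)+
  moreover have "einterval 0 \<infinity> = {0<..}"
    by (auto simp: einterval_def zero_ereal_def)
  ultimately show "set_integrable lborel {0<..} (\<lambda>x. kern x / (1 + x) ^ (m + 1))"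
    "(LINT x:{0<..}|lborel. kern x / (1 + x) ^ (m + 1)) = P m 1 / real m"
    by (auto simp: interval_lebesgue_integral_0_infty)
qed

section \<open>The change of variables in v\<close>

text \<open>
  The solution \<open>v\<close> of \<open>(v\<^sup>2 - 1) / (v\<^sup>2 - b\<^sup>2) = (1 + s) / s\<close>.
\<close>

definition v_subst :: "real \<Rightarrow> real \<Rightarrow> real" where
  "v_subst b s = sqrt (1 + (b\<^sup>2 - 1) * (1 + s))"

lemma v_subst_squared: "b > 1 \<Longrightarrow> s \<ge> 0 \<Longrightarrow> (v_subst b s)\<^sup>2 = 1 + (b\<^sup>2 - 1) * (1 + s)"
  unfolding v_subst_def by (intro real_sqrt_pow2) (simp add: one_le_power)

lemma v_subst_ge:
  assumes "b > 1" "s \<ge> 0"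
  shows "v_subst b s \<ge> b"
proof (rule power2_le_imp_le)
  show "b\<^sup>2 \<le> (v_subst b s)\<^sup>2"
    using assms mult_right_mono[of 1 "b\<^sup>2" s] by (simp add: v_subst_squared algebra_simps)
  show "0 \<le> v_subst b s"
    using assms one_le_power[of b 2] by (simp add: v_subst_def)
qed

lemma v_subst_gt:
  assumes "b > 1" "s > 0"
  shows "v_subst b s > b"
proof (rule power2_less_imp_less)
  show "b\<^sup>2 < (v_subst b s)\<^sup>2"
    using assms mult_strict_right_mono[of 1 "b\<^sup>2" s] by (simp add: v_subst_squared algebra_simps)
  show "0 \<le> v_subst b s"
    using assms one_le_power[of b 2] by (simp add: v_subst_def)
qed

lemma v_subst_mono: "1 < b \<Longrightarrow> b \<le> c \<Longrightarrow> s \<ge> 0 \<Longrightarrow> v_subst b s \<le> v_subst c s"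
  unfolding v_subst_def by (intro real_sqrt_le_mono add_left_mono mult_right_mono diff_right_mono power_mono) auto

text \<open>Stated for nonnegative \<open>f\<close> so that integrability is transported as well,
  from \<open>s\<close> to \<open>v\<close>: a majorant is at hand only on the \<open>s\<close>
  side, where the logarithm is free of \<open>b\<close>.\<close>

lemma
  fixes f :: "real \<Rightarrow> real"
  assumes b: "b > 1" and f0: "\<And>v. v > b \<Longrightarrow> f v \<ge> 0" and fc: "\<And>v. v > b \<Longrightarrow> isCont f v"
    and int: "set_integrable lborel {0<..} (\<lambda>s. f (v_subst b s) * ((b\<^sup>2 - 1) / (2 * v_subst b s)))"
  shows change_v_integrable: "set_integrable lborel {b<..} f"
    and change_v_integral:
      "(LINT v:{b<..}|lborel. f v) = (LINT s:{0<..}|lborel. f (v_subst b s) * ((b\<^sup>2 - 1) / (2 * v_subst b s)))"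
proof -
  have b2: "b\<^sup>2 > 1" using b by (simp add: one_less_power)
  have pos: "1 + (b\<^sup>2 - 1) * (1 + s) > 0" if "s \<ge> 0" for s
    using b2 that by (simp add: add_pos_nonneg)
  have d: "(v_subst b has_real_derivative (b\<^sup>2 - 1) / (2 * v_subst b s)) (at s)" if "s > 0" for s
  proof -
    have "((\<lambda>s. 1 + (b\<^sup>2 - 1) * (1 + s)) has_real_derivative b\<^sup>2 - 1) (at s)"
      by (rule derivative_eq_intros refl | simp)+
    from DERIV_cong[OF DERIV_chain2[OF DERIV_real_sqrt this]] show ?thesis
      using pos[of s] that unfolding v_subst_def by (simp add: inverse_eq_divide mult.commute)
  qed
  have cV: "isCont (v_subst b) s" if "s > 0" for s
    using d[OF that] DERIV_isCont by blast
  have Vpos: "v_subst b s > 0" if "s \<ge> 0" for s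
    using v_subst_ge[OF b that] b by simp
  have l0: "(v_subst b \<longlongrightarrow> b) (at_right 0)"
  proof -
    have "(v_subst b \<longlongrightarrow> sqrt (1 + (b\<^sup>2 - 1) * (1 + 0))) (at_right 0)"
      unfolding v_subst_def by (intro tendsto_intros)
    with b show ?thesis by simp
  qed
  have l1: "filterlim (v_subst b) at_top at_top"
    unfolding v_subst_def using b2
    by (intro filterlim_compose[OF sqrt_at_top] filterlim_tendsto_add_at_top[OF tendsto_const]
          filterlim_tendsto_pos_mult_at_top[OF tendsto_const] filterlim_ident) auto
  have e: "einterval 0 \<infinity> = {0<..}" "einterval (ereal b) \<infinity> = {b<..}"
    by (auto simp: einterval_def zero_ereal_def)
  have L0: "((ereal \<circ> v_subst b \<circ> real_of_ereal) \<longlongrightarrow> ereal b) (at_right 0)"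
    using l0 by (auto simp: ereal_tendsto_simps zero_ereal_def)
  have L1: "((ereal \<circ> v_subst b \<circ> real_of_ereal) \<longlongrightarrow> \<infinity>) (at_left \<infinity>)"
  proof -
    have "((ereal \<circ> v_subst b) \<longlongrightarrow> \<infinity>) at_top"
      using l1 by (simp add: ereal_tendsto_simps2)
    then show ?thesis by (simp add: ereal_tendsto_simps1)
  qed
  have lt: "(0::ereal) < \<infinity>" by simp
  have pos': "0 < x" if "0 < ereal x" for x
    using that by simp
  have g0: "0 \<le> (b\<^sup>2 - 1) / (2 * v_subst b x)" if "0 \<le> ereal x" for x
    using that Vpos[of x] b2 by (intro divide_nonneg_pos) auto
  have gc: "isCont (\<lambda>s. (b\<^sup>2 - 1) / (2 * v_subst b s)) x" if "x > 0" for x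
    using Vpos[of x] that by (intro continuous_intros cV) auto
  note sub = interval_integral_substitution_nonneg[where a=0 and b=\<infinity> and g="v_subst b" and f=f
      and g'="\<lambda>s. (b\<^sup>2 - 1) / (2 * v_subst b s)", OF lt d[OF pos'] fc[OF v_subst_gt[OF b pos']] gc[OF pos']
        f0[OF v_subst_gt[OF b pos']] g0 L0 L1, unfolded e, OF _ _ _ _ _ int]
  from sub(1) sub(2)
show "set_integrable lborel {b<..} f"
    "(LINT v:{b<..}|lborel. f v) = (LINT s:{0<..}|lborel. f (v_subst b s) * ((b\<^sup>2 - 1) / (2 * v_subst b s)))"
    unfolding interval_lebesgue_integral_0_infty interval_integral_to_infinity_eq by auto
qed

subsection \<open>Monotonicity of the weights\<close>

lemma antimono_on_add:
  fixes f g :: "real \<Rightarrow> real"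
  assumes "antimono_on S f" "antimono_on S g"
  shows "antimono_on S (\<lambda>x. f x + g x)"
  using assms by (auto simp: monotone_on_def intro: add_mono)

lemma antimono_on_mult:
  fixes f g :: "real \<Rightarrow> real"
  assumes "antimono_on S f" "antimono_on S g" "\<And>x. x \<in> S \<Longrightarrow> f x \<ge> 0" "\<And>x. x \<in> S \<Longrightarrow> g x \<ge> 0"
  shows "antimono_on S (\<lambda>x. f x * g x)"
  using assms by (auto simp: monotone_on_def intro!: mult_mono)

lemma antimono_on_sum:
  fixes f :: "'a \<Rightarrow> real \<Rightarrow> real"
  assumes "\<And>i. i \<in> I \<Longrightarrow> antimono_on S (f i)"
  shows "antimono_on S (\<lambda>x. \<Sum>i\<in>I. f i x)"
  using assms by (auto simp: monotone_on_def intro!: sum_mono)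

lemma antimono_on_cong:
  assumes "antimono_on S f" "\<And>x. x \<in> S \<Longrightarrow> f x = g x"
  shows "antimono_on S g"
  using assms by (simp add: monotone_on_def)

text \<open>
  Differences of decreasing functions need not be decreasing; this relation guarantees that and is
  stable under products.
\<close>

definition dominates :: "real set \<Rightarrow> (real \<Rightarrow> real) \<Rightarrow> (real \<Rightarrow> real) \<Rightarrow> bool" where
  "dominates S f g \<longleftrightarrow>
     antimono_on S g \<and> antimono_on S (\<lambda>x. f x - g x) \<and> (\<forall>x\<in>S. 0 \<le> g x \<and> g x \<le> f x)"

lemma dominates_antimono:
  assumes "dominates S f g"
  shows "antimono_on S f"
proof -
  have "antimono_on S (\<lambda>x. (f x - g x) + g x)"
    using assms by (intro antimono_on_add) (auto simp: dominates_def)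
  then show ?thesis by simp
qed

text \<open>\<open>f f' - g g' = (f - g) f' + g (f' - g')\<close>, and each summand is a product of
  nonnegative decreasing functions.\<close>

lemma dominates_mult:
  assumes "dominates S f g" "dominates S f' g'"
  shows "dominates S (\<lambda>x. f x * f' x) (\<lambda>x. g x * g' x)"
proof -
  have "antimono_on S (\<lambda>x. (f x - g x) * f' x + g x * (f' x - g' x))"
    using assms dominates_antimono[OF assms(2)]
    by (intro antimono_on_add antimono_on_mult) (auto simp: dominates_def intro: order_trans)
  then have "antimono_on S (\<lambda>x. f x * f' x - g x * g' x)"
    by (simp add: algebra_simps)
  moreover have "antimono_on S (\<lambda>x. g x * g' x)"
    using assms by (intro antimono_on_mult) (auto simp: dominates_def)
  ultimately show ?thesis
    using assms by (auto simp: dominates_def intro!: mult_mono intro: order_trans)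
qed

lemma dominates_power:
  assumes "dominates S f g"
  shows "dominates S (\<lambda>x. f x ^ k) (\<lambda>x. g x ^ k)"
proof (induction k)
  case 0
  show ?case by (simp add: dominates_def monotone_on_def)
next
  case (Suc k)
  show ?case using dominates_mult[OF assms Suc] by simp
qed

text \<open>The difference of the two functions is \<open>2 * u\<close> times their product, hence
  decreasing.\<close>

lemma dominates_inverse:
  assumes "0 \<le> u" "u \<le> 1"
  shows "dominates {1<..} (\<lambda>b. 1 / (b - u)) (\<lambda>b. 1 / (b + u))"
proof -
  have *: "antimono_on {1<..} (\<lambda>b. 1 / (b - u))" "antimono_on {1<..} (\<lambda>b. 1 / (b + u))"
    using assms by (auto simp: monotone_on_def intro!: divide_left_mono)
  have "antimono_on {1<..} (\<lambda>b. 2 * u * ((1 / (b - u)) * (1 / (b + u))))"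
    using assms by (intro antimono_on_mult *) (auto simp: monotone_on_def)
  then have "antimono_on {1<..} (\<lambda>b. 1 / (b - u) - 1 / (b + u))"
    by (rule antimono_on_cong) (use assms in \<open>auto simp: diff_frac_eq\<close>)
  with * show ?thesis
    using assms by (auto simp: dominates_def intro!: divide_left_mono)
qed

lemma sum_diff_powers:
  fixes x y :: real
  shows "x ^ m - y ^ m = (x - y) * (\<Sum>i<m. x ^ (m - 1 - i) * y ^ i)"
  using power_diff_sumr2[of y m x] by (simp add: algebra_simps)

section \<open>The weight in u\<close>

text \<open>
  The \<open>b\<close>-dependent factor left by the integration by parts of \<open>M_u\<close>: the derivative of
  \<open>ln ((b\<^sup>2 - u\<^sup>2) / (1 - u\<^sup>2))\<close> times the increment over \<open>[u, 1]\<close> of a primitive of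
  \<open>m ((b - u) ^ -(m + 1) + (b + u) ^ -(m + 1))\<close>, up to the factor \<open>2 u / (1 - u\<^sup>2)\<close>.
\<close>

definition parts_kernel :: "nat \<Rightarrow> real \<Rightarrow> real \<Rightarrow> real" where
  "parts_kernel m u b = (b\<^sup>2 - 1) / (b\<^sup>2 - u\<^sup>2) *
     ((1 / (b - 1) ^ m - 1 / (b + 1) ^ m) - (1 / (b - u) ^ m - 1 / (b + u) ^ m))"

text \<open>The prefactor contains the increasing \<open>b^2 - 1\<close>, so monotonicity of the
  bracket alone would not suffice. Regrouped as \<open>(X^m - x^m) + (y^m - Y^m)\<close>, the
  bracket telescopes into terms that each have a factor \<open>X\<close> or \<open>Y\<close>. This
  factor absorbs \<open>b^2 - 1\<close>, at the price of \<open>b + 1\<close> or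
  \<open>b - 1\<close>, which combine with \<open>x\<close> or \<open>y\<close> in turn. A
  difference with coefficient \<open>1 + u\<close> survives; controlling it is the purpose of
  \<open>dominates\<close>.\<close>

lemma parts_kernel_antimono:
  assumes u: "0 \<le> u" "u < 1"
  shows "antimono_on {1<..} (parts_kernel m u)"
proof -
  define X x y Y where "X = (\<lambda>b::real. 1 / (b - 1))" and "x = (\<lambda>b. 1 / (b - u))"
    and "y = (\<lambda>b. 1 / (b + u))" and "Y = (\<lambda>b::real. 1 / (b + 1))"
  have XY: "dominates {1<..} X Y" and xy: "dominates {1<..} x y"
    unfolding X_def x_def y_def Y_def using dominates_inverse[of 1] dominates_inverse[of u] u by auto
  \<comment> \<open>By \<open>(b^2 - 1) * X = b + 1\<close>,
    \<open>(b + 1) * x = 1 + (1 + u) * x\<close> and the mirrored identities for \<open>Y\<close>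
    and \<open>y\<close>, the telescoped summand of index \<open>i\<close> is
    \<open>(1 - u) * T (m - 1 - i) i b\<close>, apart from the common factor
    \<open>x * y = 1 / (b^2 - u^2)\<close>.\<close>
  define T where "T = (\<lambda>k i b. (X b ^ k * x b ^ i + Y b ^ k * y b ^ i)
      + (1 + u) * (X b ^ k * x b ^ (i + 1) - Y b ^ k * y b ^ (i + 1)))"
  have d: "dominates {1<..} (\<lambda>b. X b ^ k * x b ^ i) (\<lambda>b. Y b ^ k * y b ^ i)" for k i
    by (intro dominates_mult dominates_power XY xy)
  have T: "antimono_on {1<..} (T k i)" for k i
  proof -
    have a: "antimono_on {1<..} (\<lambda>b. X b ^ k * x b ^ i)" by (rule dominates_antimono[OF d])
    have b: "antimono_on {1<..} (\<lambda>b. Y b ^ k * y b ^ i)" using d[of k i] by (simp add: dominates_def)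
    have c: "antimono_on {1<..} (\<lambda>b. X b ^ k * x b ^ (i + 1) - Y b ^ k * y b ^ (i + 1))"
      and c0: "\<And>b. b \<in> {1<..} \<Longrightarrow> X b ^ k * x b ^ (i + 1) - Y b ^ k * y b ^ (i + 1) \<ge> 0"
      using d[of k "i + 1"] unfolding dominates_def by auto
    show ?thesis
      unfolding T_def using u
      by (intro antimono_on_add antimono_on_mult a b c c0) (simp_all add: monotone_on_def)
  qed
  have T0: "T k i b \<ge> 0" if "b > 1" for k i b
  proof -
    have "0 \<le> Y b ^ k * y b ^ i" "Y b ^ k * y b ^ i \<le> X b ^ k * x b ^ i"
      "Y b ^ k * y b ^ (i + 1) \<le> X b ^ k * x b ^ (i + 1)"
      using d[of k i] d[of k "i + 1"] that unfolding dominates_def by auto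
    then show ?thesis
      unfolding T_def using u
      by (intro add_nonneg_nonneg[OF _ mult_nonneg_nonneg[of "1 + u" "_ - _"]]) linarith+
  qed
  have x0: "x b \<ge> 0" "y b \<ge> 0" if "b > 1" for b
    using that u by (auto simp: x_def y_def)
  have xy': "antimono_on {1<..} x" "antimono_on {1<..} y"
    using dominates_antimono[OF xy] xy by (auto simp: dominates_def)
  have "antimono_on {1<..} (\<lambda>b. (1 - u) * ((x b * y b) * (\<Sum>i<m. T (m - 1 - i) i b)))"
    using u by (intro antimono_on_mult antimono_on_sum T xy')
       (auto intro!: sum_nonneg mult_nonneg_nonneg T0 x0 simp: monotone_on_def[where f="\<lambda>_. _"])
  then show ?thesis
  proof (rule antimono_on_cong)
    fix b :: real assume "b \<in> {1<..}"
    then have b: "b > 1" by simp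
    have e1: "X b - x b = (1 - u) * X b * x b" "y b - Y b = (1 - u) * Y b * y b"
      and e2: "(b\<^sup>2 - 1) * X b = b + 1" "(b\<^sup>2 - 1) * Y b = b - 1"
      and e3: "(b + 1) * x b = 1 + (1 + u) * x b" "(b - 1) * y b = 1 - (1 + u) * y b"
      using b u unfolding X_def Y_def x_def y_def by (simp_all add: divide_simps power2_eq_square) (simp_all add: algebra_simps)
    have e4: "1 / (b\<^sup>2 - u\<^sup>2) = x b * y b"
      by (simp add: x_def y_def power2_eq_square algebra_simps)
    have pw: "1 / (b - 1) ^ m = X b ^ m" "1 / (b + 1) ^ m = Y b ^ m" "1 / (b - u) ^ m = x b ^ m"
      "1 / (b + u) ^ m = y b ^ m"
      by (simp_all add: X_def Y_def x_def y_def power_one_over)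
    have "parts_kernel m u b = (x b * y b) * ((b\<^sup>2 - 1) * ((X b ^ m - x b ^ m) - (Y b ^ m - y b ^ m)))"
      unfolding parts_kernel_def pw e4[symmetric]
      by (simp add: algebra_simps add_divide_distrib diff_divide_distrib)
    also have "(b\<^sup>2 - 1) * ((X b ^ m - x b ^ m) - (Y b ^ m - y b ^ m)) =
       (\<Sum>i<m. (b\<^sup>2 - 1) * ((X b - x b) * (X b ^ (m - 1 - i) * x b ^ i)
           + (y b - Y b) * (Y b ^ (m - 1 - i) * y b ^ i)))"
      unfolding sum_diff_powers[of "X b"] sum_diff_powers[of "Y b"]
      by (simp add: sum_distrib_left sum.distrib sum_subtractf algebra_simps)
    also have "\<dots> = (\<Sum>i<m. (1 - u) * T (m - 1 - i) i b)"
    proof (rule sum.cong)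
      fix i
      let ?Z = "X b ^ (m - 1 - i) * x b ^ i" and ?W = "Y b ^ (m - 1 - i) * y b ^ i"
      have "(b\<^sup>2 - 1) * ((X b - x b) * ?Z + (y b - Y b) * ?W) =
         (1 - u) * ((((b\<^sup>2 - 1) * X b) * x b) * ?Z + (((b\<^sup>2 - 1) * Y b) * y b) * ?W)"
        unfolding e1 by (simp add: algebra_simps)
      also have "\<dots> = (1 - u) * T (m - 1 - i) i b"
        unfolding e2 e3 T_def by (simp add: algebra_simps)
      finally show "(b\<^sup>2 - 1) * ((X b - x b) * ?Z + (y b - Y b) * ?W) = (1 - u) * T (m - 1 - i) i b" .
    qed simp
    finally show "(1 - u) * ((x b * y b) * (\<Sum>i<m. T (m - 1 - i) i b)) = parts_kernel m u b"
      by (simp add: sum_distrib_left mult_ac)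
  qed
qed

section \<open>The weight in v\<close>

text \<open>
  The weight in \<open>v\<close> that remains after the substitution \<open>v_subst\<close>, cleared of \<open>2 (b\<^sup>2 - 1) (1 + s)\<^sup>2\<close>.
\<close>

definition Theta :: "nat \<Rightarrow> real \<Rightarrow> real" where
  "Theta p v = (v\<^sup>2 - 1)\<^sup>2 / v * (1 / (v - 1) ^ p - 1 / (v + 1) ^ p)"

text \<open>The half-difference of \<open>X\<close> and \<open>Y\<close> equals
  \<open>X * Y = 1 / (v^2 - 1)\<close>. Hence \<open>Theta p\<close> and its companion
  \<open>S p\<close>, with the sum in place of the difference and one factor \<open>v^2 - 1\<close>
  fewer, obey a coupled recursion. The bound on \<open>p\<close> is sharp:
  \<open>Theta 1 v = 2 * (v^2 - 1) / v\<close> increases, whereas \<open>Theta 2\<close> is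
  constantly 4.\<close>

lemma Theta_antimono:
  assumes "p \<ge> 2"
  shows "antimono_on {1<..} (Theta p)"
proof -
  define X Y where "X = (\<lambda>v::real. 1 / (v - 1))" and "Y = (\<lambda>v::real. 1 / (v + 1))"
  define c where "c = (\<lambda>v. (X v + Y v) / 2)"
  define S where "S = (\<lambda>p v. (v\<^sup>2 - 1) / v * (X v ^ p + Y v ^ p))"
  have Theta: "Theta p v = (v\<^sup>2 - 1)\<^sup>2 / v * (X v ^ p - Y v ^ p)" for p v
    by (simp add: Theta_def X_def Y_def power_one_over)
  have X: "antimono_on {1<..} X" "antimono_on {1<..} Y"
    unfolding X_def Y_def by (auto simp: monotone_on_def intro!: divide_left_mono)
  have XY0: "X v > 0" "Y v > 0" "Y v \<le> X v" if "v > 1" for v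
    using that by (auto simp: X_def Y_def divide_simps)
  have c: "antimono_on {1<..} c" "\<And>v. v > 1 \<Longrightarrow> c v \<ge> 0"
  proof -
    have "antimono_on {1<..} (\<lambda>v. X v + Y v)" by (intro antimono_on_add X)
    then show "antimono_on {1<..} c" unfolding c_def monotone_on_def
      by (meson divide_right_mono zero_le_numeral)
    show "c v \<ge> 0" if "v > 1" for v
      using XY0[OF that] by (simp add: c_def)
  qed
  have pos: "Theta p v \<ge> 0" "S p v \<ge> 0" if "v > 1" for p v
    unfolding Theta S_def using that XY0[OF that] one_le_power[of v 2]
    by (auto intro!: mult_nonneg_nonneg divide_nonneg_pos add_nonneg_nonneg zero_le_power power_mono
        simp: less_imp_le)
  have XYmul: "X v * Y v = 1 / (v\<^sup>2 - 1)" for v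
    by (simp add: X_def Y_def power2_eq_square algebra_simps)
  have rec: "Theta (Suc p) v = c v * Theta p v + S p v"
    "S (Suc p) v = c v * S p v + (X v * Y v) * (X v * Y v) * Theta p v" if v: "v > 1" for p v
  proof -
    have n: "v\<^sup>2 - 1 \<noteq> 0" using one_less_power[OF v, of 2] by simp
    have d: "(X v - Y v) / 2 = X v * Y v" 
      using v by (simp add: X_def Y_def diff_frac_eq)
    \<comment> \<open>Write \<open>X\<close> and \<open>Y\<close> as their mean \<open>c\<close>
      plus and minus the half-difference.\<close>
    have "X v ^ Suc p - Y v ^ Suc p = c v * (X v ^ p - Y v ^ p) + (X v - Y v) / 2 * (X v ^ p + Y v ^ p)"
      "X v ^ Suc p + Y v ^ Suc p = c v * (X v ^ p + Y v ^ p) + (X v - Y v) / 2 * (X v ^ p - Y v ^ p)"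
      by (simp_all add: c_def field_simps)
    note e = this[unfolded d XYmul]
    have f: "D\<^sup>2 / v * (k * y + 1 / D * z) = k * (D\<^sup>2 / v * y) + D / v * z"
      "D / v * (k * z + 1 / D * y) = k * (D / v * z) + 1 / D * (1 / D) * (D\<^sup>2 / v * y)"
      if "D \<noteq> 0" for D k y z :: real
      using v that by (simp_all add: field_simps power2_eq_square)
    show "Theta (Suc p) v = c v * Theta p v + S p v"
      unfolding Theta S_def e(1) by (rule f(1)[OF n])
    show "S (Suc p) v = c v * S p v + (X v * Y v) * (X v * Y v) * Theta p v"
      unfolding Theta S_def e(2) XYmul by (rule f(2)[OF n])
  qed
  have XX: "antimono_on {1<..} (\<lambda>v. (X v * Y v) * (X v * Y v))"
    using XY0 X by (intro antimono_on_mult) (auto simp: less_imp_le)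
  \<comment> \<open>The recursion has positive decreasing coefficients, and both base functions at \<open>p = 2\<close> decrease.\<close>
  have "antimono_on {1<..} (Theta p) \<and> antimono_on {1<..} (S p)"
    using assms
  proof (induction p rule: nat_induct_at_least)
    case base
    have v1: "antimono_on {1<..} (\<lambda>v::real. 1 / v)"
      by (auto simp: monotone_on_def intro!: divide_left_mono)
    have "antimono_on {1<..} (\<lambda>v. 2 * (1 / v) + 4 * ((1 / v) * (X v * Y v)))"
      using XY0 X by (intro antimono_on_add antimono_on_mult v1) (auto simp: monotone_on_def less_imp_le)
    then have "antimono_on {1<..} (S 2)"
    proof (rule antimono_on_cong)
      fix v :: real assume "v \<in> {1<..}"
      then have v: "v > 1" by simp
      then have n: "v\<^sup>2 - 1 > 0" using one_less_power[of v 2] by simp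
      have "X v ^ 2 + Y v ^ 2 = 2 * (v\<^sup>2 + 1) * (X v * Y v)\<^sup>2"
        using v by (simp add: X_def Y_def divide_simps) (simp add: power2_eq_square algebra_simps)
      then have S2: "S 2 v = (v\<^sup>2 - 1) / v * (2 * ((v\<^sup>2 - 1) + 2) * (1 / (v\<^sup>2 - 1))\<^sup>2)"
        unfolding S_def XYmul by simp
      have "2 * (1 / v) + 4 * ((1 / v) * (1 / D)) = D / v * (2 * (D + 2) * (1 / D)\<^sup>2)"
        if "D > 0" for D
        using that v by (simp add: field_simps power2_eq_square)
      from this[OF n] show "2 * (1 / v) + 4 * ((1 / v) * (X v * Y v)) = S 2 v"
        unfolding S2 XYmul .
    qed
    moreover have "antimono_on {1<..} (\<lambda>v::real. 4::real)" by (simp add: monotone_on_def)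
    then have "antimono_on {1<..} (Theta 2)"
    proof (rule antimono_on_cong)
      fix v :: real assume "v \<in> {1<..}"
      then have v: "v > 1" by simp
      then have n: "v\<^sup>2 - 1 > 0" using one_less_power[of v 2] by simp
      have "X v ^ 2 - Y v ^ 2 = 4 * v * (X v * Y v)\<^sup>2"
        using v by (simp add: X_def Y_def divide_simps) (simp add: power2_eq_square algebra_simps)
      then show "4 = Theta 2 v"
        unfolding Theta XYmul using n[THEN less_imp_neq] v by (simp add: power_one_over)
    qed
    ultimately show ?case by simp
  next
    case (Suc p)
    have a: "antimono_on {1<..} (\<lambda>v. c v * Theta p v + S p v)"
      "antimono_on {1<..} (\<lambda>v. c v * S p v + (X v * Y v) * (X v * Y v) * Theta p v)"
      using Suc c pos XX XY0
      by (intro antimono_on_add antimono_on_mult[of _ c] antimono_on_mult[of _ "\<lambda>v. (X v * Y v) * (X v * Y v)"];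
          auto simp: less_imp_le)+
    show ?case
      by (intro conjI antimono_on_cong[OF a(1)] antimono_on_cong[OF a(2)] rec[symmetric]) auto
  qed
  then show ?thesis ..
qed

lemma Theta_nonneg: "v > 1 \<Longrightarrow> Theta p v \<ge> 0"
  unfolding Theta_def
  by (intro mult_nonneg_nonneg) (auto intro!: divide_left_mono power_mono)

text \<open>As \<open>v^2 - 1 = (v - 1) * (v + 1)\<close>, the rescaling clears every denominator
  but \<open>v\<close>. The result is regular at \<open>v = 1\<close> with value
  \<open>2 ^ p\<close>, which the limit at \<open>b = 1\<close> reads off.\<close>

lemma Theta_scaled:
  assumes "v > 1" "p \<ge> 2"
  shows "(v\<^sup>2 - 1) ^ (p - 2) * Theta p v = ((v + 1) ^ p - (v - 1) ^ p) / v"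
proof -
  have "v\<^sup>2 - 1 = (v - 1) * (v + 1)" by (simp add: power2_eq_square algebra_simps)
  then have e: "(v - 1) ^ p * (v + 1) ^ p = (v\<^sup>2 - 1) ^ (p - 2) * (v\<^sup>2 - 1)\<^sup>2"
    using assms(2) by (metis power_mult_distrib power_add le_add_diff_inverse2)
  have "1 / (v - 1) ^ p - 1 / (v + 1) ^ p = ((v + 1) ^ p - (v - 1) ^ p) / ((v - 1) ^ p * (v + 1) ^ p)"
    using assms by (simp add: diff_frac_eq)
  moreover have "v\<^sup>2 - 1 \<noteq> 0" using one_less_power[OF assms(1), of 2] by simp
  ultimately show ?thesis
    unfolding Theta_def e by simp
qed

text \<open>Telescoping \<open>(v + 1) ^ p - (v - 1) ^ p\<close> saves one power of \<open>v\<close>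
  against estimating \<open>(v + 1) ^ p\<close> alone; the decay of \<open>M_v\<close> at infinity
  depends on it.\<close>

lemma Theta_bound:
  assumes "v > 1" "p \<ge> 2"
  shows "(v\<^sup>2 - 1) ^ (p - 2) * Theta p v \<le> real p * 2 ^ p * v ^ (p - 2)"
proof -
  obtain k where p: "p = Suc (Suc k)" using assms(2) by (metis Suc_le_D numeral_2_eq_2 Suc_le_mono)
  have "(v + 1) ^ p - (v - 1) ^ p = 2 * (\<Sum>i<p. (v + 1) ^ (p - 1 - i) * (v - 1) ^ i)"
    unfolding sum_diff_powers[of "v + 1"] by simp
  also have "(\<Sum>i<p. (v + 1) ^ (p - 1 - i) * (v - 1) ^ i) \<le> (\<Sum>i<p. (2 * v) ^ (p - 1))"
  proof (rule sum_mono)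
    fix i assume i: "i \<in> {..<p}"
    have "(v + 1) ^ (p - 1 - i) * (v - 1) ^ i \<le> (2 * v) ^ (p - 1 - i) * (2 * v) ^ i"
      using assms by (intro mult_mono power_mono) auto
    also have "\<dots> = (2 * v) ^ (p - 1)"
    proof -
      have "p - 1 = (p - 1 - i) + i" using i by simp
      then show ?thesis by (metis power_add)
    qed
    finally show "(v + 1) ^ (p - 1 - i) * (v - 1) ^ i \<le> (2 * v) ^ (p - 1)" .
  qed
  finally have "(v + 1) ^ p - (v - 1) ^ p \<le> real p * 2 ^ p * v ^ (p - 1)"
    by (simp add: p power_mult_distrib mult_ac)
  then show ?thesis
    unfolding Theta_scaled[OF assms] using assms(1) by (simp add: p divide_le_eq mult_ac)
qed

subsection \<open>The part of M depending on the logarithm of v\<close>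

text \<open>The weight is \<open>m + 1\<close> times the integral of
  \<open>1 / (v - u) ^ (m + 2)\<close> over \<open>u\<close> in \<open>(-1, 1)\<close>.\<close>

definition M_v :: "nat \<Rightarrow> real \<Rightarrow> real" where
  "M_v m b = (LINT v:{b<..}|lborel. ln ((v\<^sup>2 - 1) / (v\<^sup>2 - b\<^sup>2)) * (1 / (v - 1) ^ (m + 1) - 1 / (v + 1) ^ (m + 1)))"

lemma set_integral_nonneg:
  fixes f :: "'a \<Rightarrow> real"
  assumes "\<And>x. x \<in> A \<Longrightarrow> f x \<ge> 0"
  shows "(LINT x:A|N. f x) \<ge> 0"
  unfolding set_lebesgue_integral_def using assms
  by (intro Bochner_Integration.integral_nonneg) (simp add: indicator_def)

lemma inverse_powers_diff_nonneg:
  fixes v :: real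
  assumes "v > 1"
  shows "1 / (v - 1) ^ p - 1 / (v + 1) ^ p \<ge> 0"
  using assms power_mono[of "v - 1" "v + 1" p] by (simp add: divide_left_mono)

text \<open>The square is the factor \<open>(1 + s)^2\<close> that was cleared from
  \<open>Theta\<close>. This function, times a constant, dominates the integrands in
  \<open>s\<close> for every \<open>m\<close>.\<close>

lemma kern2_integrable: "set_integrable lborel {0<..} (\<lambda>s. kern s / (1 + s)\<^sup>2)"
  using kern_integrable[of 1] by (simp add: power2_eq_square)

lemma isCont_Theta: "v > 1 \<Longrightarrow> isCont (Theta p) v"
  unfolding Theta_def by (intro continuous_intros) auto

lemma continuous_on_v_subst: "continuous_on A (\<lambda>s. v_subst b s)"
  unfolding v_subst_def by (intro continuous_intros)

lemma tendsto_v_subst: "((\<lambda>b. v_subst b s) \<longlongrightarrow> v_subst c s) (at c within A)"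
  unfolding v_subst_def by (intro tendsto_intros)

lemma continuous_on_Theta_v_subst:
  assumes "b > 1"
  shows "continuous_on {0<..} (\<lambda>s. kern s / (1 + s)\<^sup>2 * Theta p (v_subst b s))"
proof -
  have "continuous_on {0<..} (\<lambda>s. Theta p (v_subst b s))"
    by (rule continuous_on_compose2[where t="{1<..}" and g="Theta p", OF _ continuous_on_v_subst])
       (use isCont_Theta v_subst_gt[OF assms] assms in \<open>force intro!: continuous_at_imp_continuous_on\<close>)+
  then show ?thesis
    by (intro continuous_intros) auto
qed

text \<open>Monotonicity of \<open>Theta\<close> doubles as domination: since
  \<open>v_subst b s \<ge> b \<ge> c\<close>, the weight can be frozen at \<open>c\<close>,
  uniformly in \<open>b\<close> and \<open>s\<close>.\<close>

lemma Theta_v_subst_le: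
  assumes "1 < c" "c \<le> b" "s > 0" "p \<ge> 2"
  shows "kern s / (1 + s)\<^sup>2 * Theta p (v_subst b s) \<le> kern s / (1 + s)\<^sup>2 * Theta p c"
proof (rule mult_left_mono)
  have "c \<le> v_subst b s" using v_subst_ge[of b s] assms by linarith
  then show "Theta p (v_subst b s) \<le> Theta p c"
    using Theta_antimono[OF assms(4)] assms(1) by (auto simp: monotone_on_def)
qed (use assms kern_nonneg in auto)

lemma Theta_v_subst_nonneg:
  assumes "1 < b" "s > 0"
  shows "kern s / (1 + s)\<^sup>2 * Theta p (v_subst b s) \<ge> 0"
  using assms v_subst_gt[OF assms] by (intro mult_nonneg_nonneg Theta_nonneg) (auto simp: kern_nonneg)

lemma Theta_v_subst_integral_nonneg:
  "b > 1 \<Longrightarrow> (LINT s:{0<..}|lborel. kern s / (1 + s)\<^sup>2 * Theta p (v_subst b s)) \<ge> 0"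
  by (rule set_integral_nonneg[OF Theta_v_subst_nonneg]) auto

lemma Theta_v_subst_integrable:
  assumes "b > 1" "p \<ge> 2"
  shows "set_integrable lborel {0<..} (\<lambda>s. kern s / (1 + s)\<^sup>2 * Theta p (v_subst b s))"
proof (rule set_integrable_bound_continuous)
  show "set_integrable lborel {0<..} (\<lambda>s. kern s / (1 + s)\<^sup>2 * Theta p b)"
    by (intro set_integrable_mult_left kern2_integrable)
  show "continuous_on {0<..} (\<lambda>s. kern s / (1 + s)\<^sup>2 * Theta p (v_subst b s))"
    by (rule continuous_on_Theta_v_subst[OF assms(1)])
  show "\<bar>kern s / (1 + s)\<^sup>2 * Theta p (v_subst b s)\<bar> \<le> kern s / (1 + s)\<^sup>2 * Theta p b" if "s \<in> {0<..}" for s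
    using that Theta_v_subst_le[of b b s p] Theta_v_subst_nonneg[of b s p] assms by simp
qed auto

lemma
  assumes b: "b > 1" and m: "m \<ge> 1"
  shows M_v_integrable: "set_integrable lborel {b<..}
      (\<lambda>v. ln ((v\<^sup>2 - 1) / (v\<^sup>2 - b\<^sup>2)) * (1 / (v - 1) ^ (m + 1) - 1 / (v + 1) ^ (m + 1)))"
    and M_v_eq: "M_v m b = 1 / (2 * (b\<^sup>2 - 1)) *
      (LINT s:{0<..}|lborel. kern s / (1 + s)\<^sup>2 * Theta (m + 1) (v_subst b s))"
proof -
  have b2: "b\<^sup>2 > 1" using b by (simp add: one_less_power)
  let ?f = "\<lambda>v. ln ((v\<^sup>2 - 1) / (v\<^sup>2 - b\<^sup>2)) * (1 / (v - 1) ^ (m + 1) - 1 / (v + 1) ^ (m + 1))"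
  have vb: "v\<^sup>2 > b\<^sup>2" if "v > b" for v
    using that b by (simp add: power_strict_mono)
  have f0: "?f v \<ge> 0" if "v > b" for v
    using vb[OF that] b2 b that
    by (intro mult_nonneg_nonneg ln_ge_zero inverse_powers_diff_nonneg) (auto simp: le_divide_eq)
  have fc: "isCont ?f v" if "v > b" for v
    using vb[OF that] b that by (intro continuous_intros) (auto simp: power2_eq_1_iff)
  \<comment> \<open>Since \<open>v^2 - 1 = (b^2 - 1) * (1 + s)\<close>, the square in
    \<open>Theta\<close> accounts for \<open>(b^2 - 1)^2 * (1 + s)^2\<close>; one factor
    \<open>b^2 - 1\<close> comes back from \<open>dv\<close>.\<close>
  have eq: "?f (v_subst b s) * ((b\<^sup>2 - 1) / (2 * v_subst b s)) =
      1 / (2 * (b\<^sup>2 - 1)) * (kern s / (1 + s)\<^sup>2 * Theta (m + 1) (v_subst b s))" if s: "s \<in> {0<..}" for s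
  proof -
    define v where "v = v_subst b s"
    define g where "g = 1 / (v - 1) ^ (m + 1) - 1 / (v + 1) ^ (m + 1)"
    have v: "v > 0" using v_subst_gt[of b s] b s by (simp add: v_def)
    have v1: "v\<^sup>2 - 1 = (b\<^sup>2 - 1) * (1 + s)" and v2: "v\<^sup>2 - b\<^sup>2 = (b\<^sup>2 - 1) * s"
      using v_subst_squared[of b s] b s by (simp_all add: v_def algebra_simps)
    have k: "ln ((v\<^sup>2 - 1) / (v\<^sup>2 - b\<^sup>2)) = kern s"
      unfolding v1 v2 kern_def using b2 by simp
    have "Theta (m + 1) v = ((b\<^sup>2 - 1) * (1 + s))\<^sup>2 / v * g"
      unfolding Theta_def v1 g_def ..
    moreover have "K * g * (D / (2 * v)) = 1 / (2 * D) * (K / E\<^sup>2 * ((D * E)\<^sup>2 / v * g))"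
      if "D > 0" "E > 0" for K D E
      using that v by (simp add: field_simps power2_eq_square)
    from this[of "b\<^sup>2 - 1" "1 + s" "kern s"] b2 s have "kern s * g * ((b\<^sup>2 - 1) / (2 * v)) =
       1 / (2 * (b\<^sup>2 - 1)) * (kern s / (1 + s)\<^sup>2 * (((b\<^sup>2 - 1) * (1 + s))\<^sup>2 / v * g))" by simp
    ultimately show ?thesis
      unfolding v_def[symmetric] g_def[symmetric] k by simp
  qed
  have "set_integrable lborel {0<..} (\<lambda>s. 1 / (2 * (b\<^sup>2 - 1)) * (kern s / (1 + s)\<^sup>2 * Theta (m + 1) (v_subst b s)))"
    using Theta_v_subst_integrable[OF b, of "m + 1"] m by (intro set_integrable_mult_right) auto
  then have i: "set_integrable lborel {0<..} (\<lambda>s. ?f (v_subst b s) * ((b\<^sup>2 - 1) / (2 * v_subst b s)))"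
    by (subst set_integrable_cong[OF refl refl eq])
  show "set_integrable lborel {b<..} ?f"
    by (rule change_v_integrable[OF b f0 fc i])
  have "M_v m b = (LINT s:{0<..}|lborel. ?f (v_subst b s) * ((b\<^sup>2 - 1) / (2 * v_subst b s)))"
    unfolding M_v_def by (rule change_v_integral[OF b f0 fc i])
  also have "\<dots> = (LINT s:{0<..}|lborel. 1 / (2 * (b\<^sup>2 - 1)) * (kern s / (1 + s)\<^sup>2 * Theta (m + 1) (v_subst b s)))"
    by (rule set_lebesgue_integral_cong) (use eq in auto)
  finally show "M_v m b = 1 / (2 * (b\<^sup>2 - 1)) *
      (LINT s:{0<..}|lborel. kern s / (1 + s)\<^sup>2 * Theta (m + 1) (v_subst b s))"
    by (simp only: set_integral_mult_right)
qed

lemma M_v_nonneg: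
  assumes "b > 1" "m \<ge> 1"
  shows "M_v m b \<ge> 0"
  unfolding M_v_eq[OF assms] using assms one_less_power[of b 2]
  by (intro mult_nonneg_nonneg Theta_v_subst_integral_nonneg) auto

lemma M_v_antimono:
  assumes "m \<ge> 1"
  shows "antimono_on {1<..} (M_v m)"
proof (rule monotone_onI)
  fix b c :: real assume bc: "b \<in> {1<..}" "c \<in> {1<..}" "b \<le> c"
  then have b: "b > 1" and c: "c > 1" by auto
  have "kern s / (1 + s)\<^sup>2 * Theta (m + 1) (v_subst c s) \<le> kern s / (1 + s)\<^sup>2 * Theta (m + 1) (v_subst b s)" if "s > 0" for s
  proof (rule mult_left_mono)
    show "Theta (m + 1) (v_subst c s) \<le> Theta (m + 1) (v_subst b s)"
      using Theta_antimono[of "m + 1"] assms v_subst_mono[OF b bc(3), of s] v_subst_gt[OF b that] v_subst_gt[OF c that] b c that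
      by (auto simp: monotone_on_def)
  qed (use that kern_nonneg in auto)
  then have "(LINT s:{0<..}|lborel. kern s / (1 + s)\<^sup>2 * Theta (m + 1) (v_subst c s))
      \<le> (LINT s:{0<..}|lborel. kern s / (1 + s)\<^sup>2 * Theta (m + 1) (v_subst b s))"
    using assms by (intro set_integral_mono Theta_v_subst_integrable b c) auto
  moreover have "1 / (2 * (c\<^sup>2 - 1)) \<le> 1 / (2 * (b\<^sup>2 - 1))"
    using b c bc one_less_power[of b 2] one_less_power[of c 2]
    by (intro divide_left_mono mult_pos_pos mult_left_mono diff_right_mono power_mono) auto
  ultimately show "M_v m c \<le> M_v m b"
    unfolding M_v_eq[OF b assms] M_v_eq[OF c assms] using b c one_less_power[of b 2]
    by (intro mult_mono Theta_v_subst_integral_nonneg) auto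
qed

lemma M_v_continuous:
  assumes m: "m \<ge> 1"
  shows "continuous_on {1<..} (M_v m)"
proof -
  let ?I = "\<lambda>b. LINT s:{0<..}|lborel. kern s / (1 + s)\<^sup>2 * Theta (m + 1) (v_subst b s)"
  have "isCont (M_v m) b" if b: "b > 1" for b
  proof -
    define c where "c = (1 + b) / 2"
    have c: "c > 1" "c < b" using b by (auto simp: c_def)
    have "(?I \<longlongrightarrow> ?I b) (at b within {c<..})"
    proof (rule set_integral_tendsto_at_within)
      show "set_integrable lborel {0<..} (\<lambda>s. kern s / (1 + s)\<^sup>2 * Theta (m + 1) c)"
        by (intro set_integrable_mult_left kern2_integrable)
      show "continuous_on {0<..} (\<lambda>s. kern s / (1 + s)\<^sup>2 * Theta (m + 1) (v_subst t s))" if "t \<in> {c<..}" for t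
        using that c by (intro continuous_on_Theta_v_subst) auto
      show "continuous_on {0<..} (\<lambda>s. kern s / (1 + s)\<^sup>2 * Theta (m + 1) (v_subst b s))"
        using b by (intro continuous_on_Theta_v_subst) auto
      show "\<bar>kern s / (1 + s)\<^sup>2 * Theta (m + 1) (v_subst t s)\<bar> \<le> kern s / (1 + s)\<^sup>2 * Theta (m + 1) c"
        if "t \<in> {c<..}" "s \<in> {0<..}" for t s
        using that c m Theta_v_subst_le[of c t s "m + 1"] Theta_v_subst_nonneg[of t s "m + 1"] by auto
      show "((\<lambda>t. kern s / (1 + s)\<^sup>2 * Theta (m + 1) (v_subst t s)) \<longlongrightarrow>
          kern s / (1 + s)\<^sup>2 * Theta (m + 1) (v_subst b s)) (at b within {c<..})" if "s \<in> {0<..}" for s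
      proof (intro tendsto_intros isCont_tendsto_compose[OF isCont_Theta])
        show "1 < v_subst b s" using v_subst_gt[of b s] b that by simp
        show "((\<lambda>t. v_subst t s) \<longlongrightarrow> v_subst b s) (at b within {c<..})"
          by (rule tendsto_v_subst)
      qed
    qed auto
    then have "(?I \<longlongrightarrow> ?I b) (at b)"
      using c by (simp add: at_within_open[of b "{c<..}"])
    then have *: "((\<lambda>b. 1 / (2 * (b\<^sup>2 - 1)) * ?I b) \<longlongrightarrow> 1 / (2 * (b\<^sup>2 - 1)) * ?I b) (at b)"
      using b by (intro tendsto_intros) (auto simp: power2_eq_1_iff)
    have "\<forall>\<^sub>F t in at b. 1 / (2 * (t\<^sup>2 - 1)) * ?I t = M_v m t"
      using eventually_at_in_open'[of "{1<..}" b] b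
      by (auto elim!: eventually_mono simp: M_v_eq[OF _ m])
    from Lim_transform_eventually[OF * this] show ?thesis
      unfolding isCont_def M_v_eq[OF b m] .
  qed
  then show ?thesis by (intro continuous_at_imp_continuous_on) auto
qed

text \<open>For fixed \<open>s\<close>, \<open>v_subst b s\<close> tends to 1. With
  \<open>p = m + 1\<close>, \<open>Theta_scaled\<close> uses up \<open>m - 1\<close> powers of
  \<open>b^2 - 1\<close>, and the last power cancels the prefactor in \<open>M_v_eq\<close>. The
  limit \<open>2 ^ (m + 1)\<close> of the rescaled weight is cancelled by
  \<open>1 / (2 * (b + 1) ^ m)\<close>, which is what remains of \<open>(b - 1) ^ m\<close> and the
  prefactor.\<close>

lemma M_v_at_1:
  assumes m: "m \<ge> 1"
  shows "((\<lambda>b. (b - 1) ^ m * M_v m b) \<longlongrightarrow> P m 1 / real m) (at_right 1)"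
proof -
  \<comment> \<open>The cut at 2 gives \<open>v_subst\<close> a bound uniform in
    \<open>b\<close>.\<close>
  have at: "at_right 1 = at 1 within {1<..<2::real}"
    by (rule at_within_nhd[of _ "{..<2}"]) auto
  let ?I = "\<lambda>b. LINT s:{0<..}|lborel. kern s / (1 + s)\<^sup>2 * ((b\<^sup>2 - 1) ^ (m - 1) * Theta (m + 1) (v_subst b s))"
  have resc: "(b\<^sup>2 - 1) ^ (m - 1) * Theta (m + 1) (v_subst b s) =
      ((v_subst b s)\<^sup>2 - 1) ^ (m - 1) * Theta (m + 1) (v_subst b s) / (1 + s) ^ (m - 1)" if "b > 1" "s > 0" for b s
    using that by (simp add: v_subst_squared power_mult_distrib)
  \<comment> \<open>Growth at most linear in \<open>s\<close> is matched by the power of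
    \<open>1 + s\<close> in \<open>resc\<close>, so the rescaled weight is bounded by a
    constant.\<close>
  have V2: "v_subst b s \<le> 2 * (1 + s)" if "b > 1" "b < 2" "s > 0" for b s
  proof (rule power2_le_imp_le)
    have "b\<^sup>2 \<le> 4" using that power_mono[of b 2 2] by simp
    then have "(b\<^sup>2 - 1) * (1 + s) \<le> 3 * (1 + s)" using that by (intro mult_right_mono) auto
    then have "(v_subst b s)\<^sup>2 \<le> 1 + 3 * (1 + s)"
      using that v_subst_squared[of b s] by simp
    also have "\<dots> \<le> 4 + 8 * s" using that by simp
    also have "\<dots> \<le> 4 + 8 * s + 4 * s\<^sup>2" by simp
    also have "\<dots> = (2 * (1 + s))\<^sup>2" by (simp add: power2_eq_square algebra_simps)
    finally show "(v_subst b s)\<^sup>2 \<le> (2 * (1 + s))\<^sup>2" .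
  qed (use that in auto)
  have lim: "(?I \<longlongrightarrow> (LINT s:{0<..}|lborel. kern s / (1 + s)\<^sup>2 * (2 ^ (m + 1) / (1 + s) ^ (m - 1)))) (at_right 1)"
    unfolding at
  proof (rule set_integral_tendsto_at_within)
    define C where "C = real (m + 1) * 2 ^ (m + 1) * 2 ^ (m - 1)"
    show "set_integrable lborel {0<..} (\<lambda>s. kern s / (1 + s)\<^sup>2 * C)"
      by (intro set_integrable_mult_left kern2_integrable)
    show "continuous_on {0<..} (\<lambda>s. kern s / (1 + s)\<^sup>2 * ((t\<^sup>2 - 1) ^ (m - 1) * Theta (m + 1) (v_subst t s)))"
      if "t \<in> {1<..<2}" for t
      using continuous_on_mult_right[OF continuous_on_Theta_v_subst[of t "m + 1"], of "(t\<^sup>2 - 1) ^ (m - 1)"] that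
      by (simp add: mult_ac)
    show "continuous_on {0<..} (\<lambda>s. kern s / (1 + s)\<^sup>2 * (2 ^ (m + 1) / (1 + s) ^ (m - 1)))"
      by (intro continuous_intros) auto
    show "\<bar>kern s / (1 + s)\<^sup>2 * ((t\<^sup>2 - 1) ^ (m - 1) * Theta (m + 1) (v_subst t s))\<bar> \<le> kern s / (1 + s)\<^sup>2 * C"
      if "t \<in> {1<..<2}" "s \<in> {0<..}" for t s
    proof -
      have t: "t > 1" "t < 2" and s: "s > 0" using that by auto
      have "(t\<^sup>2 - 1) ^ (m - 1) * Theta (m + 1) (v_subst t s) =
          ((v_subst t s)\<^sup>2 - 1) ^ (m - 1) * Theta (m + 1) (v_subst t s) / (1 + s) ^ (m - 1)"
        by (rule resc) fact+
      also have "\<dots> \<le> (real (m + 1) * 2 ^ (m + 1) * v_subst t s ^ (m - 1)) / (1 + s) ^ (m - 1)"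
        using Theta_bound[of "v_subst t s" "m + 1"] m v_subst_gt[OF t(1) s] t s by (intro divide_right_mono) auto
      also have "\<dots> \<le> (real (m + 1) * 2 ^ (m + 1) * (2 * (1 + s)) ^ (m - 1)) / (1 + s) ^ (m - 1)"
        using V2[OF t s] v_subst_gt[OF t(1) s] t s
        by (intro divide_right_mono mult_left_mono power_mono) auto
      also have "\<dots> = C"
        unfolding C_def power_mult_distrib using s by simp
      finally have "(t\<^sup>2 - 1) ^ (m - 1) * Theta (m + 1) (v_subst t s) \<le> C" .
      moreover have "(t\<^sup>2 - 1) ^ (m - 1) * Theta (m + 1) (v_subst t s) \<ge> 0"
        using Theta_nonneg[of "v_subst t s"] v_subst_gt[OF t(1) s] t one_less_power[of t 2] by simp
      ultimately show ?thesis
        using divide_nonneg_nonneg[OF kern_nonneg[OF s], of "(1 + s)\<^sup>2"]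
        by (subst abs_of_nonneg) (auto intro!: mult_nonneg_nonneg mult_left_mono simp del: times_divide_eq_left)
    qed
    show "((\<lambda>t. kern s / (1 + s)\<^sup>2 * ((t\<^sup>2 - 1) ^ (m - 1) * Theta (m + 1) (v_subst t s))) \<longlongrightarrow>
        kern s / (1 + s)\<^sup>2 * (2 ^ (m + 1) / (1 + s) ^ (m - 1))) (at 1 within {1<..<2})"
      if "s \<in> {0<..}" for s
    proof (rule tendsto_mult_left)
      have s: "s > 0" using that by simp
      have "((\<lambda>t. v_subst t s) \<longlongrightarrow> v_subst 1 s) (at 1 within {1<..<2})"
        by (rule tendsto_v_subst)
      then have V: "((\<lambda>t. v_subst t s) \<longlongrightarrow> 1) (at 1 within {1<..<2})" by (simp add: v_subst_def)
      have "((\<lambda>t. ((v_subst t s + 1) ^ (m + 1) - (v_subst t s - 1) ^ (m + 1)) / v_subst t s / (1 + s) ^ (m - 1)) \<longlongrightarrow>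
          ((1 + 1) ^ (m + 1) - (1 - 1) ^ (m + 1)) / 1 / (1 + s) ^ (m - 1)) (at 1 within {1<..<2})"
        using s by (intro tendsto_intros V) auto
      then have *: "((\<lambda>t. ((v_subst t s + 1) ^ (m + 1) - (v_subst t s - 1) ^ (m + 1)) / v_subst t s / (1 + s) ^ (m - 1)) \<longlongrightarrow>
          2 ^ (m + 1) / (1 + s) ^ (m - 1)) (at 1 within {1<..<2})" by simp
      have "\<forall>\<^sub>F t in at 1 within {1<..<2}.
          ((v_subst t s + 1) ^ (m + 1) - (v_subst t s - 1) ^ (m + 1)) / v_subst t s / (1 + s) ^ (m - 1) =
          (t\<^sup>2 - 1) ^ (m - 1) * Theta (m + 1) (v_subst t s)"
      proof -
        have "((v_subst t s + 1) ^ (m + 1) - (v_subst t s - 1) ^ (m + 1)) / v_subst t s / (1 + s) ^ (m - 1) =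
            (t\<^sup>2 - 1) ^ (m - 1) * Theta (m + 1) (v_subst t s)" if t: "t > 1" for t
        proof -
          have "m + 1 - 2 = m - 1" "v_subst t s > 1" "m + 1 \<ge> 2" using v_subst_gt[OF t s] t m by auto
          note * = Theta_scaled[OF this(2,3), unfolded this(1)]
          show ?thesis unfolding resc[OF t s] * ..
        qed
        then show ?thesis
          by (auto simp: eventually_at_filter intro!: always_eventually)
      qed
      from Lim_transform_eventually[OF * this]
      show "((\<lambda>t. (t\<^sup>2 - 1) ^ (m - 1) * Theta (m + 1) (v_subst t s)) \<longlongrightarrow> 2 ^ (m + 1) / (1 + s) ^ (m - 1))
          (at 1 within {1<..<2})" .
    qed
  qed auto
  have "(LINT s:{0<..}|lborel. kern s / (1 + s)\<^sup>2 * (2 ^ (m + 1) / (1 + s) ^ (m - 1)))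
     = (LINT s:{0<..}|lborel. 2 ^ (m + 1) * (kern s / (1 + s) ^ (m + 1)))"
  proof (rule set_lebesgue_integral_cong)
    have "m + 1 = 2 + (m - 1)" using m by simp
    then show "\<forall>s. s \<in> {0<..} \<longrightarrow> kern s / (1 + s)\<^sup>2 * (2 ^ (m + 1) / (1 + s) ^ (m - 1)) =
        2 ^ (m + 1) * (kern s / (1 + s) ^ (m + 1))"
      by (metis (no_types, opaque_lifting) mult.commute power_add times_divide_eq_left times_divide_eq_right
            divide_divide_eq_left)
  qed simp
  also have "\<dots> = 2 ^ (m + 1) * (P m 1 / real m)"
    by (simp only: set_integral_mult_right kern_integral[OF m])
  finally have lim': "(?I \<longlongrightarrow> 2 ^ (m + 1) * (P m 1 / real m)) (at_right 1)"
    using lim by simp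
  have "((\<lambda>b::real. 1 / (2 * (b + 1) ^ m)) \<longlongrightarrow> 1 / (2 * (1 + 1) ^ m)) (at_right 1)"
    by (intro tendsto_intros) auto
  from tendsto_mult[OF this lim']
  have *: "((\<lambda>b. 1 / (2 * (b + 1) ^ m) * ?I b) \<longlongrightarrow> P m 1 / real m) (at_right 1)" by simp
  have ev: "\<forall>\<^sub>F b in at_right 1. 1 / (2 * (b + 1) ^ m) * ?I b = (b - 1) ^ m * M_v m b"
    unfolding eventually_at_filter
  proof (intro always_eventually allI impI)
    fix b :: real assume "b \<in> {1<..}"
    then have b: "b > 1" by simp
    obtain k where k: "m = Suc k" using m by (cases m) auto
    have e: "b\<^sup>2 - 1 = (b - 1) * (b + 1)" by (simp add: power2_eq_square algebra_simps)
    have "?I b = (LINT s:{0<..}|lborel. (b\<^sup>2 - 1) ^ (m - 1) * (kern s / (1 + s)\<^sup>2 * Theta (m + 1) (v_subst b s)))"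
      by (intro set_lebesgue_integral_cong) (auto simp: mult_ac)
    then have I: "?I b = (b\<^sup>2 - 1) ^ (m - 1) * (LINT s:{0<..}|lborel. kern s / (1 + s)\<^sup>2 * Theta (m + 1) (v_subst b s))"
      by (simp only: set_integral_mult_right)
    show "1 / (2 * (b + 1) ^ m) * ?I b = (b - 1) ^ m * M_v m b"
      unfolding I M_v_eq[OF b m] unfolding e k power_mult_distrib using b by simp
  qed
  show ?thesis by (rule Lim_transform_eventually[OF * ev])
qed

text \<open>The substitution frees the logarithm in \<open>v\<close> from \<open>b\<close>, so
  \<open>b ^ (m + 1) * M_v m b\<close> is bounded already without dividing by
  \<open>ln b\<close>.\<close>

lemma M_v_at_top:
  assumes m: "m \<ge> 1"
  shows "((\<lambda>b. b ^ (m + 1) / ln b * M_v m b) \<longlongrightarrow> 0) at_top"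
proof -
  define I where "I = (LINT s:{0<..}|lborel. kern s / (1 + s)\<^sup>2)"
  have I0: "I \<ge> 0" unfolding I_def by (intro set_integral_nonneg) (auto simp: kern_nonneg)
  define C where "C = real (m + 1) * 2 ^ (m + 1) * 2 ^ m * I"
  have C0: "C \<ge> 0" using I0 by (simp add: C_def)
  have bd: "b ^ (m + 1) * M_v m b \<le> C" if b: "b \<ge> 2" for b
  proof -
    have b1: "b > 1" using b by simp
    define D where "D = b\<^sup>2 - 1"
    have D: "D > 0" using one_less_power[of b 2] b by (simp add: D_def)
    \<comment> \<open>Makes \<open>(b^2 / D) ^ m\<close>, all that is left of the powers of
      \<open>b\<close>, at most \<open>2 ^ m\<close>.\<close>
    have DB: "b\<^sup>2 \<le> 2 * D" using b power_mono[of 2 b 2] by (simp add: D_def)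
    have "(LINT s:{0<..}|lborel. kern s / (1 + s)\<^sup>2 * Theta (m + 1) (v_subst b s)) \<le>
        (LINT s:{0<..}|lborel. kern s / (1 + s)\<^sup>2 * Theta (m + 1) b)"
      using m b1 Theta_v_subst_le[OF b1 order.refl]
      by (intro set_integral_mono Theta_v_subst_integrable set_integrable_mult_left kern2_integrable) auto
    then have "M_v m b \<le> 1 / (2 * D) * (I * Theta (m + 1) b)"
      unfolding M_v_eq[OF b1 m] D_def[symmetric] I_def set_integral_mult_left using D
      by (intro mult_left_mono) auto
    also have "\<dots> \<le> 1 / D * (I * Theta (m + 1) b)"
      using D I0 Theta_nonneg[OF b1] by (intro mult_right_mono mult_nonneg_nonneg) (auto intro!: divide_left_mono)
    also have "\<dots> = I / D ^ m * (D ^ (m - 1) * Theta (m + 1) b)"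
      using D m by (cases m) auto
    also have "\<dots> \<le> I / D ^ m * (real (m + 1) * 2 ^ (m + 1) * b ^ (m - 1))"
      using Theta_bound[OF b1, of "m + 1"] m I0 D by (intro mult_left_mono) (auto simp: D_def)
    finally have "b ^ (m + 1) * M_v m b \<le> b ^ (m + 1) * (I / D ^ m * (real (m + 1) * 2 ^ (m + 1) * b ^ (m - 1)))"
      using b by (intro mult_left_mono) auto
    also have "b ^ (m + 1) * (I / D ^ m * (real (m + 1) * 2 ^ (m + 1) * b ^ (m - 1))) =
       real (m + 1) * 2 ^ (m + 1) * I * (b\<^sup>2 / D) ^ m"
      using m by (cases m) (auto simp: power_divide power_mult[symmetric] power2_eq_square mult_ac
          power_mult_distrib)
    also have "\<dots> \<le> real (m + 1) * 2 ^ (m + 1) * I * 2 ^ m"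
      using DB D I0 by (intro mult_left_mono power_mono) (auto simp: divide_le_eq)
    finally show ?thesis by (simp add: C_def mult_ac)
  qed
  show ?thesis
  proof (rule Lim_null_comparison)
    show "\<forall>\<^sub>F b in at_top. norm (b ^ (m + 1) / ln b * M_v m b) \<le> C / ln b"
      using eventually_ge_at_top[of 2]
    proof eventually_elim
      case (elim b)
      have "b ^ (m + 1) * M_v m b / ln b \<le> C / ln b"
        using bd[OF elim] elim by (intro divide_right_mono) auto
      moreover have "b ^ (m + 1) * M_v m b / ln b \<ge> 0"
        using elim M_v_nonneg[of b m] m by auto
      ultimately show ?case by (simp add: abs_mult)
    qed
    show "((\<lambda>b. C / ln b) \<longlongrightarrow> 0) at_top" by real_asymp
  qed
qed

subsection \<open>The part of M depending on the logarithm of u\<close>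

text \<open>The constant \<open>ln 2\<close> makes the integrand nonnegative on the whole interval,
  so that finite limits of a primitive at both ends yield integrability.\<close>

lemma set_integrable_ln_one_minus: "set_integrable lborel {-1<..<1::real} (\<lambda>u. ln 2 - ln (1 - u))"
proof -
  have 0: "((\<lambda>u::real. u * ln 2 + (1 - u) * ln (1 - u) + u) \<longlongrightarrow> - ln 2 + 2 * ln 2 - 1) (at_right (-1))"
  proof -
    have "((\<lambda>u::real. u * ln 2 + (1 - u) * ln (1 - u) + u) \<longlongrightarrow> (-1) * ln 2 + (1 - (-1)) * ln (1 - (-1)) + (-1))
        (at_right (-1))"
      by (intro tendsto_intros) auto
    then show ?thesis by simp
  qed
  have 1: "((\<lambda>u::real. u * ln 2 + (1 - u) * ln (1 - u) + u) \<longlongrightarrow> ln 2 + 1) (at_left 1)"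
    by real_asymp
  have "set_integrable lborel (einterval (ereal (-1)) (ereal 1)) (\<lambda>u. ln 2 - ln (1 - u))"
  proof (rule interval_integral_FTC_nonneg(1)[where F="\<lambda>u. u * ln 2 + (1 - u) * ln (1 - u) + u"])
    show "((\<lambda>u. u * ln 2 + (1 - u) * ln (1 - u) + u) has_real_derivative ln 2 - ln (1 - x)) (at x)"
      if "ereal (-1) < ereal x" "ereal x < ereal 1" for x
      using that by (auto intro!: derivative_eq_intros)
    show "isCont (\<lambda>u. ln 2 - ln (1 - u)) x" if "ereal (-1) < ereal x" "ereal x < ereal 1" for x :: real
      using that by (intro continuous_intros) auto
    show "AE x in lborel. ereal (-1) < ereal x \<longrightarrow> ereal x < ereal 1 \<longrightarrow> 0 \<le> ln 2 - ln (1 - x)"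
      by (intro AE_I2) auto
  qed (use 0 1 in \<open>simp_all only: ereal_tendsto_simps1\<close>, simp)
  then show ?thesis by simp
qed

lemma set_integrable_ln_one_plus: "set_integrable lborel {-1<..<1::real} (\<lambda>u. ln 2 - ln (1 + u))"
  using interval_integrable_mirror[of "ereal (-1)" "ereal 1" "\<lambda>u. ln 2 - ln (1 - u)"]
    set_integrable_ln_one_minus
  by (simp add: interval_lebesgue_integrable_def)

definition psi :: "real \<Rightarrow> real \<Rightarrow> real" where
  "psi b u = ln ((b\<^sup>2 - u\<^sup>2) / (1 - u\<^sup>2))"

text \<open>\<open>1 / (b - u) ^ (m + 1)\<close> is \<open>m + 1\<close> times the integral of
  \<open>1 / (v - u) ^ (m + 2)\<close> over \<open>v > b\<close>.\<close>

definition M_u :: "nat \<Rightarrow> real \<Rightarrow> real" where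
  "M_u m b = (LINT u:{-1<..<1}|lborel. psi b u / (b - u) ^ (m + 1))"

lemma sq_less:
  fixes b u :: real
  assumes "b > 1" "-1 < u" "u < 1"
  shows "u\<^sup>2 < 1" "u\<^sup>2 < b\<^sup>2" "1 < b\<^sup>2"
proof -
  show 1: "u\<^sup>2 < 1" "1 < b\<^sup>2"
    using assms abs_square_less_1[of u] one_less_power[of b 2] by auto
  then show "u\<^sup>2 < b\<^sup>2" by linarith
qed

text \<open>Separates the singularity at \<open>u = 1\<close>, which produces the whole limit at
  \<open>b = 1\<close>, from the one at \<open>u = -1\<close>, whose scaled contribution
  vanishes.\<close>

lemma psi_split:
  assumes "b > 1" "-1 < u" "u < 1"
  shows "psi b u = ln ((b - u) / (1 - u)) + ln ((b + u) / (1 + u))"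
proof -
  have *: "(b\<^sup>2 - u\<^sup>2) / (1 - u\<^sup>2) = ((b - u) / (1 - u)) * ((b + u) / (1 + u))"
    by (simp add: power2_eq_square algebra_simps)
  show ?thesis
    unfolding psi_def * using assms by (intro ln_mult_pos) auto
qed

lemma psi_eq:
  assumes "b > 1" "-1 < u" "u < 1"
  shows "psi b u = ln (b\<^sup>2 - u\<^sup>2) - ln (1 - u) - ln (1 + u)"
proof -
  have "1 - u\<^sup>2 = (1 - u) * (1 + u)" by (simp add: power2_eq_square algebra_simps)
  then show ?thesis
    unfolding psi_def using assms sq_less[OF assms] less_imp_neq[OF sq_less(2)[OF assms]]
    by (simp add: ln_div ln_mult_pos)
qed

lemma psi_ge:
  assumes "b > 1" "-1 < u" "u < 1"
  shows "psi b u \<ge> ln (b\<^sup>2)"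
proof -
  note sq = sq_less[OF assms]
  have "b\<^sup>2 \<le> (b\<^sup>2 - u\<^sup>2) / (1 - u\<^sup>2)"
    using sq mult_right_mono[of 1 "b\<^sup>2" "u\<^sup>2"] by (simp add: le_divide_eq algebra_simps)
  then show ?thesis unfolding psi_def using sq by (intro ln_mono) auto
qed

lemma psi_pos:
  assumes "b > 1" "-1 < u" "u < 1"
  shows "psi b u > 0"
  using psi_ge[OF assms] sq_less[OF assms] ln_gt_zero[of "b\<^sup>2"] by linarith

lemma psi_le:
  assumes "b > 1" "b \<le> d" "-1 < u" "u < 1"
  shows "psi b u \<le> 2 * ln d + (ln 2 - ln (1 - u)) + (ln 2 - ln (1 + u))"
proof -
  have "ln (b\<^sup>2 - u\<^sup>2) \<le> ln (d\<^sup>2)"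
  proof (intro ln_mono)
    show "b\<^sup>2 - u\<^sup>2 \<le> d\<^sup>2"
      using power_mono[OF assms(2), of 2] zero_le_power2[of u] assms(1) by linarith
    show "b\<^sup>2 - u\<^sup>2 > 0" using sq_less(2)[of b u] assms by auto
  qed
  also have "ln (d\<^sup>2) = 2 * ln d" using assms by (simp add: ln_realpow)
  finally show ?thesis using psi_eq[OF assms(1,3,4)] ln_ge_zero[of "2::real"] by linarith
qed

lemma isCont_psi: "b > 1 \<Longrightarrow> -1 < u \<Longrightarrow> u < 1 \<Longrightarrow> isCont (psi b) u"
  unfolding psi_def using sq_less[of b u] by (intro continuous_intros) auto

lemma continuous_on_psi [continuous_intros]: "b > 1 \<Longrightarrow> A \<subseteq> {-1<..<1} \<Longrightarrow> continuous_on A (psi b)"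
  by (intro continuous_at_imp_continuous_on ballI isCont_psi) auto

lemma tendsto_psi:
  assumes "b > 1" "-1 < u" "u < 1"
  shows "((\<lambda>t. psi t u) \<longlongrightarrow> psi b u) (at b within A)"
  unfolding psi_def using sq_less[OF assms] by (intro tendsto_intros) auto

definition psi_bound :: "real \<Rightarrow> real \<Rightarrow> real" where
  "psi_bound d u = 2 * ln d + (ln 2 - ln (1 - u)) + (ln 2 - ln (1 + u))"

lemma psi_bound_nonneg:
  assumes "d \<ge> 1" "-1 < u" "u < 1"
  shows "psi_bound d u \<ge> 0"
proof -
  have "ln (1 - u) \<le> ln 2" "ln (1 + u) \<le> ln 2" "ln d \<ge> 0"
    using assms by auto
  then show ?thesis unfolding psi_bound_def by linarith
qed

lemma psi_bound_integrable: "set_integrable lborel {-1<..<1} (psi_bound d)"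
  unfolding psi_bound_def
  by (intro set_integral_add(1) set_integrable_ln_one_minus set_integrable_ln_one_plus set_integrable_const_Ioo)

lemma psi_div_le:
  assumes "1 < c" "c \<le> b" "b \<le> d" "-1 < u" "u < 1"
  shows "\<bar>psi b u / (b - u) ^ k\<bar> \<le> psi_bound d u * (1 / (c - 1) ^ k)"
proof -
  have b: "b > 1" using assms by simp
  have p: "psi b u > 0" using psi_pos[OF b] assms by simp
  have "\<bar>psi b u / (b - u) ^ k\<bar> = psi b u * (1 / (b - u) ^ k)"
    using p assms by simp
  also have "\<dots> \<le> psi_bound d u * (1 / (c - 1) ^ k)"
  proof (rule mult_mono)
    show 1: "psi b u \<le> psi_bound d u"
      unfolding psi_bound_def using psi_le[OF b] assms by blast
    show "0 \<le> psi_bound d u" using 1 p by linarith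
    show "1 / (b - u) ^ k \<le> 1 / (c - 1) ^ k"
      using assms by (intro divide_left_mono power_mono) auto
    show "0 \<le> 1 / (b - u) ^ k" using assms by simp
  qed
  finally show ?thesis .
qed

lemma continuous_on_M_u_integrand:
  "b > 1 \<Longrightarrow> A \<subseteq> {-1<..<1} \<Longrightarrow> continuous_on A (\<lambda>u. psi b u / (b - u) ^ k)"
  by (intro continuous_intros) auto

lemma M_u_integrable:
  assumes "b > 1"
  shows "set_integrable lborel {-1<..<1} (\<lambda>u. psi b u / (b - u) ^ k)"
  by (rule set_integrable_bound_continuous[where w="\<lambda>u. psi_bound b u * (1 / (b - 1) ^ k)"])
     (use assms psi_div_le[of b b b] in \<open>auto intro!: continuous_on_M_u_integrand set_integrable_mult_left psi_bound_integrable
       simp del: times_divide_eq_right\<close>)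

lemma M_u_pos:
  assumes "b > 1"
  shows "M_u m b > 0"
  unfolding M_u_def using assms psi_pos[OF assms]
  by (intro set_lebesgue_integral_pos M_u_integrable) auto

lemma M_u_continuous: "continuous_on {1<..} (M_u m)"
proof -
  have "isCont (M_u m) b" if b: "b > 1" for b
  proof -
    define c where "c = (1 + b) / 2"
    have c: "c > 1" "c < b" using b by (auto simp: c_def)
    have "(M_u m \<longlongrightarrow> M_u m b) (at b within {c<..<b+1})"
      unfolding M_u_def
    proof (rule set_integral_tendsto_at_within)
      show "set_integrable lborel {-1<..<1} (\<lambda>u. psi_bound (b + 1) u * (1 / (c - 1) ^ (m + 1)))"
        by (intro set_integrable_mult_left psi_bound_integrable)
      show "continuous_on {-1<..<1} (\<lambda>u. psi t u / (t - u) ^ (m + 1))" if "t \<in> {c<..<b+1}" for t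
        using that c by (intro continuous_on_M_u_integrand) auto
      show "continuous_on {-1<..<1} (\<lambda>u. psi b u / (b - u) ^ (m + 1))"
        using b by (intro continuous_on_M_u_integrand) auto
      show "\<bar>psi t u / (t - u) ^ (m + 1)\<bar> \<le> psi_bound (b + 1) u * (1 / (c - 1) ^ (m + 1))"
        if "t \<in> {c<..<b+1}" "u \<in> {-1<..<1}" for t u
        using that c by (intro psi_div_le) auto
      show "((\<lambda>t. psi t u / (t - u) ^ (m + 1)) \<longlongrightarrow> psi b u / (b - u) ^ (m + 1)) (at b within {c<..<b+1})"
        if "u \<in> {-1<..<1}" for u
        using that b by (intro tendsto_intros tendsto_psi) auto
    qed auto
    then show ?thesis
      using c by (simp add: at_within_open[of b "{c<..<b+1}"] isCont_def)
  qed
  then show ?thesis by (intro continuous_at_imp_continuous_on) auto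
qed

text \<open>\<open>psi b u / ln b\<close> tends to 2 and \<open>b / (b - u)\<close> to 1, so the
  limit is 2 times the interval length 2.\<close>

lemma M_u_at_top: "((\<lambda>b. b ^ (m + 1) / ln b * M_u m b) \<longlongrightarrow> 4) at_top"
proof -
  have lim: "((\<lambda>b. LINT u:{-1<..<1}|lborel. psi b u / ln b * (b / (b - u)) ^ (m + 1)) \<longlongrightarrow>
      (LINT u:{-1<..<1::real}|lborel. 2::real)) at_top"
  proof (rule set_integral_tendsto_at_top[where T=2])
    \<comment> \<open>For \<open>t \<ge> 2\<close>, \<open>ln t\<close> is at least
      \<open>ln 2\<close> and \<open>t / (t - u)\<close> is at most 2.\<close>
    define w where "w = (\<lambda>u. (2 + (1 / ln 2) * psi_bound 1 u) * 2 ^ (m + 1))"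
    show "set_integrable lborel {-1<..<1} w"
      unfolding w_def by (intro set_integrable_mult_left set_integral_add(1) set_integrable_mult_right
          psi_bound_integrable set_integrable_const_Ioo)
    show "continuous_on {-1<..<1} (\<lambda>u. psi t u / ln t * (t / (t - u)) ^ (m + 1))" if "t \<ge> 2" for t
      using that by (intro continuous_intros) auto
    show "\<bar>psi t u / ln t * (t / (t - u)) ^ (m + 1)\<bar> \<le> w u" if t: "t \<ge> 2" and u: "u \<in> {-1<..<1}" for t u
    proof -
      have ln: "ln 2 \<le> ln t" "0 < ln (2::real)" using t by auto
      have p: "psi t u > 0" using psi_pos[of t u] t u by simp
      have b0: "psi_bound 1 u \<ge> 0"
        using u by (intro psi_bound_nonneg) auto
      have "psi t u / ln t \<le> (2 * ln t + psi_bound 1 u) / ln t"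
        using psi_le[of t t u] t u ln by (intro divide_right_mono) (auto simp: psi_bound_def)
      also have "\<dots> = 2 + (1 / ln t) * psi_bound 1 u"
        using less_le_trans[OF ln(2,1)] by (simp add: add_divide_distrib)
      also have "\<dots> \<le> 2 + (1 / ln 2) * psi_bound 1 u"
        using ln b0 by (intro add_left_mono mult_right_mono divide_left_mono mult_pos_pos less_le_trans[OF ln(2,1)]) auto
      finally have 1: "psi t u / ln t \<le> 2 + (1 / ln 2) * psi_bound 1 u" .
      have "t / (t - u) \<le> 2" using t u by (simp add: divide_le_eq)
      then have 2: "(t / (t - u)) ^ (m + 1) \<le> 2 ^ (m + 1)"
        using t u by (intro power_mono) auto
      have nn: "psi t u / ln t \<ge> 0" "(t / (t - u)) ^ (m + 1) \<ge> 0" using p ln t u by auto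
      have "\<bar>psi t u / ln t * (t / (t - u)) ^ (m + 1)\<bar> = psi t u / ln t * (t / (t - u)) ^ (m + 1)"
        using nn by (intro abs_of_nonneg mult_nonneg_nonneg)
      also have "\<dots> \<le> w u"
        unfolding w_def using nn 1 2 by (intro mult_mono) auto
      finally show ?thesis .
    qed
    show "((\<lambda>t. psi t u / ln t * (t / (t - u)) ^ (m + 1)) \<longlongrightarrow> 2) at_top" if "u \<in> {-1<..<1}" for u
    proof -
      have "((\<lambda>t. t / (t - u)) \<longlongrightarrow> 1) at_top" by real_asymp
      moreover have "((\<lambda>t. (ln (t\<^sup>2 - u\<^sup>2) - ln (1 - u) - ln (1 + u)) / ln t) \<longlongrightarrow> 2) at_top"
        by real_asymp
      ultimately have *: "((\<lambda>t. (ln (t\<^sup>2 - u\<^sup>2) - ln (1 - u) - ln (1 + u)) / ln t * (t / (t - u)) ^ (m + 1))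
          \<longlongrightarrow> 2 * 1 ^ (m + 1)) at_top"
        by (intro tendsto_intros)
      have "\<forall>\<^sub>F t in at_top. (ln (t\<^sup>2 - u\<^sup>2) - ln (1 - u) - ln (1 + u)) / ln t * (t / (t - u)) ^ (m + 1) =
           psi t u / ln t * (t / (t - u)) ^ (m + 1)"
        using eventually_gt_at_top[of 1] by eventually_elim (use that psi_eq in auto)
      from Lim_transform_eventually[OF * this] show ?thesis by simp
    qed
  qed auto
  have "(LINT u:{-1<..<1::real}|lborel. (2::real)) = 4"
    by (simp add: set_integral_const)
  with lim have lim': "((\<lambda>b. LINT u:{-1<..<1}|lborel. psi b u / ln b * (b / (b - u)) ^ (m + 1)) \<longlongrightarrow> 4) at_top"
    by simp
  have "\<forall>\<^sub>F b in at_top. (LINT u:{-1<..<1}|lborel. psi b u / ln b * (b / (b - u)) ^ (m + 1)) =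
      b ^ (m + 1) / ln b * M_u m b"
  proof (rule always_eventually, rule allI)
    fix b :: real
    have "(LINT u:{-1<..<1}|lborel. psi b u / ln b * (b / (b - u)) ^ (m + 1)) =
        (LINT u:{-1<..<1}|lborel. b ^ (m + 1) / ln b * (psi b u / (b - u) ^ (m + 1)))"
      by (intro set_lebesgue_integral_cong) (auto simp: power_divide mult_ac)
    then show "(LINT u:{-1<..<1}|lborel. psi b u / ln b * (b / (b - u)) ^ (m + 1)) = b ^ (m + 1) / ln b * M_u m b"
      by (simp only: set_integral_mult_right M_u_def)
  qed
  from Lim_transform_eventually[OF lim' this] show ?thesis .
qed

section \<open>The behaviour of M_u as b tends to 1\<close>

text \<open>
  Substituting \<open>u = 1 - (b - 1) x\<close> in the contribution of \<open>(b - u) / (1 - u)\<close>, the factor of the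
  logarithm that is singular near \<open>u = 1\<close>.
\<close>

lemma M_u_first_part:
  assumes b: "b > 1"
  shows "(b - 1) ^ m * (LINT u:{-1<..<1}|lborel. ln ((b - u) / (1 - u)) / (b - u) ^ (m + 1)) =
    (LINT x:{0<..}|lborel. indicator {..<2 / (b - 1)} x * (kern x / (1 + x) ^ (m + 1)))"
proof -
  let ?f = "\<lambda>u. indicator {-1<..<1} u *\<^sub>R (ln ((b - u) / (1 - u)) / (b - u) ^ (m + 1))"
  have "(LINT u:{-1<..<1}|lborel. ln ((b - u) / (1 - u)) / (b - u) ^ (m + 1)) =
      \<bar>1 - b\<bar> *\<^sub>R (LINT x|lborel. ?f (1 + (1 - b) * x))"
    unfolding set_lebesgue_integral_def using b by (intro lborel_integral_real_affine) simp
  also have "(LINT x|lborel. ?f (1 + (1 - b) * x)) =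
     (LINT x|lborel. 1 / (b - 1) ^ (m + 1) *
        (indicator {0<..} x *\<^sub>R (indicator {..<2 / (b - 1)} x * (kern x / (1 + x) ^ (m + 1)))))"
  proof (rule Bochner_Integration.integral_cong)
    fix x
    have i: "1 + (1 - b) * x \<in> {-1<..<1} \<longleftrightarrow> x \<in> {0<..} \<and> x \<in> {..<2 / (b - 1)}"
    proof -
      have "1 + (1 - b) * x < 1 \<longleftrightarrow> (b - 1) * x > 0" by (simp add: algebra_simps)
      also have "\<dots> \<longleftrightarrow> x > 0" using b by (simp add: zero_less_mult_iff)
      finally have 1: "1 + (1 - b) * x < 1 \<longleftrightarrow> x > 0" .
      have "1 + (1 - b) * x > -1 \<longleftrightarrow> x < 2 / (b - 1)"
        using b by (simp add: less_divide_eq algebra_simps)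
      with 1 show ?thesis by auto
    qed
    have "(b - (1 + (1 - b) * x)) = (b - 1) * (1 + x)" "1 - (1 + (1 - b) * x) = (b - 1) * x"
      by (simp_all add: algebra_simps)
    then show "?f (1 + (1 - b) * x) = 1 / (b - 1) ^ (m + 1) *
        (indicator {0<..} x *\<^sub>R (indicator {..<2 / (b - 1)} x * (kern x / (1 + x) ^ (m + 1))))"
      using i b by (auto simp: indicator_def kern_def power_mult_distrib)
  qed simp
  finally have "(LINT u:{-1<..<1}|lborel. ln ((b - u) / (1 - u)) / (b - u) ^ (m + 1)) =
     (b - 1) * (1 / (b - 1) ^ (m + 1) *
       (LINT x:{0<..}|lborel. indicator {..<2 / (b - 1)} x * (kern x / (1 + x) ^ (m + 1))))"
    unfolding integral_mult_right_zero set_lebesgue_integral_def using b by simp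
  then show ?thesis using b by simp
qed

text \<open>After the scaling, \<open>b\<close> survives only in the cutoff
  \<open>2 / (b - 1)\<close>, which tends to infinity; the limit integrand is its own majorant. The
  discontinuous indicator calls for the measurable form of dominated convergence.\<close>

lemma M_u_first_part_at_1:
  assumes m: "m \<ge> 1"
  shows "((\<lambda>b. LINT x:{0<..}|lborel. indicator {..<2 / (b - 1)} x * (kern x / (1 + x) ^ (m + 1)))
    \<longlongrightarrow> P m 1 / real m) (at_right 1)"
  unfolding kern_integral[OF m, symmetric]
proof (rule set_integral_tendsto_at_within_measurable)
  show "set_borel_measurable lborel {0<..} (\<lambda>x. indicator {..<2 / (t - 1)} x * (kern x / (1 + x) ^ (m + 1)))"
    for t :: real
    unfolding set_borel_measurable_def kern_def by measurable
  show "set_borel_measurable lborel {0<..} (\<lambda>x. kern x / (1 + x) ^ (m + 1))"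
    unfolding set_borel_measurable_def kern_def by measurable
  show "set_integrable lborel {0<..} (\<lambda>x. kern x / (1 + x) ^ (m + 1))"
    by (rule kern_integrable[OF m])
  show "\<bar>indicator {..<2 / (t - 1)} x * (kern x / (1 + x) ^ (m + 1))\<bar> \<le> kern x / (1 + x) ^ (m + 1)"
    if "x \<in> {0<..}" for t x :: real
    using that kern_nonneg[of x] by (auto simp: indicator_def)
  show "((\<lambda>t. indicator {..<2 / (t - 1)} x * (kern x / (1 + x) ^ (m + 1))) \<longlongrightarrow> kern x / (1 + x) ^ (m + 1)) (at_right 1)"
    if "x \<in> {0<..}" for x :: real
  proof (rule tendsto_eventually)
    have x: "x > 0" using that by simp
    have "\<forall>\<^sub>F t in at_right 1. 1 < t \<and> t < 1 + 2 / x"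
      using eventually_at_right_real[of 1 "1 + 2 / x"] x by (simp add: greaterThanLessThan_iff)
    then show "\<forall>\<^sub>F t in at_right 1. indicator {..<2 / (t - 1)} x * (kern x / (1 + x) ^ (m + 1)) = kern x / (1 + x) ^ (m + 1)"
    proof eventually_elim
      case (elim t)
      then have "x < 2 / (t - 1)" using x by (simp add: field_simps)
      then show ?case by simp
    qed
  qed
qed

lemma ln_ratio_bounds:
  fixes b u :: real
  assumes "b > 1" "-1 < u" "u < 1"
  shows "ln ((b + u) / (1 + u)) \<ge> 0" "ln ((b + u) / (1 + u)) \<le> (b - 1) / (1 + u)"
proof -
  show "ln ((b + u) / (1 + u)) \<ge> 0" using assms by (intro ln_ge_zero) simp
  have "(b + u) / (1 + u) - 1 = (b - 1) / (1 + u)" using assms by (simp add: field_simps)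
  then show "ln ((b + u) / (1 + u)) \<le> (b - 1) / (1 + u)"
    using ln_le_minus_one[of "(b + u) / (1 + u)"] assms by simp
qed

text \<open>For \<open>u \<ge> 0\<close> the logarithm is at most \<open>t - 1\<close>, which bounds
  the expression by \<open>((t - 1) / (t - u)) ^ (m + 1) \<le> 1\<close>. For \<open>u < 0\<close>
  the denominator is at least 1, and only the integrable singularity of \<open>ln (1 + u)\<close> at
  -1 remains.\<close>

lemma M_u_second_part_bound:
  fixes t u :: real
  assumes t: "1 < t" "t < 2" and u: "-1 < u" "u < 1"
  shows "\<bar>(t - 1) ^ m * (ln ((t + u) / (1 + u)) / (t - u) ^ (m + 1))\<bar> \<le> 1 + (ln 2 - ln (1 + u))"
proof -
  note r = ln_ratio_bounds[OF t(1) u]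
  have "\<bar>(t - 1) ^ m * (ln ((t + u) / (1 + u)) / (t - u) ^ (m + 1))\<bar> =
      (t - 1) ^ m * (ln ((t + u) / (1 + u)) / (t - u) ^ (m + 1))"
    using t u r by (intro abs_of_nonneg mult_nonneg_nonneg divide_nonneg_nonneg) auto
  also have "\<dots> \<le> 1 + (ln 2 - ln (1 + u))"
  proof (cases "u \<ge> 0")
    case True
    have "ln ((t + u) / (1 + u)) \<le> t - 1"
      using r(2) True t divide_left_mono[of 1 "1 + u" "t - 1"] by simp
    then have "(t - 1) ^ m * (ln ((t + u) / (1 + u)) / (t - u) ^ (m + 1)) \<le>
        (t - 1) ^ m * ((t - 1) / (t - u) ^ (m + 1))"
      using t u by (intro mult_left_mono divide_right_mono) auto
    also have "\<dots> = ((t - 1) / (t - u)) ^ (m + 1)" by (simp add: power_divide)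
    also have "\<dots> \<le> 1" using t u by (intro power_le_one) auto
    also have "1 \<le> 1 + (ln 2 - ln (1 + u))" using u by simp
    finally show ?thesis .
  next
    case False
    have "(t - 1) ^ m * (ln ((t + u) / (1 + u)) / (t - u) ^ (m + 1)) \<le> 1 * (ln ((t + u) / (1 + u)) / 1)"
      using t u r False by (intro mult_mono divide_left_mono power_le_one one_le_power) auto
    also have "\<dots> = ln (t + u) - ln (1 + u)" using t u by (simp add: ln_div)
    also have "\<dots> \<le> 1 + (ln 2 - ln (1 + u))"
    proof -
      have "ln (t + u) \<le> ln 2" using t u False by simp
      then show ?thesis by simp
    qed
    finally show ?thesis .
  qed
  finally show ?thesis .
qed

lemma M_u_second_part_at_1:
  assumes m: "m \<ge> 1"
  shows "((\<lambda>b::real. LINT u:{-1<..<1::real}|lborel. (b - 1) ^ m * (ln ((b + u) / (1 + u)) / (b - u) ^ (m + 1))) \<longlongrightarrow> 0)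
    (at_right 1)"
proof -
  have at: "at_right 1 = at 1 within {1<..<2::real}"
    by (rule at_within_nhd[of _ "{..<2}"]) auto
  have "((\<lambda>b::real. LINT u:{-1<..<1::real}|lborel. (b - 1) ^ m * (ln ((b + u) / (1 + u)) / (b - u) ^ (m + 1))) \<longlongrightarrow>
     (LINT u:{-1<..<1::real}|lborel. 0::real)) (at_right 1)"
    unfolding at
  proof (rule set_integral_tendsto_at_within)
    show "set_integrable lborel {-1<..<1::real} (\<lambda>u. 1 + (ln 2 - ln (1 + u)))"
      by (intro set_integral_add(1) set_integrable_ln_one_plus set_integrable_const_Ioo)
    show "continuous_on {-1<..<1} (\<lambda>u. (t - 1) ^ m * (ln ((t + u) / (1 + u)) / (t - u) ^ (m + 1)))"
      if "t \<in> {1<..<2}" for t :: real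
      using that by (intro continuous_intros) auto
    show "\<bar>(t - 1) ^ m * (ln ((t + u) / (1 + u)) / (t - u) ^ (m + 1))\<bar> \<le> 1 + (ln 2 - ln (1 + u))"
      if "t \<in> {1<..<2}" "u \<in> {-1<..<1}" for t u :: real
      using that by (intro M_u_second_part_bound) auto
    show "((\<lambda>t. (t - 1) ^ m * (ln ((t + u) / (1 + u)) / (t - u) ^ (m + 1))) \<longlongrightarrow> 0) (at 1 within {1<..<2})"
      if "u \<in> {-1<..<1}" for u :: real
    proof -
      have "((\<lambda>t. (t - 1) ^ m * (ln ((t + u) / (1 + u)) / (t - u) ^ (m + 1))) \<longlongrightarrow>
          (1 - 1) ^ m * (ln ((1 + u) / (1 + u)) / (1 - u) ^ (m + 1))) (at 1 within {1<..<2})"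
        using that by (intro tendsto_intros) auto
      then show ?thesis using m by (simp add: zero_power)
    qed
  qed auto
  then show ?thesis by (simp only: set_lebesgue_integral_zero)
qed

lemma M_u_at_1:
  assumes m: "m \<ge> 1"
  shows "((\<lambda>b. (b - 1) ^ m * M_u m b) \<longlongrightarrow> P m 1 / real m) (at_right 1)"
proof -
  from tendsto_add[OF M_u_first_part_at_1[OF m] M_u_second_part_at_1[OF m]]
  have lim: "((\<lambda>b. (LINT x:{0<..}|lborel. indicator {..<2 / (b - 1)} x * (kern x / (1 + x) ^ (m + 1))) +
     (LINT u:{-1<..<1}|lborel. (b - 1) ^ m * (ln ((b + u) / (1 + u)) / (b - u) ^ (m + 1)))) \<longlongrightarrow> P m 1 / real m)
     (at_right 1)" by simp
  have "\<forall>\<^sub>F b in at_right 1. (LINT x:{0<..}|lborel. indicator {..<2 / (b - 1)} x * (kern x / (1 + x) ^ (m + 1))) +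
     (LINT u:{-1<..<1}|lborel. (b - 1) ^ m * (ln ((b + u) / (1 + u)) / (b - u) ^ (m + 1))) = (b - 1) ^ m * M_u m b"
    unfolding eventually_at_filter
  proof (intro always_eventually allI impI)
    fix b :: real assume "b \<in> {1<..}"
    then have b: "b > 1" by simp
    let ?f = "\<lambda>u. ln ((b - u) / (1 - u)) / (b - u) ^ (m + 1)"
    let ?g = "\<lambda>u. ln ((b + u) / (1 + u)) / (b - u) ^ (m + 1)"
    have split: "psi b u / (b - u) ^ (m + 1) = ?f u + ?g u" if "-1 < u" "u < 1" for u
      using psi_split[OF b that] by (simp add: add_divide_distrib)
    have nn: "?g u \<ge> 0" "?f u \<ge> 0" if "-1 < u" "u < 1" for u
      using that b ln_ratio_bounds(1)[OF b, of u] ln_ratio_bounds(1)[OF b, of "-u"]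
      by (auto intro!: divide_nonneg_nonneg)
    \<comment> \<open>Both parts are nonnegative, so each is dominated by their sum.\<close>
    have f: "set_integrable lborel {-1<..<1} ?f"
      by (rule set_integrable_bound_continuous[OF _ _ M_u_integrable[OF b, of "m + 1"]])
         (use b split nn in \<open>auto intro!: continuous_intros simp del: ln_div\<close>)
    have g: "set_integrable lborel {-1<..<1} ?g"
      by (rule set_integrable_bound_continuous[OF _ _ M_u_integrable[OF b, of "m + 1"]])
         (use b split nn in \<open>auto intro!: continuous_intros simp del: ln_div\<close>)
    have "M_u m b = (LINT u:{-1<..<1}|lborel. ?f u + ?g u)"
      unfolding M_u_def
      by (rule set_lebesgue_integral_cong) (use split in \<open>simp_all only: greaterThanLessThan_iff, simp_all\<close>)
    also have "\<dots> = (LINT u:{-1<..<1}|lborel. ?f u) + (LINT u:{-1<..<1}|lborel. ?g u)"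
      using f g by (rule set_integral_add(2))
    finally show "(LINT x:{0<..}|lborel. indicator {..<2 / (b - 1)} x * (kern x / (1 + x) ^ (m + 1))) +
     (LINT u:{-1<..<1}|lborel. (b - 1) ^ m * (ln ((b + u) / (1 + u)) / (b - u) ^ (m + 1))) = (b - 1) ^ m * M_u m b"
      unfolding M_u_first_part[OF b, symmetric] set_integral_mult_right by (simp only: distrib_left)
  qed
  from Lim_transform_eventually[OF lim this] show ?thesis .
qed

section \<open>Monotonicity of M_u\<close>

lemma ln_over_antimono: "antimono_on {1<..} (\<lambda>x::real. ln x / (x - 1))"
proof (rule monotone_onI)
  fix x y :: real assume xy: "x \<in> {1<..}" "y \<in> {1<..}" "x \<le> y"
  show "ln y / (y - 1) \<le> ln x / (x - 1)"
  proof (rule DERIV_nonpos_imp_nonincreasing[OF xy(3)])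
    fix z assume z: "x \<le> z" "z \<le> y"
    then have z1: "z > 1" using xy by auto
    have "((\<lambda>x. ln x / (x - 1)) has_real_derivative (1 / z * (z - 1) - ln z) / (z - 1)\<^sup>2) (at z)"
      using z1 by (auto intro!: derivative_eq_intros simp: power2_eq_square)
    moreover have "1 / z * (z - 1) \<le> ln z"
      using ln_le_minus_one[of "1 / z"] z1 by (simp add: ln_div field_simps)
    then have "(1 / z * (z - 1) - ln z) / (z - 1)\<^sup>2 \<le> 0"
      by (intro divide_nonpos_nonneg) auto
    ultimately show "\<exists>y. ((\<lambda>x. ln x / (x - 1)) has_real_derivative y) (at z) \<and> y \<le> 0" by blast
  qed
qed

text \<open>The telescoped difference of powers has the factor
  \<open>1 / (b - 1) - 1 / (b + 1) = 2 / (b^2 - 1)\<close>. Paired with it, the increasing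
  \<open>ln (b^2)\<close> becomes \<open>ln x / (x - 1)\<close> at \<open>x = b^2\<close>, which
  decreases.\<close>

lemma boundary_term_antimono:
  "antimono_on {1<..} (\<lambda>b::real. ln (b\<^sup>2) * (1 / (b - 1) ^ m - 1 / (b + 1) ^ m))"
proof -
  define X Y where "X = (\<lambda>b::real. 1 / (b - 1))" and "Y = (\<lambda>b::real. 1 / (b + 1))"
  have X: "antimono_on {1<..} X" "antimono_on {1<..} Y"
    unfolding X_def Y_def by (auto simp: monotone_on_def intro!: divide_left_mono)
  have pos: "X b \<ge> 0" "Y b \<ge> 0" if "b > 1" for b using that by (auto simp: X_def Y_def)
  have pw: "antimono_on {1<..} (\<lambda>b. f b ^ k)" if "antimono_on {1<..} f" "\<And>b. b > 1 \<Longrightarrow> f b \<ge> 0" for f :: "real \<Rightarrow> real" and k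
    using that by (auto simp: monotone_on_def intro!: power_mono)
  have s: "antimono_on {1<..} (\<lambda>b. \<Sum>i<m. X b ^ (m - 1 - i) * Y b ^ i)"
    by (intro antimono_on_sum antimono_on_mult pw X pos) (use pos in auto)
  have l: "antimono_on {1<..} (\<lambda>b::real. ln (b\<^sup>2) / (b\<^sup>2 - 1))"
  proof (rule monotone_onI)
    fix x y :: real assume "x \<in> {1<..}" "y \<in> {1<..}" "x \<le> y"
    then show "ln (y\<^sup>2) / (y\<^sup>2 - 1) \<le> ln (x\<^sup>2) / (x\<^sup>2 - 1)"
      using ln_over_antimono one_less_power[of x 2] one_less_power[of y 2] power_mono[of x y 2]
      by (auto simp: monotone_on_def)
  qed
  have "antimono_on {1<..} (\<lambda>b. ln (b\<^sup>2) / (b\<^sup>2 - 1) * (2 * (\<Sum>i<m. X b ^ (m - 1 - i) * Y b ^ i)))"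
  proof (intro antimono_on_mult l s)
    show "antimono_on {1<..} (\<lambda>_::real. 2::real)" by (simp add: monotone_on_def)
    show "ln (b\<^sup>2) / (b\<^sup>2 - 1) \<ge> 0" if "b \<in> {1<..}" for b :: real
      using one_less_power[of b 2] that by (intro divide_nonneg_nonneg ln_ge_zero) auto
    show "2 * (\<Sum>i<m. X b ^ (m - 1 - i) * Y b ^ i) \<ge> 0" if "b \<in> {1<..}" for b :: real
      using pos[of b] that by (intro mult_nonneg_nonneg sum_nonneg) auto
    show "(\<Sum>i<m. X b ^ (m - 1 - i) * Y b ^ i) \<ge> 0" if "b \<in> {1<..}" for b :: real
      using pos[of b] that by (intro mult_nonneg_nonneg sum_nonneg) auto
  qed auto
  then show ?thesis
  proof (rule antimono_on_cong)
    fix b :: real assume "b \<in> {1<..}"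
    then have b: "b > 1" by simp
    have "1 / (b - 1) ^ m - 1 / (b + 1) ^ m = X b ^ m - Y b ^ m"
      by (simp add: X_def Y_def power_one_over)
    also have "\<dots> = (X b - Y b) * (\<Sum>i<m. X b ^ (m - 1 - i) * Y b ^ i)"
      by (rule sum_diff_powers)
    also have "X b - Y b = 2 / (b\<^sup>2 - 1)"
      using b by (simp add: X_def Y_def diff_frac_eq power2_eq_square algebra_simps)
    finally show "ln (b\<^sup>2) / (b\<^sup>2 - 1) * (2 * (\<Sum>i<m. X b ^ (m - 1 - i) * Y b ^ i)) =
        ln (b\<^sup>2) * (1 / (b - 1) ^ m - 1 / (b + 1) ^ m)"
      by simp
  qed
qed

text \<open>\<open>psi\<close> is even in \<open>u\<close>. On \<open>(0, 1)\<close> it increases in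
  \<open>u\<close>, so the subsequent integration by parts yields a kernel of constant sign; on
  \<open>(-1, 0)\<close> the sign of its derivative is opposite.\<close>

lemma M_u_fold:
  assumes b: "b > 1"
  shows "M_u m b = (LINT u:{0<..<1}|lborel. psi b u * (1 / (b - u) ^ (m + 1) + 1 / (b + u) ^ (m + 1)))"
    and "set_integrable lborel {0<..<1} (\<lambda>u. psi b u * (1 / (b - u) ^ (m + 1) + 1 / (b + u) ^ (m + 1)))"
proof -
  let ?f = "\<lambda>u. psi b u / (b - u) ^ (m + 1)"
  have f: "set_integrable lborel {-1<..<1} ?f" by (rule M_u_integrable[OF b])
  have m: "interval_lebesgue_integrable lborel (ereal (-1)) (ereal 1) ?f"
    using f by (simp add: interval_lebesgue_integrable_def)
  have mm: "min (ereal (-1)) (min (ereal 0) (ereal 1)) = ereal (-1)" "max (ereal (-1)) (max (ereal 0) (ereal 1)) = ereal 1"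
    by (auto simp: min_def max_def)
  have f1: "set_integrable lborel {0<..<1} ?f" by (rule set_integrable_subset[OF f]) auto
  have f2: "set_integrable lborel {-1<..<0} ?f" by (rule set_integrable_subset[OF f]) auto
  have f3: "set_integrable lborel {0<..<1} (\<lambda>u. ?f (-u))"
    using f2 interval_integrable_mirror[of "ereal 0" "ereal 1" ?f]
    by (simp add: interval_lebesgue_integrable_def zero_ereal_def)
  have eq: "psi b u * (1 / (b - u) ^ (m + 1) + 1 / (b + u) ^ (m + 1)) = ?f u + ?f (-u)" for u
    by (simp add: psi_def algebra_simps)
  have "M_u m b = (LBINT u=ereal (-1)..ereal 1. ?f u)"
    unfolding M_u_def by (simp add: interval_lebesgue_integral_def)
  also have "\<dots> = (LBINT u=ereal (-1)..ereal 0. ?f u) + (LBINT u=ereal 0..ereal 1. ?f u)"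
    by (rule interval_integral_sum[symmetric], unfold mm, rule m)
  also have "(LBINT u=ereal (-1)..ereal 0. ?f u) = (LBINT u=ereal 0..ereal 1. ?f (-u))"
    by (subst interval_integral_reflect) simp
  also have "(LBINT u=ereal 0..ereal 1. ?f (-u)) + (LBINT u=ereal 0..ereal 1. ?f u) =
     (LINT u:{0<..<1}|lborel. ?f (-u)) + (LINT u:{0<..<1}|lborel. ?f u)"
    by (simp add: interval_lebesgue_integral_def)
  also have "\<dots> = (LINT u:{0<..<1}|lborel. ?f (-u) + ?f u)"
    using f3 f1 by (rule set_integral_add(2)[symmetric])
  finally show "M_u m b = (LINT u:{0<..<1}|lborel. psi b u * (1 / (b - u) ^ (m + 1) + 1 / (b + u) ^ (m + 1)))"
    unfolding eq by (simp only: add.commute)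
  show "set_integrable lborel {0<..<1} (\<lambda>u. psi b u * (1 / (b - u) ^ (m + 1) + 1 / (b + u) ^ (m + 1)))"
    unfolding eq using f1 f3 by (rule set_integral_add(1))
qed

lemma psi_deriv:
  assumes "b > 1" "-1 < u" "u < 1"
  shows "(psi b has_real_derivative 2 * u * (b\<^sup>2 - 1) / ((1 - u\<^sup>2) * (b\<^sup>2 - u\<^sup>2))) (at u)"
proof -
  note sq = sq_less[OF assms]
  have "((\<lambda>u. ln (b\<^sup>2 - u\<^sup>2) - ln (1 - u\<^sup>2)) has_real_derivative
      - (2 * u) / (b\<^sup>2 - u\<^sup>2) - - (2 * u) / (1 - u\<^sup>2)) (at u)"
    using sq by (auto intro!: derivative_eq_intros simp: divide_inverse)
  also have "- (2 * u) / (b\<^sup>2 - u\<^sup>2) - - (2 * u) / (1 - u\<^sup>2) =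
      2 * u * (b\<^sup>2 - 1) / ((1 - u\<^sup>2) * (b\<^sup>2 - u\<^sup>2))"
    using sq by (simp add: divide_simps) (simp add: algebra_simps)
  finally show ?thesis
  proof (rule has_field_derivative_transform_within_open)
    show "open {-1<..<1::real}" "u \<in> {-1<..<1}" using assms by auto
    show "ln (b\<^sup>2 - u\<^sup>2) - ln (1 - u\<^sup>2) = psi b u" if "u \<in> {-1<..<1}" for u
      using that sq_less[OF assms(1), of u] unfolding psi_def by (subst ln_div) auto
  qed
qed

text \<open>The primitive \<open>H u - H 1\<close> vanishes at \<open>u = 1\<close>, where
  \<open>psi\<close> is singular, so the boundary term comes from \<open>u = 0\<close> alone, with
  \<open>psi b 0 = ln (b^2)\<close> and \<open>H 0 = 0\<close>. As \<open>psi\<close> has a rational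
  derivative, no logarithm stays under the integral.\<close>

lemma M_u_parts:
  assumes b: "b > 1" and m: "m \<ge> 1"
  shows "set_integrable lborel {0<..<1} (\<lambda>u. 2 * u / (1 - u\<^sup>2) * parts_kernel m u b)"
    and "real m * M_u m b = (LINT u:{0<..<1}|lborel. 2 * u / (1 - u\<^sup>2) * parts_kernel m u b)
      + ln (b\<^sup>2) * (1 / (b - 1) ^ m - 1 / (b + 1) ^ m)"
proof -
  define H where "H = (\<lambda>u. 1 / (b - u) ^ m - 1 / (b + u) ^ m)"
  define h where "h = (\<lambda>u. 1 / (b - u) ^ (m + 1) + 1 / (b + u) ^ (m + 1))"
  define Q where "Q = (\<lambda>u. 2 * u / (1 - u\<^sup>2) * parts_kernel m u b)"
  have dH: "(H has_real_derivative real m * h u) (at u)" if "-b < u" "u < b" for u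
  proof -
    have k: "real m * (x\<^sup>2 * x ^ (m - 1)) = real m * x ^ (m + 1)" for x :: real
      using m by (cases m) (auto simp: power2_eq_square)
    have d: "((\<lambda>u. 1 / (b - u)) has_real_derivative (1 / (b - u))\<^sup>2) (at u)"
      "((\<lambda>u. 1 / (b + u)) has_real_derivative - (1 / (b + u))\<^sup>2) (at u)"
      using that by (auto intro!: derivative_eq_intros simp: power2_eq_square)
    have "((\<lambda>u. (1 / (b - u)) ^ m - (1 / (b + u)) ^ m) has_real_derivative
        real m * (1 / (b - u)) ^ (m + 1) - - (real m * (1 / (b + u)) ^ (m + 1))) (at u)"
      using DERIV_diff[OF DERIV_power[OF d(1), of m] DERIV_power[OF d(2), of m]]
      unfolding k[symmetric] by simp
    then show ?thesis unfolding H_def h_def by (simp add: power_one_over algebra_simps)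
  qed
  have pk: "parts_kernel m u b = (b\<^sup>2 - 1) / (b\<^sup>2 - u\<^sup>2) * (H 1 - H u)" for u
    by (simp add: parts_kernel_def H_def)
  define C where "C = real m * (2 / (b - 1) ^ (m + 1))"
  have h_bd: "0 \<le> h u" "h u \<le> 2 / (b - 1) ^ (m + 1)" if "0 \<le> u" "u \<le> 1" for u
  proof -
    show "0 \<le> h u" unfolding h_def using that b by simp
    have "1 / (b - u) ^ (m + 1) \<le> 1 / (b - 1) ^ (m + 1)" "1 / (b + u) ^ (m + 1) \<le> 1 / (b - 1) ^ (m + 1)"
      using that b by (intro divide_left_mono power_mono mult_pos_pos zero_less_power; simp)+
    then show "h u \<le> 2 / (b - 1) ^ (m + 1)" unfolding h_def by simp
  qed
  \<comment> \<open>The linear bound from the mean value theorem cancels the pole of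
    \<open>1 / (1 - u^2)\<close> in \<open>Q\<close> and outweighs the logarithm in the boundary
    term at \<open>u = 1\<close>.\<close>
  have H_bd: "0 \<le> H 1 - H u" "H 1 - H u \<le> C * (1 - u)" if u: "0 < u" "u < 1" for u
  proof -
    have "\<exists>z>u. z < 1 \<and> H 1 - H u = (1 - u) * (real m * h z)"
      using u b by (intro MVT2 dH) auto
    then obtain z where z: "u < z" "z < 1" "H 1 - H u = (1 - u) * (real m * h z)" by blast
    have hz: "0 \<le> h z" "h z \<le> 2 / (b - 1) ^ (m + 1)" using h_bd[of z] z u by auto
    show "0 \<le> H 1 - H u" unfolding z(3) using hz u by simp
    have "(1 - u) * (real m * h z) \<le> (1 - u) * (real m * (2 / (b - 1) ^ (m + 1)))"
      using hz u by (intro mult_left_mono) auto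
    then show "H 1 - H u \<le> C * (1 - u)" unfolding z(3) C_def by (simp add: mult_ac)
  qed
  have C0: "C \<ge> 0" using b by (simp add: C_def)
  have cH: "isCont H u" if "-b < u" "u < b" for u using dH[OF that] DERIV_isCont by blast
  have cQ: "isCont Q u" if "0 < u" "u < 1" for u
    unfolding Q_def pk using that b sq_less[of b u] by (intro continuous_intros cH) auto
  have Q_bd: "\<bar>Q u\<bar> \<le> 2 * C" if u: "0 < u" "u < 1" for u
  proof -
    have sq: "u\<^sup>2 < 1" "u\<^sup>2 < b\<^sup>2" "1 < b\<^sup>2" using sq_less[of b u] b u by auto
    have e: "1 - u\<^sup>2 = (1 - u) * (1 + u)" by (simp add: power2_eq_square algebra_simps)
    have "(b\<^sup>2 - 1) / (b\<^sup>2 - u\<^sup>2) \<le> 1" using sq by (simp add: divide_le_eq_1)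
    then have p: "0 \<le> parts_kernel m u b" "parts_kernel m u b \<le> 1 * (C * (1 - u))"
      unfolding pk using sq H_bd[OF u] by (intro mult_nonneg_nonneg mult_mono; simp)+
    have "Q u \<le> 2 * u / (1 - u\<^sup>2) * (C * (1 - u))"
      unfolding Q_def using p u sq by (intro mult_left_mono) auto
    also have "\<dots> = 2 * C * (u / (1 + u))" unfolding e using u by simp
    also have "\<dots> \<le> 2 * C * 1" using u C0 by (intro mult_left_mono) auto
    finally have "Q u \<le> 2 * C" by simp
    moreover have "Q u \<ge> 0" unfolding Q_def using p u sq by simp
    ultimately show ?thesis by simp
  qed
  have Qi: "set_integrable lborel {0<..<1} Q"
    by (rule set_integrable_bound_continuous[OF _ _ set_integrable_const_Ioo])
       (use cQ Q_bd in \<open>auto intro!: continuous_at_imp_continuous_on\<close>)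
  then show "set_integrable lborel {0<..<1} (\<lambda>u. 2 * u / (1 - u\<^sup>2) * parts_kernel m u b)"
    by (simp add: Q_def)
  have hi: "set_integrable lborel {0<..<1} (\<lambda>u. real m * (psi b u * h u))"
    using M_u_fold(2)[OF b, of m] unfolding h_def by (intro set_integrable_mult_right)
  have i: "set_integrable lborel {0<..<1} (\<lambda>u. real m * (psi b u * h u) - Q u)"
    by (intro set_integral_diff(1) hi Qi)
  let ?F = "\<lambda>u. - (psi b u * (H 1 - H u))"
  have dF: "(?F has_real_derivative real m * (psi b u * h u) - Q u) (at u)" if u: "0 < u" "u < 1" for u
  proof -
    have "(?F has_real_derivative - ((2 * u * (b\<^sup>2 - 1) / ((1 - u\<^sup>2) * (b\<^sup>2 - u\<^sup>2))) * (H 1 - H u)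
        + (0 - real m * h u) * psi b u)) (at u)"
      using u b by (intro DERIV_minus DERIV_mult DERIV_diff DERIV_const dH psi_deriv) auto
    moreover have "- ((2 * u * (b\<^sup>2 - 1) / ((1 - u\<^sup>2) * (b\<^sup>2 - u\<^sup>2))) * (H 1 - H u)
        + (0 - real m * h u) * psi b u) = real m * (psi b u * h u) - Q u"
      unfolding Q_def pk by simp
    ultimately show ?thesis by (simp only:)
  qed
  have F0: "(?F \<longlongrightarrow> - (ln (b\<^sup>2) * H 1)) (at_right 0)"
  proof -
    have "(?F \<longlongrightarrow> - (psi b 0 * (H 1 - H 0))) (at_right 0)"
      using isCont_psi[of b 0] cH[of 0] b
      by (intro tendsto_intros) (auto simp: isCont_def intro: tendsto_within_subset[where S=UNIV])
    then show ?thesis by (simp add: psi_def H_def)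
  qed
  have F1: "(?F \<longlongrightarrow> 0) (at_left 1)"
  proof (rule Lim_null_comparison)
    show "((\<lambda>u. psi_bound b u * (C * (1 - u))) \<longlongrightarrow> 0) (at_left 1)"
      unfolding psi_bound_def by real_asymp
    show "\<forall>\<^sub>F u in at_left 1. norm (- (psi b u * (H 1 - H u))) \<le> psi_bound b u * (C * (1 - u))"
      using eventually_at_left_real[OF zero_less_one]
    proof eventually_elim
      case (elim u)
      then have u: "0 < u" "u < 1" by auto
      have "psi b u > 0" "psi b u \<le> psi_bound b u"
        using psi_pos[OF b, of u] psi_le[OF b order.refl, of u] u by (auto simp: psi_bound_def)
      then show ?case using H_bd[OF u] by (auto simp: abs_mult intro!: mult_mono)
    qed
  qed
  have "(LBINT u=ereal 0..ereal 1. real m * (psi b u * h u) - Q u) = 0 - - (ln (b\<^sup>2) * H 1)"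
  proof (rule interval_integral_FTC_integrable[where F="?F"])
    show "(?F has_vector_derivative real m * (psi b u * h u) - Q u) (at u)" if "ereal 0 < ereal u" "ereal u < ereal 1" for u
      using dF that by (simp add: has_real_derivative_iff_has_vector_derivative)
    show "isCont (\<lambda>u. real m * (psi b u * h u) - Q u) u" if "ereal 0 < ereal u" "ereal u < ereal 1" for u
      unfolding h_def using that b by (intro continuous_intros cQ isCont_psi) auto
    show "set_integrable lborel (einterval (ereal 0) (ereal 1)) (\<lambda>u. real m * (psi b u * h u) - Q u)"
      using i by simp
  qed (use F0 F1 in \<open>simp_all only: ereal_tendsto_simps1\<close>, simp)
  then have "(LINT u:{0<..<1}|lborel. real m * (psi b u * h u) - Q u) = ln (b\<^sup>2) * H 1"
    by (simp add: interval_lebesgue_integral_def)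
  then have "(LINT u:{0<..<1}|lborel. real m * (psi b u * h u)) - (LINT u:{0<..<1}|lborel. Q u) = ln (b\<^sup>2) * H 1"
    using set_integral_diff(2)[OF hi Qi] by simp
  moreover have "(LINT u:{0<..<1}|lborel. real m * (psi b u * h u)) = real m * M_u m b"
    unfolding M_u_fold(1)[OF b] h_def by (rule set_integral_mult_right)
  ultimately show "real m * M_u m b = (LINT u:{0<..<1}|lborel. 2 * u / (1 - u\<^sup>2) * parts_kernel m u b)
      + ln (b\<^sup>2) * (1 / (b - 1) ^ m - 1 / (b + 1) ^ m)"
    unfolding Q_def H_def by linarith
qed

lemma M_u_antimono:
  assumes m: "m \<ge> 1"
  shows "antimono_on {1<..} (M_u m)"
proof (rule monotone_onI)
  fix b c :: real assume bc: "b \<in> {1<..}" "c \<in> {1<..}" "b \<le> c"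
  then have b: "b > 1" and c: "c > 1" by auto
  have "(LINT u:{0<..<1}|lborel. 2 * u / (1 - u\<^sup>2) * parts_kernel m u c) \<le>
      (LINT u:{0<..<1}|lborel. 2 * u / (1 - u\<^sup>2) * parts_kernel m u b)"
  proof (rule set_integral_mono)
    show "2 * u / (1 - u\<^sup>2) * parts_kernel m u c \<le> 2 * u / (1 - u\<^sup>2) * parts_kernel m u b"
      if "u \<in> {0<..<1}" for u
    proof (rule mult_left_mono)
      show "parts_kernel m u c \<le> parts_kernel m u b"
        using parts_kernel_antimono[of u m] that bc by (simp add: monotone_on_def)
      show "0 \<le> 2 * u / (1 - u\<^sup>2)" using that sq_less[OF b, of u] by auto
    qed
  qed (intro M_u_parts b c m)+
  moreover have "ln (c\<^sup>2) * (1 / (c - 1) ^ m - 1 / (c + 1) ^ m) \<le> ln (b\<^sup>2) * (1 / (b - 1) ^ m - 1 / (b + 1) ^ m)"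
    using boundary_term_antimono[of m] bc by (simp add: monotone_on_def)
  ultimately have "real m * M_u m c \<le> real m * M_u m b"
    unfolding M_u_parts(2)[OF b m] M_u_parts(2)[OF c m] by linarith
  then show "M_u m c \<le> M_u m b" using m by simp
qed

subsection \<open>The function M\<close>

lemma inverse_power_integral_to_infinity:
  fixes b u :: real
  assumes "u < b"
  shows "set_integrable lborel {b<..} (\<lambda>v. 1 / (v - u) ^ (m + 2))"
    and "(LINT v:{b<..}|lborel. 1 / (v - u) ^ (m + 2)) = 1 / (real (m + 1) * (b - u) ^ (m + 1))"
proof -
  let ?F = "\<lambda>v. - (1 / real (m + 1)) * (1 / (v - u)) ^ (m + 1)"
  have dF: "(?F has_real_derivative 1 / (v - u) ^ (m + 2)) (at v)" if "b < v" for v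
  proof -
    have "((\<lambda>v. 1 / (v - u)) has_real_derivative - (1 / (v - u))\<^sup>2) (at v)"
      using that assms by (auto intro!: derivative_eq_intros simp: power2_eq_square)
    from DERIV_cmult[OF DERIV_power[OF this, of "m + 1"], of "- (1 / real (m + 1))"]
    show ?thesis by (rule DERIV_cong) (simp add: power_one_over power2_eq_square field_simps)
  qed
  have F0: "(?F \<longlongrightarrow> - (1 / real (m + 1)) * (1 / (b - u)) ^ (m + 1)) (at_right b)"
    using assms by (intro tendsto_intros) auto
  have "((\<lambda>v. 1 / (v - u)) \<longlongrightarrow> 0) at_top" by real_asymp
  then have "(?F \<longlongrightarrow> - (1 / real (m + 1)) * 0 ^ (m + 1)) at_top" by (intro tendsto_intros)
  then have F1: "(?F \<longlongrightarrow> 0) at_top" by simp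
  have lt: "ereal b < \<infinity>" by simp
  have e: "einterval (ereal b) \<infinity> = {b<..}" by (auto simp: einterval_def)
  have c: "isCont (\<lambda>v. 1 / (v - u) ^ (m + 2)) v" if "b < v" for v
    using that assms by (intro continuous_intros) auto
  have nn: "AE v in lborel. ereal b < ereal v \<longrightarrow> ereal v < \<infinity> \<longrightarrow> 0 \<le> 1 / (v - u) ^ (m + 2)"
    using assms by (intro AE_I2) auto
  have "((?F \<circ> real_of_ereal) \<longlongrightarrow> - (1 / real (m + 1)) * (1 / (b - u)) ^ (m + 1)) (at_right (ereal b))"
    "((?F \<circ> real_of_ereal) \<longlongrightarrow> 0) (at_left \<infinity>)"
    using F0 F1 by (simp_all only: ereal_tendsto_simps1)
  note * = interval_integral_FTC_nonneg[OF lt _ _ nn this]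
  have "set_integrable lborel (einterval (ereal b) \<infinity>) (\<lambda>v. 1 / (v - u) ^ (m + 2))"
    "(LBINT v=ereal b..\<infinity>. 1 / (v - u) ^ (m + 2)) = 0 - (- (1 / real (m + 1)) * (1 / (b - u)) ^ (m + 1))"
    by (rule *; use dF c in simp)+
  then show "set_integrable lborel {b<..} (\<lambda>v. 1 / (v - u) ^ (m + 2))"
    "(LINT v:{b<..}|lborel. 1 / (v - u) ^ (m + 2)) = 1 / (real (m + 1) * (b - u) ^ (m + 1))"
    by (simp_all only: e interval_integral_to_infinity_eq) (simp add: power_one_over)
qed

lemma inverse_power_integral_unit:
  fixes v :: real
  assumes "v > 1"
  shows "set_integrable lborel {-1<..<1} (\<lambda>u. 1 / (v - u) ^ (m + 2))"
    and "(LINT u:{-1<..<1}|lborel. 1 / (v - u) ^ (m + 2)) =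
      (1 / (v - 1) ^ (m + 1) - 1 / (v + 1) ^ (m + 1)) / real (m + 1)"
proof -
  let ?F = "\<lambda>u. 1 / real (m + 1) * (1 / (v - u)) ^ (m + 1)"
  have dF: "(?F has_real_derivative 1 / (v - u) ^ (m + 2)) (at u)" if "u \<le> 1" for u
  proof -
    have "((\<lambda>u. 1 / (v - u)) has_real_derivative (1 / (v - u))\<^sup>2) (at u)"
      using that assms by (auto intro!: derivative_eq_intros simp: power2_eq_square)
    from DERIV_cmult[OF DERIV_power[OF this, of "m + 1"], of "1 / real (m + 1)"]
    show ?thesis by (rule DERIV_cong) (simp add: power_one_over power2_eq_square field_simps)
  qed
  have c: "continuous_on {-1..1} (\<lambda>u. 1 / (v - u) ^ (m + 2))"
    using assms by (intro continuous_intros) auto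
  have "set_integrable lborel {-1..1} (\<lambda>u. 1 / (v - u) ^ (m + 2))"
    using borel_integrable_compact[OF _ c] by (simp add: set_integrable_def indicator_scaleR_eq_if)
  then show "set_integrable lborel {-1<..<1} (\<lambda>u. 1 / (v - u) ^ (m + 2))"
    by (rule set_integrable_subset) auto
  have "(LBINT u=ereal (-1)..ereal 1. 1 / (v - u) ^ (m + 2)) = ?F 1 - ?F (-1)"
  proof (rule interval_integral_FTC_finite)
    show "continuous_on {min (-1) 1..max (-1) 1} (\<lambda>u. 1 / (v - u) ^ (m + 2))" using c by simp
    show "(?F has_vector_derivative 1 / (v - x) ^ (m + 2)) (at x within {min (-1) 1..max (-1) 1})"
      if "min (-1) 1 \<le> x" "x \<le> max (-1) 1" for x
      using dF[of x] that
      by (auto simp: has_real_derivative_iff_has_vector_derivative[symmetric] intro: has_field_derivative_at_within)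
  qed
  then show "(LINT u:{-1<..<1}|lborel. 1 / (v - u) ^ (m + 2)) =
      (1 / (v - 1) ^ (m + 1) - 1 / (v + 1) ^ (m + 1)) / real (m + 1)"
    by (simp add: interval_lebesgue_integral_def power_one_over diff_divide_distrib add.commute mult_ac)
qed

definition phi :: "real \<Rightarrow> real \<Rightarrow> real" where
  "phi b v = ln ((v\<^sup>2 - 1) / (v\<^sup>2 - b\<^sup>2))"

lemma phi_nonneg:
  assumes "b > 1" "v > b"
  shows "phi b v \<ge> 0"
  using assms power_strict_mono[of b v 2] one_less_power[of b 2]
  unfolding phi_def by (intro ln_ge_zero) (simp add: le_divide_eq)

text \<open>Fubini gives this for almost every \<open>u\<close> only, but \<open>M_eq\<close> splits
  the inner integral at each fixed \<open>u\<close>. The majorant is a multiple of the integrand of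
  \<open>M_v\<close>: \<open>1 / (v - u) ^ (m + 2)\<close> is at most \<open>X ^ (m + 2) \<le> C * Y
  ^ (m + 2) \<le> C * (X ^ (m + 1) - Y ^ (m + 1))\<close>, where the last step uses
  \<open>X - Y = 2 * X * Y\<close>.\<close>

lemma phi_inner_integrable:
  assumes b: "b > 1" and m: "m \<ge> 1" and u: "-1 < u" "u < 1"
  shows "set_integrable lborel {b<..} (\<lambda>v. phi b v * (1 / (v - u) ^ (m + 2)))"
proof (rule set_integrable_bound_continuous)
  \<comment> \<open>\<open>X / Y = (v + 1) / (v - 1)\<close> decreases in \<open>v\<close>, so its
    value at \<open>b\<close> bounds it for all \<open>v > b\<close>.\<close>
  define C where "C = ((b + 1) / (b - 1)) ^ (m + 2)"
  have C: "C \<ge> 0" using b by (simp add: C_def)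
  show "set_integrable lborel {b<..} (\<lambda>v. C * (phi b v * (1 / (v - 1) ^ (m + 1) - 1 / (v + 1) ^ (m + 1))))"
    using M_v_integrable[OF b m] unfolding phi_def by (intro set_integrable_mult_right)
  show "continuous_on {b<..} (\<lambda>v. phi b v * (1 / (v - u) ^ (m + 2)))"
    unfolding phi_def using b u power_strict_mono[of b _ 2] one_less_power[of b 2]
    by (intro continuous_intros) (auto simp: power2_eq_1_iff)
  fix v assume "v \<in> {b<..}"
  then have v: "v > b" by simp
  define X Y where "X = 1 / (v - 1)" and "Y = 1 / (v + 1)"
  have XY: "0 < Y" "Y \<le> X" using v b by (auto simp: X_def Y_def divide_left_mono)
  have d: "X - Y = 2 * X * Y" using v b by (simp add: X_def Y_def diff_frac_eq)
  have "X \<le> (b + 1) / (b - 1) * Y"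
    unfolding X_def Y_def using v b by (simp add: divide_simps) (simp add: algebra_simps)
  then have XC: "X ^ (m + 2) \<le> C * Y ^ (m + 2)"
    unfolding C_def power_mult_distrib[symmetric] using XY by (intro power_mono) auto
  have "Y ^ (m + 2) = Y * Y * Y ^ m" by simp
  also have "\<dots> \<le> (X - Y) * Y ^ m"
    unfolding d using XY mult_mono[of Y "2 * X" Y Y] by (intro mult_right_mono) auto
  also have "\<dots> \<le> X ^ (m + 1) - Y ^ (m + 1)"
    using XY power_mono[of Y X m] mult_left_mono[of "Y ^ m" "X ^ m" X] by (simp add: algebra_simps)
  also have "\<dots> = 1 / (v - 1) ^ (m + 1) - 1 / (v + 1) ^ (m + 1)"
    by (simp add: X_def Y_def power_one_over)
  finally have "C * Y ^ (m + 2) \<le> C * (1 / (v - 1) ^ (m + 1) - 1 / (v + 1) ^ (m + 1))"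
    using C by (rule mult_left_mono)
  moreover have "1 / (v - u) ^ (m + 2) \<le> X ^ (m + 2)"
  proof -
    have "X ^ (m + 2) = 1 / (v - 1) ^ (m + 2)" by (simp add: X_def power_one_over)
    moreover have "1 / (v - u) ^ (m + 2) \<le> 1 / (v - 1) ^ (m + 2)"
      using v b u by (intro divide_left_mono power_mono mult_pos_pos zero_less_power) auto
    ultimately show ?thesis by simp
  qed
  ultimately have "1 / (v - u) ^ (m + 2) \<le> C * (1 / (v - 1) ^ (m + 1) - 1 / (v + 1) ^ (m + 1))"
    using XC by linarith
  then have "phi b v * (1 / (v - u) ^ (m + 2)) \<le> phi b v * (C * (1 / (v - 1) ^ (m + 1) - 1 / (v + 1) ^ (m + 1)))"
    using phi_nonneg[OF b v] by (rule mult_left_mono)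
  moreover have "0 \<le> phi b v * (1 / (v - u) ^ (m + 2))"
    using phi_nonneg[OF b v] v u b by (intro mult_nonneg_nonneg) auto
  ultimately show "\<bar>phi b v * (1 / (v - u) ^ (m + 2))\<bar> \<le>
      C * (phi b v * (1 / (v - 1) ^ (m + 1) - 1 / (v + 1) ^ (m + 1)))"
    by (simp only: abs_of_nonneg mult.left_commute)
qed auto

text \<open>The integrand is nonnegative, so integrability on the product follows from one iterated
  integral. Integration over \<open>u\<close> first is explicit and leaves the integrand of
  \<open>M_v\<close> divided by \<open>m + 1\<close>.\<close>

lemma phi_Fubini:
  assumes b: "b > 1" and m: "m \<ge> 1"
  shows "set_integrable lborel {-1<..<1} (\<lambda>u. LINT v:{b<..}|lborel. phi b v * (1 / (v - u) ^ (m + 2)))"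
    and "(LINT u:{-1<..<1}|lborel. (LINT v:{b<..}|lborel. phi b v * (1 / (v - u) ^ (m + 2)))) =
      M_v m b / real (m + 1)"
proof -
  define f where "f = (\<lambda>v u. indicator {b<..} v * (indicator {-1<..<1} u * (phi b v * (1 / (v - u) ^ (m + 2)))))"
  let ?g = "\<lambda>v. 1 / (v - 1) ^ (m + 1) - 1 / (v + 1) ^ (m + 1)"
  have meas: "case_prod f \<in> borel_measurable (lborel \<Otimes>\<^sub>M lborel)"
    unfolding f_def phi_def by measurable
  have f0: "f v u \<ge> 0" for v u
    unfolding f_def using phi_nonneg[OF b, of v] b by (auto simp: indicator_def)
  have fi: "integrable lborel (f v)" for v
  proof (cases "v > b")
    case True
    then have "set_integrable lborel {-1<..<1} (\<lambda>u. phi b v * (1 / (v - u) ^ (m + 2)))"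
      using b by (intro set_integrable_mult_right inverse_power_integral_unit) auto
    then show ?thesis using True by (simp add: f_def set_integrable_def)
  qed (simp add: f_def)
  have fint: "(LINT u|lborel. f v u) = indicator {b<..} v *\<^sub>R (1 / real (m + 1) * (phi b v * ?g v))" for v
  proof (cases "v > b")
    case True
    then have "(LINT u|lborel. f v u) = (LINT u:{-1<..<1}|lborel. phi b v * (1 / (v - u) ^ (m + 2)))"
      by (simp add: f_def set_lebesgue_integral_def)
    also have "\<dots> = phi b v * (?g v / real (m + 1))"
      using True b by (subst set_integral_mult_right, subst inverse_power_integral_unit) auto
    finally show ?thesis using True by (simp add: mult_ac)
  qed (simp add: f_def)
  have g: "set_integrable lborel {b<..} (\<lambda>v. 1 / real (m + 1) * (phi b v * ?g v))"
    using M_v_integrable[OF b m] unfolding phi_def by (intro set_integrable_mult_right)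
  have int: "integrable (lborel \<Otimes>\<^sub>M lborel) (case_prod f)"
  proof (rule lborel_pair.Fubini_integrable[OF meas])
    show "integrable lborel (\<lambda>v. LINT u|lborel. norm (case_prod f (v, u)))"
      using g by (simp only: split_conv real_norm_def abs_of_nonneg[OF f0] fint set_integrable_def)
    show "AE v in lborel. integrable lborel (\<lambda>u. case_prod f (v, u))"
      using fi by simp
  qed
  have inner: "(LINT v|lborel. f v u) =
      indicator {-1<..<1} u *\<^sub>R (LINT v:{b<..}|lborel. phi b v * (1 / (v - u) ^ (m + 2)))" for u
    unfolding set_lebesgue_integral_def f_def by (cases "u \<in> {-1<..<1}") auto
  show "set_integrable lborel {-1<..<1} (\<lambda>u. LINT v:{b<..}|lborel. phi b v * (1 / (v - u) ^ (m + 2)))"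
    using lborel_pair.integrable_snd[OF int] unfolding inner set_integrable_def .
  have "(LINT u:{-1<..<1}|lborel. (LINT v:{b<..}|lborel. phi b v * (1 / (v - u) ^ (m + 2)))) =
      (LINT u|lborel. (LINT v|lborel. f v u))"
    unfolding inner set_lebesgue_integral_def ..
  also have "\<dots> = (LINT v|lborel. (LINT u|lborel. f v u))"
    by (rule lborel_pair.Fubini_integral[OF int])
  also have "\<dots> = (LINT v:{b<..}|lborel. 1 / real (m + 1) * (phi b v * ?g v))"
    unfolding fint set_lebesgue_integral_def ..
  also have "\<dots> = 1 / real (m + 1) * M_v m b"
    unfolding M_v_def phi_def by (rule set_integral_mult_right)
  finally show "(LINT u:{-1<..<1}|lborel. (LINT v:{b<..}|lborel. phi b v * (1 / (v - u) ^ (m + 2)))) =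
      M_v m b / real (m + 1)" by simp
qed

lemma M_eq:
  assumes b: "b > 1" and m: "m \<ge> 1"
  shows "M (m + 2) b = (M_v m b + M_u m b) / real (m + 1)"
proof -
  have e: "einterval (-1) 1 = {-1<..<1}" "einterval (ereal b) \<infinity> = {b<..}"
    by (auto simp: einterval_def one_ereal_def)
  have inner: "(LBINT v=ereal b..\<infinity>. ln (((v\<^sup>2 - 1) * (u\<^sup>2 - b\<^sup>2)) / ((v\<^sup>2 - b\<^sup>2) * (u\<^sup>2 - 1))) / (v - u) ^ (m + 2))
      = (LINT v:{b<..}|lborel. phi b v * (1 / (v - u) ^ (m + 2))) + 1 / real (m + 1) * (psi b u / (b - u) ^ (m + 1))"
    if u: "u \<in> {-1<..<1}" for u
  proof -
    have u': "-1 < u" "u < 1" "u < b" using u b by auto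
    note sq = sq_less[OF b u'(1,2)]
    have ln: "ln (((v\<^sup>2 - 1) * (u\<^sup>2 - b\<^sup>2)) / ((v\<^sup>2 - b\<^sup>2) * (u\<^sup>2 - 1))) / (v - u) ^ (m + 2) =
       phi b v * (1 / (v - u) ^ (m + 2)) + psi b u * (1 / (v - u) ^ (m + 2))" if "v \<in> {b<..}" for v
    proof -
      have v: "v\<^sup>2 > b\<^sup>2" using that b power_strict_mono[of b v 2] by simp
      have "((v\<^sup>2 - 1) * (u\<^sup>2 - b\<^sup>2)) / ((v\<^sup>2 - b\<^sup>2) * (u\<^sup>2 - 1)) =
         (v\<^sup>2 - 1) / (v\<^sup>2 - b\<^sup>2) * ((u\<^sup>2 - b\<^sup>2) / (u\<^sup>2 - 1))" by simp
      \<comment> \<open>Numerator and denominator are both negative; the flip makes them positive,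
        as in \<open>psi\<close>.\<close>
      also have "(u\<^sup>2 - b\<^sup>2) / (u\<^sup>2 - 1) = (b\<^sup>2 - u\<^sup>2) / (1 - u\<^sup>2)"
        by (metis minus_diff_eq minus_divide_divide)
      finally have "ln (((v\<^sup>2 - 1) * (u\<^sup>2 - b\<^sup>2)) / ((v\<^sup>2 - b\<^sup>2) * (u\<^sup>2 - 1))) = phi b v + psi b u"
        unfolding phi_def psi_def using sq v by (simp only:) (rule ln_mult_pos; simp)
      then show ?thesis by (simp only:) (simp add: add_divide_distrib)
    qed
    have "(LBINT v=ereal b..\<infinity>. ln (((v\<^sup>2 - 1) * (u\<^sup>2 - b\<^sup>2)) / ((v\<^sup>2 - b\<^sup>2) * (u\<^sup>2 - 1))) / (v - u) ^ (m + 2)) =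
       (LINT v:{b<..}|lborel. phi b v * (1 / (v - u) ^ (m + 2)) + psi b u * (1 / (v - u) ^ (m + 2)))"
      unfolding interval_integral_to_infinity_eq by (intro set_lebesgue_integral_cong allI impI ln) auto
    also have "\<dots> = (LINT v:{b<..}|lborel. phi b v * (1 / (v - u) ^ (m + 2))) +
       (LINT v:{b<..}|lborel. psi b u * (1 / (v - u) ^ (m + 2)))"
      using u' by (intro set_integral_add(2) phi_inner_integrable[OF b m] set_integrable_mult_right
          inverse_power_integral_to_infinity) auto
    also have "(LINT v:{b<..}|lborel. psi b u * (1 / (v - u) ^ (m + 2))) =
        psi b u * (1 / (real (m + 1) * (b - u) ^ (m + 1)))"
      unfolding set_integral_mult_right inverse_power_integral_to_infinity(2)[OF u'(3)] ..
    finally show ?thesis by simp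
  qed
  have i2: "set_integrable lborel {-1<..<1} (\<lambda>u. 1 / real (m + 1) * (psi b u / (b - u) ^ (m + 1)))"
    by (intro set_integrable_mult_right M_u_integrable b)
  have outer: "(LBINT u=-1..1. f u) = (LINT u:{-1<..<1}|lborel. f u)" for f :: "real \<Rightarrow> real"
  proof -
    have "(-1::ereal) \<le> 1" by (simp add: one_ereal_def)
    then show ?thesis by (simp add: interval_lebesgue_integral_def e(1))
  qed
  have "M (m + 2) b = (LINT u:{-1<..<1}|lborel.
      (LINT v:{b<..}|lborel. phi b v * (1 / (v - u) ^ (m + 2))) + 1 / real (m + 1) * (psi b u / (b - u) ^ (m + 1)))"
    unfolding M_def outer
    by (intro set_lebesgue_integral_cong allI impI inner) auto
  also have "\<dots> = M_v m b / real (m + 1) + 1 / real (m + 1) * M_u m b"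
    unfolding set_integral_add(2)[OF phi_Fubini(1)[OF b m] i2] phi_Fubini(2)[OF b m]
      set_integral_mult_right M_u_def ..
  finally show ?thesis by (simp add: add_divide_distrib)
qed

lemma M_pos:
  assumes "b > 1" "m \<ge> 1"
  shows "M (m + 2) b > 0"
  unfolding M_eq[OF assms] using M_v_nonneg[OF assms] M_u_pos[OF assms(1), of m] by simp

lemma M_continuous:
  assumes "m \<ge> 1"
  shows "continuous_on {1<..} (M (m + 2))"
proof -
  have "continuous_on {1<..} (\<lambda>b. (M_v m b + M_u m b) / real (m + 1))"
    using assms by (intro continuous_intros M_v_continuous M_u_continuous) auto
  then show ?thesis
    by (rule continuous_on_eq) (use assms M_eq in auto)
qed

lemma M_antimono:
  assumes "m \<ge> 1"
  shows "antimono_on {1<..} (M (m + 2))"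
proof -
  have "antimono_on {1<..} (\<lambda>b. (M_v m b + M_u m b) / real (m + 1))"
    using antimono_on_add[OF M_v_antimono[OF assms] M_u_antimono[OF assms]]
    by (auto simp: monotone_on_def intro!: divide_right_mono)
  then show ?thesis
    by (rule antimono_on_cong) (use assms M_eq in auto)
qed

section \<open>Asymptotics of M and a global bound\<close>

lemma M_at_1:
  assumes "m \<ge> 1"
  shows "((\<lambda>b. (b - 1) ^ m * M (m + 2) b) \<longlongrightarrow> 2 * P m 1 / (real m * real (m + 1))) (at_right 1)"
proof -
  have "((\<lambda>b. ((b - 1) ^ m * M_v m b + (b - 1) ^ m * M_u m b) / real (m + 1)) \<longlongrightarrow>
      (P m 1 / real m + P m 1 / real m) / real (m + 1)) (at_right 1)"
    by (intro tendsto_intros M_v_at_1 M_u_at_1 assms) auto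
  then have *: "((\<lambda>b. ((b - 1) ^ m * M_v m b + (b - 1) ^ m * M_u m b) / real (m + 1)) \<longlongrightarrow>
      2 * P m 1 / (real m * real (m + 1))) (at_right 1)" by simp
  have "\<forall>\<^sub>F b in at_right 1. ((b - 1) ^ m * M_v m b + (b - 1) ^ m * M_u m b) / real (m + 1) = (b - 1) ^ m * M (m + 2) b"
    unfolding eventually_at_filter using M_eq[OF _ assms]
    by (intro always_eventually) (simp add: distrib_left)
  from Lim_transform_eventually[OF * this] show ?thesis .
qed

lemma M_at_top:
  assumes "m \<ge> 1"
  shows "((\<lambda>b. b ^ (m + 1) / ln b * M (m + 2) b) \<longlongrightarrow> 4 / real (m + 1)) at_top"
proof -
  have "((\<lambda>b. (b ^ (m + 1) / ln b * M_v m b + b ^ (m + 1) / ln b * M_u m b) / real (m + 1)) \<longlongrightarrow>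
      (0 + 4) / real (m + 1)) at_top"
    by (intro tendsto_intros M_v_at_top M_u_at_top assms) auto
  then have *: "((\<lambda>b. (b ^ (m + 1) / ln b * M_v m b + b ^ (m + 1) / ln b * M_u m b) / real (m + 1)) \<longlongrightarrow>
      4 / real (m + 1)) at_top" by simp
  have "\<forall>\<^sub>F b in at_top. (b ^ (m + 1) / ln b * M_v m b + b ^ (m + 1) / ln b * M_u m b) / real (m + 1) =
      b ^ (m + 1) / ln b * M (m + 2) b"
    using eventually_gt_at_top[of 1]
    by eventually_elim (subst M_eq[OF _ assms], simp_all only: distrib_left times_divide_eq_right)
  from Lim_transform_eventually[OF * this] show ?thesis .
qed

text \<open>Near 1 the bound is the limit plus 1, and far out it follows from the decay. In between,
  monotonicity of \<open>M\<close> takes the place of a compactness argument.\<close>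

lemma M_upper_bound:
  assumes m: "m \<ge> 1"
  obtains C where "C > 0" "\<And>b. b > 1 \<Longrightarrow> (b - 1) ^ m * M (m + 2) b \<le> C"
proof -
  define K where "K = 2 * P m 1 / (real m * real (m + 1)) + 1"
  have "\<forall>\<^sub>F b in at_right 1. (b - 1) ^ m * M (m + 2) b < K"
    using M_at_1[OF m] unfolding K_def by (rule order_tendstoD) simp
  then obtain c where c: "c > 1" "\<And>b. 1 < b \<Longrightarrow> b < c \<Longrightarrow> (b - 1) ^ m * M (m + 2) b < K"
    by (auto simp: eventually_at_right_field)
  \<comment> \<open>The extra factor \<open>ln b / b\<close> turns the expression into
    \<open>b ^ m * M (m + 2) b\<close>, which therefore tends to 0.\<close>
  have "((\<lambda>b. b ^ (m + 1) / ln b * M (m + 2) b * (ln b / b)) \<longlongrightarrow> 4 / real (m + 1) * 0) at_top"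
    by (intro tendsto_mult M_at_top m) real_asymp
  then have "\<forall>\<^sub>F b in at_top. b ^ (m + 1) / ln b * M (m + 2) b * (ln b / b) < 1"
    by (rule order_tendstoD) simp
  then obtain d0 where d0: "\<And>b. b \<ge> d0 \<Longrightarrow> b ^ (m + 1) / ln b * M (m + 2) b * (ln b / b) < 1"
    by (auto simp: eventually_at_top_linorder)
  define d where "d = max d0 (c + 1)"
  have d: "d > c" "d > 1" using c by (auto simp: d_def)
  define C where "C = max 1 (max K ((d - 1) ^ m * M (m + 2) c))"
  have "(b - 1) ^ m * M (m + 2) b \<le> C" if b: "b > 1" for b
  proof -
    consider "b < c" | "c \<le> b" "b \<le> d" | "d < b" by linarith
    then show ?thesis
    proof cases
      case 1
      then show ?thesis using c(2)[OF b] by (simp add: C_def)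
    next
      case 2
      have "M (m + 2) b \<le> M (m + 2) c"
        using M_antimono[OF m] c 2 by (auto simp: monotone_on_def)
      then have "(b - 1) ^ m * M (m + 2) b \<le> (d - 1) ^ m * M (m + 2) c"
        using 2 b M_pos[OF b m] by (intro mult_mono power_mono) auto
      then show ?thesis by (simp add: C_def)
    next
      case 3
      then have b2: "b > 1" "b \<ge> d0" using d by (auto simp: d_def)
      have "(b - 1) ^ m * M (m + 2) b \<le> b ^ m * M (m + 2) b"
        using b M_pos[OF b m] by (intro mult_right_mono power_mono) auto
      also have "\<dots> = b ^ (m + 1) / ln b * M (m + 2) b * (ln b / b)"
        using b by simp
      also have "\<dots> < 1" by (rule d0[OF b2(2)])
      finally show ?thesis by (simp add: C_def)
    qed
  qed
  moreover have "C > 0" by (simp add: C_def)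
  ultimately show ?thesis using that by blast
qed

subsection \<open>The function F\<close>

definition endpoint :: "real \<Rightarrow> real \<Rightarrow> real" where
  "endpoint r l = sqrt (((exp l)\<^sup>2 - r\<^sup>2) / (1 - r\<^sup>2))"

definition radial_integrand :: "nat \<Rightarrow> real \<Rightarrow> real \<Rightarrow> real" where
  "radial_integrand m l r = r ^ (m - 1) / sqrt (1 - r\<^sup>2) ^ m * M (m + 2) (endpoint r l)"

lemma unit_sq:
  fixes r :: real
  assumes "0 < r" "r < 1"
  shows "r\<^sup>2 < 1" "0 < sqrt (1 - r\<^sup>2)" "sqrt (1 - r\<^sup>2) < 1" "(sqrt (1 - r\<^sup>2))\<^sup>2 = 1 - r\<^sup>2"
proof -
  show 1: "r\<^sup>2 < 1" using assms by (simp add: power_less_one_iff abs_square_less_1)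
  then show "0 < sqrt (1 - r\<^sup>2)" "sqrt (1 - r\<^sup>2) < 1" "(sqrt (1 - r\<^sup>2))\<^sup>2 = 1 - r\<^sup>2"
    using assms by auto
qed

lemma endpoint_sq:
  assumes "0 < r" "r < 1" "l > 0"
  shows "(endpoint r l)\<^sup>2 = ((exp l)\<^sup>2 - r\<^sup>2) / (1 - r\<^sup>2)"
proof -
  have "(exp l)\<^sup>2 > 1" using assms one_less_power[of "exp l" 2] by simp
  then show ?thesis
    unfolding endpoint_def using unit_sq[OF assms(1,2)] by (intro real_sqrt_pow2) auto
qed

lemma endpoint_ge:
  assumes "0 < r" "r < 1" "l > 0"
  shows "endpoint r l \<ge> exp l"
proof (rule power2_le_imp_le)
  have "(exp l)\<^sup>2 > 1" using assms one_less_power[of "exp l" 2] by simp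
  then have "(exp l)\<^sup>2 * (1 - r\<^sup>2) \<le> (exp l)\<^sup>2 - r\<^sup>2"
    using mult_right_mono[of 1 "(exp l)\<^sup>2" "r\<^sup>2"] by (simp add: algebra_simps)
  then show "(exp l)\<^sup>2 \<le> (endpoint r l)\<^sup>2"
    unfolding endpoint_sq[OF assms] using unit_sq[OF assms(1,2)] by (simp add: le_divide_eq)
  show "0 \<le> endpoint r l"
    unfolding endpoint_def using \<open>(exp l)\<^sup>2 > 1\<close> unit_sq[OF assms(1,2)] by auto
qed

lemma endpoint_gt_1: "0 < r \<Longrightarrow> r < 1 \<Longrightarrow> l > 0 \<Longrightarrow> endpoint r l > 1"
  using endpoint_ge[of r l] one_less_exp_iff[of l] by linarith

lemma endpoint_mono:
  assumes "0 < r" "r < 1" "0 < k" "k \<le> l"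
  shows "endpoint r k \<le> endpoint r l"
  unfolding endpoint_def using assms unit_sq[OF assms(1,2)]
  by (intro real_sqrt_le_mono divide_right_mono diff_right_mono power_mono) auto

text \<open>With \<open>a = exp l\<close> and \<open>s = sqrt (1 - r^2)\<close> it amounts to
  \<open>a - 1 + s \<le> sqrt (a^2 - r^2)\<close>, and squaring reduces this to
  \<open>(a - 1) * s \<le> a - 1\<close>. Its \<open>m\<close>-th power cancels the weight
  \<open>1 / s ^ m\<close> and makes the bound on the integrand uniform in \<open>r\<close>.\<close>

lemma endpoint_gap:
  assumes "0 < r" "r < 1" "l > 0"
  shows "sqrt (1 - r\<^sup>2) * (endpoint r l - 1) \<ge> exp l - 1"
proof -
  define a s where "a = exp l" and "s = sqrt (1 - r\<^sup>2)"
  note u = unit_sq[OF assms(1,2)]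
  have s: "0 < s" "s < 1" "s\<^sup>2 = 1 - r\<^sup>2" using u by (auto simp: s_def)
  have a: "a > 1" using assms by (simp add: a_def)
  have a2: "a\<^sup>2 > 1" using one_less_power[OF a, of 2] by simp
  have "sqrt (1 - r\<^sup>2) * (endpoint r l - 1) = sqrt (a\<^sup>2 - r\<^sup>2) - s"
    unfolding endpoint_def a_def[symmetric] real_sqrt_divide s_def[symmetric] using s
    by (simp add: right_diff_distrib)
  moreover have "a - 1 + s \<le> sqrt (a\<^sup>2 - r\<^sup>2)"
  proof (rule real_le_rsqrt)
    have "(a - 1) * s \<le> a - 1" using a s mult_left_mono[of s 1 "a - 1"] by simp
    moreover have "(a - 1 + s)\<^sup>2 = a\<^sup>2 - 2 * a + 1 + 2 * ((a - 1) * s) + s\<^sup>2"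
      by (simp add: power2_eq_square algebra_simps)
    ultimately show "(a - 1 + s)\<^sup>2 \<le> a\<^sup>2 - r\<^sup>2" unfolding s(3) by simp
  qed
  ultimately show ?thesis by (simp add: a_def)
qed

lemma radial_integrand_pos: "0 < r \<Longrightarrow> r < 1 \<Longrightarrow> l > 0 \<Longrightarrow> m \<ge> 1 \<Longrightarrow> radial_integrand m l r > 0"
  unfolding radial_integrand_def using unit_sq[of r] M_pos[OF endpoint_gt_1]
  by (intro mult_pos_pos divide_pos_pos zero_less_power) auto

lemma radial_integrand_le:
  assumes C: "\<And>b. b > 1 \<Longrightarrow> (b - 1) ^ m * M (m + 2) b \<le> C"
    and r: "0 < r" "r < 1" and l: "l > 0" and m: "m \<ge> 1"
  shows "radial_integrand m l r \<le> C / (exp l - 1) ^ m"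
proof -
  define s b where "s = sqrt (1 - r\<^sup>2)" and "b = endpoint r l"
  note u = unit_sq[OF r]
  have s: "s > 0" using u by (simp add: s_def)
  have b: "b > 1" unfolding b_def by (rule endpoint_gt_1[OF r l])
  have Mb: "0 < M (m + 2) b" "M (m + 2) b \<le> C / (b - 1) ^ m"
    using M_pos[OF b m] C[OF b] b by (auto simp: le_divide_eq mult_ac)
  have C0: "C \<ge> 0"
    using C[OF b] Mb b by (meson less_imp_le mult_nonneg_nonneg order_trans zero_le_power diff_ge_0_iff_ge)
  have "radial_integrand m l r \<le> 1 / s ^ m * (C / (b - 1) ^ m)"
    unfolding radial_integrand_def s_def[symmetric] b_def[symmetric] using s r Mb
    by (intro mult_mono divide_right_mono power_le_one) auto
  also have "\<dots> = C / (s * (b - 1)) ^ m" by (simp add: power_mult_distrib)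
  also have "\<dots> \<le> C / (exp l - 1) ^ m"
    using endpoint_gap[OF r l] C0 s b l unfolding s_def[symmetric] b_def[symmetric]
    by (intro divide_left_mono power_mono mult_pos_pos zero_less_power) auto
  finally show ?thesis .
qed

lemma isCont_M: "b > 1 \<Longrightarrow> m \<ge> 1 \<Longrightarrow> isCont (M (m + 2)) b"
  using M_continuous[of m] continuous_on_eq_continuous_at[OF open_greaterThan, of 1 "M (m + 2)"] by auto

lemma continuous_on_radial_integrand:
  assumes l: "l > 0" and m: "m \<ge> 1"
  shows "continuous_on {0<..<1} (radial_integrand m l)"
proof (intro continuous_at_imp_continuous_on ballI)
  fix r :: real assume "r \<in> {0<..<1}"
  then have r: "0 < r" "r < 1" by auto
  note u = unit_sq[OF r]
  have w: "isCont (\<lambda>r. endpoint r l) r"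
    unfolding endpoint_def using u by (intro continuous_intros) auto
  have "isCont (\<lambda>r. M (m + 2) (endpoint r l)) r"
    by (rule isCont_o2[OF w isCont_M[OF endpoint_gt_1[OF r l] m]])
  then show "isCont (radial_integrand m l) r"
    unfolding radial_integrand_def using u by (intro continuous_intros) auto
qed

lemma radial_integrand_integrable:
  assumes l: "l > 0" and m: "m \<ge> 1"
  shows "set_integrable lborel {0<..<1} (radial_integrand m l)"
proof -
  obtain C where C: "C > 0" "\<And>b. b > 1 \<Longrightarrow> (b - 1) ^ m * M (m + 2) b \<le> C"
    using M_upper_bound[OF m] by blast
  show ?thesis
  proof (rule set_integrable_bound_continuous[OF _ continuous_on_radial_integrand[OF l m] set_integrable_const_Ioo])
    show "\<bar>radial_integrand m l r\<bar> \<le> C / (exp l - 1) ^ m" if "r \<in> {0<..<1}" for r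
      using radial_integrand_le[OF C(2)] radial_integrand_pos[of r l m] that l m by simp
  qed auto
qed

section \<open>Sphere volumes and Beta integrals\<close>

definition sphere_factor :: "nat \<Rightarrow> real" where
  "sphere_factor m = 2 * sphere_vol m * sphere_vol (m - 1) / sphere_vol (m + 1)"

lemma F_eq:
  assumes "m \<ge> 1"
  shows "F (m + 2) l = sphere_factor m * (LINT r:{0<..<1}|lborel. radial_integrand m l r)"
proof -
  have "einterval 0 1 = {0<..<1}" by (auto simp: einterval_def one_ereal_def zero_ereal_def)
  moreover have "m + 2 - 2 = m" "m + 2 - 3 = m - 1" "m + 2 - 1 = m + 1" using assms by auto
  ultimately show ?thesis
    unfolding F_def sphere_factor_def radial_integrand_def endpoint_def
    by (simp add: interval_lebesgue_integral_def)
qed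

lemma Gamma_add_1: "x > 0 \<Longrightarrow> Gamma (x + 1) = x * Gamma x" for x :: real
  by (intro Gamma_plus1) (auto simp: nonpos_Ints_def)

lemma sphere_vol_Gamma: "sphere_vol k = 2 * pi powr (real (k + 1) / 2) / Gamma (real (k + 1) / 2)"
proof -
  define y where "y = real (k + 1) / 2"
  have y: "y > 0" "real (k + 1) = 2 * y" by (auto simp: y_def)
  have "Gamma y > 0" using y by (intro Gamma_real_pos)
  then show ?thesis
    unfolding sphere_vol_eq unit_ball_vol_def y(2) using y(1) by (simp add: Gamma_add_1)
qed

text \<open>With \<open>x = m / 2\<close> the three volumes involve \<open>Gamma\<close> at
  \<open>x\<close>, \<open>x + 1 / 2\<close> and \<open>x + 1\<close>. The first and the last differ
  by the factor \<open>x\<close>, so only the middle one survives.\<close>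

lemma sphere_factor_eq:
  assumes "m \<ge> 1"
  shows "sphere_factor m = 2 * real m * pi powr ((real m - 1) / 2) / Gamma ((real m + 1) / 2)"
proof -
  define x where "x = real m / 2"
  have x: "x > 0" using assms by (simp add: x_def)
  have e: "real (m + 1) / 2 = x + 1 / 2" "real (m - 1 + 1) / 2 = x" "real (m + 1 + 1) / 2 = x + 1"
    "(real m - 1) / 2 = x - 1 / 2" "(real m + 1) / 2 = x + 1 / 2"
    using assms by (auto simp: x_def field_simps)
  have pi: "pi powr (x + 1 / 2) * pi powr x / pi powr (x + 1) = pi powr (x - 1 / 2)"
    by (simp add: powr_add[symmetric] powr_diff[symmetric])
  have G: "Gamma x > 0" "Gamma (x + 1 / 2) > 0" using x by (auto intro!: Gamma_real_pos)
  have "sphere_factor m = 4 * (pi powr (x + 1 / 2) * pi powr x / pi powr (x + 1)) * Gamma (x + 1) / (Gamma (x + 1 / 2) * Gamma x)"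
    unfolding sphere_factor_def sphere_vol_Gamma e by (simp add: mult_ac)
  also have "\<dots> = 4 * x * pi powr (x - 1 / 2) / Gamma (x + 1 / 2)"
    unfolding pi Gamma_add_1[OF x] using G by simp
  finally show ?thesis unfolding e by (simp add: x_def)
qed

lemma sphere_factor_pos: "m \<ge> 1 \<Longrightarrow> sphere_factor m > 0"
  unfolding sphere_factor_eq by (intro divide_pos_pos mult_pos_pos Gamma_real_pos) auto

text \<open>The substitution \<open>t = r^2\<close> gives a Beta integral. The exponent
  \<open>k\<close> will be \<open>m\<close> for the limit at 0 and \<open>1\<close> for the limit at
  infinity.\<close>

lemma Beta_radial_integral:
  assumes m: "m \<ge> 1"
  shows "(LINT r:{0<..<1}|lborel. r ^ (m - 1) * sqrt (1 - r\<^sup>2) ^ k) = Beta (real m / 2) (real k / 2 + 1) / 2"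
proof -
  let ?f = "\<lambda>t. t powr (real m / 2 - 1) * (1 - t) powr (real k / 2)"
  let ?g = "\<lambda>r::real. r\<^sup>2"
  have eq: "?f (?g r) * (2 * r) = 2 * (r ^ (m - 1) * sqrt (1 - r\<^sup>2) ^ k)" if r: "0 < r" "r < 1" for r
  proof -
    note u = unit_sq[OF r]
    have "(r\<^sup>2) powr (real m / 2 - 1) = r powr (real m - 2)"
      using r by (simp add: powr_powr powr_realpow[symmetric] powr_numeral[symmetric] right_diff_distrib del: powr_numeral)
    moreover have "r powr (real m - 2) * r = r powr (real m - 1)"
      using r powr_add[of r "real m - 2" 1] by simp
    moreover have "r powr (real m - 1) = r ^ (m - 1)"
      using r m powr_realpow[of r "m - 1"] by (simp add: of_nat_diff)
    moreover have "(1 - r\<^sup>2) powr (real k / 2) = sqrt (1 - r\<^sup>2) ^ k"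
      using u by (simp add: powr_half_sqrt[symmetric] powr_powr powr_realpow[symmetric])
    ultimately show ?thesis by (simp add: mult_ac)
  qed
  have ei: "einterval 0 1 = {0<..<1}" by (auto simp: einterval_def one_ereal_def zero_ereal_def)
  have b: "\<bar>2 * (r ^ (m - 1) * sqrt (1 - r\<^sup>2) ^ k)\<bar> \<le> 2" if "r \<in> {0<..<1}" for r
  proof -
    have r: "0 < r" "r < 1" using that by auto
    note u = unit_sq[OF r]
    have "r ^ (m - 1) * sqrt (1 - r\<^sup>2) ^ k \<le> 1 * 1"
      using r u by (intro mult_mono power_le_one) auto
    then show ?thesis using r u by simp
  qed
  have "set_integrable lborel {0<..<1} (\<lambda>r. 2 * (r ^ (m - 1) * sqrt (1 - r\<^sup>2) ^ k))"
    by (rule set_integrable_bound_continuous[OF _ _ set_integrable_const_Ioo b])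
       (auto intro!: continuous_intros)
  then have i: "set_integrable lborel (einterval 0 1) (\<lambda>r. ?f (?g r) * (2 * r))"
    unfolding ei by (subst set_integrable_cong[OF refl refl eq]) auto
  have sub: "set_integrable lborel (einterval 0 1) ?f"
    "(LBINT t=0..1. ?f t) = (LBINT r=0..1. ?f (?g r) * (2 * r))"
  proof -
    have lt: "(0::ereal) < 1" by simp
    have io: "0 < x \<and> x < 1" if "0 < ereal x" "ereal x < 1" for x
      using that by (simp add: one_ereal_def zero_ereal_def)
    have d: "(?g has_real_derivative 2 * x) (at x)" for x :: real
      by (auto intro!: derivative_eq_intros)
    have fc: "isCont ?f (?g x)" if "0 < ereal x" "ereal x < 1" for x
      using io[OF that] unit_sq[of x] by (intro continuous_intros) auto
    have gc: "isCont (\<lambda>r. 2 * r) x" for x :: real by (intro continuous_intros)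
    have f0: "0 \<le> ?f (?g x)" for x by simp
    have g0: "0 \<le> 2 * x" if "0 \<le> ereal x" for x using that by (simp add: zero_ereal_def)
    have L0: "((ereal \<circ> ?g \<circ> real_of_ereal) \<longlongrightarrow> 0) (at_right 0)"
    proof -
      have "(?g \<longlongrightarrow> 0\<^sup>2) (at_right 0)" by (intro tendsto_intros)
      then show ?thesis unfolding zero_ereal_def by (simp add: ereal_tendsto_simps)
    qed
    have L1: "((ereal \<circ> ?g \<circ> real_of_ereal) \<longlongrightarrow> 1) (at_left 1)"
    proof -
      have "(?g \<longlongrightarrow> 1\<^sup>2) (at_left 1)" by (intro tendsto_intros)
      then show ?thesis unfolding one_ereal_def by (simp add: ereal_tendsto_simps)
    qed
    from interval_integral_substitution_nonneg[where a=0 and b=1 and g="?g" and f="?f" and g'="\<lambda>r. 2 * r",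
        OF lt d fc gc f0 g0 L0 L1 i]
    show "set_integrable lborel (einterval 0 1) ?f"
      "(LBINT t=0..1. ?f t) = (LBINT r=0..1. ?f (?g r) * (2 * r))" by auto
  qed
  have "(LINT t:{0<..<1}|lborel. ?f t) = integral {0<..<1} ?f"
    using sub(1) unfolding ei by (rule set_borel_integral_eq_integral(2))
  also have "\<dots> = Beta (real m / 2) (real k / 2 + 1)"
    using has_integral_Beta_real[of "real m / 2" "real k / 2 + 1"] m
    by (intro integral_unique) (simp add: has_integral_Icc_iff_Ioo)
  finally have B: "(LINT t:{0<..<1}|lborel. ?f t) = Beta (real m / 2) (real k / 2 + 1)" .
  have "(LINT t:{0<..<1}|lborel. ?f t) = (LINT r:{0<..<1}|lborel. ?f (?g r) * (2 * r))"
    using sub(2) by (simp add: interval_lebesgue_integral_def ei)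
  also have "\<dots> = (LINT r:{0<..<1}|lborel. 2 * (r ^ (m - 1) * sqrt (1 - r\<^sup>2) ^ k))"
    by (rule set_lebesgue_integral_cong) (use eq in auto)
  also have "\<dots> = 2 * (LINT r:{0<..<1}|lborel. r ^ (m - 1) * sqrt (1 - r\<^sup>2) ^ k)"
    by (rule set_integral_mult_right)
  finally show ?thesis using B by simp
qed

section \<open>Positivity, bound, monotonicity and continuity of F\<close>

lemma F_pos:
  assumes "l > 0" "m \<ge> 1"
  shows "F (m + 2) l > 0"
  unfolding F_eq[OF assms(2)] using assms radial_integrand_pos sphere_factor_pos
  by (intro mult_pos_pos set_lebesgue_integral_pos radial_integrand_integrable) auto

lemma F_upper_bound:
  assumes m: "m \<ge> 1"
  shows "\<exists>C>0. \<forall>l>0. F (m + 2) l \<le> C / (exp l - 1) ^ m"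
proof -
  obtain C where C: "C > 0" "\<And>b. b > 1 \<Longrightarrow> (b - 1) ^ m * M (m + 2) b \<le> C"
    using M_upper_bound[OF m] by blast
  have "F (m + 2) l \<le> (sphere_factor m * C) / (exp l - 1) ^ m" if l: "l > 0" for l
  proof -
    have "(LINT r:{0<..<1}|lborel. radial_integrand m l r) \<le> (LINT r:{0<..<1::real}|lborel. C / (exp l - 1) ^ m)"
      using radial_integrand_le[OF C(2)] l m
      by (intro set_integral_mono radial_integrand_integrable set_integrable_const_Ioo) auto
    also have "\<dots> = C / (exp l - 1) ^ m" by (simp add: set_integral_const)
    finally show ?thesis
      unfolding F_eq[OF m] using mult_left_mono[OF _ less_imp_le[OF sphere_factor_pos[OF m]]] by fastforce
  qed
  then show ?thesis using C(1) sphere_factor_pos[OF m] by (intro exI[of _ "sphere_factor m * C"]) auto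
qed

lemma F_antimono:
  assumes m: "m \<ge> 1"
  shows "antimono_on {0<..} (F (m + 2))"
proof (rule monotone_onI)
  fix k l :: real assume kl: "k \<in> {0<..}" "l \<in> {0<..}" "k \<le> l"
  have "(LINT r:{0<..<1}|lborel. radial_integrand m l r) \<le> (LINT r:{0<..<1}|lborel. radial_integrand m k r)"
  proof (rule set_integral_mono)
    fix r :: real assume r: "r \<in> {0<..<1}"
    have "M (m + 2) (endpoint r l) \<le> M (m + 2) (endpoint r k)"
      using M_antimono[OF m] endpoint_mono[of r k l] endpoint_gt_1[of r k] endpoint_gt_1[of r l] r kl
      by (auto simp: monotone_on_def)
    then show "radial_integrand m l r \<le> radial_integrand m k r"
      unfolding radial_integrand_def using r unit_sq[of r] by (intro mult_left_mono) auto
  qed (use kl m in \<open>auto intro!: radial_integrand_integrable\<close>)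
  then show "F (m + 2) l \<le> F (m + 2) k"
    unfolding F_eq[OF m] using sphere_factor_pos[OF m] by simp
qed

lemma tendsto_endpoint:
  assumes "0 < r" "r < 1"
  shows "((\<lambda>l. endpoint r l) \<longlongrightarrow> endpoint r k) (at k within A)"
  unfolding endpoint_def using unit_sq[OF assms] by (intro tendsto_intros) auto

lemma F_continuous:
  assumes m: "m \<ge> 1"
  shows "continuous_on {0<..} (F (m + 2))"
proof -
  obtain C where C: "C > 0" "\<And>b. b > 1 \<Longrightarrow> (b - 1) ^ m * M (m + 2) b \<le> C"
    using M_upper_bound[OF m] by blast
  let ?I = "\<lambda>l. LINT r:{0<..<1}|lborel. radial_integrand m l r"
  have "isCont (F (m + 2)) l" if l: "l > 0" for l
  proof -
    \<comment> \<open>Parameters above \<open>c > 0\<close> keep \<open>exp t - 1\<close> away from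
      0, so one constant dominates all the integrands.\<close>
    define c where "c = l / 2"
    have c: "c > 0" "c < l" using l by (auto simp: c_def)
    have "(?I \<longlongrightarrow> ?I l) (at l within {c<..})"
    proof (rule set_integral_tendsto_at_within[OF _ _ _ set_integrable_const_Ioo])
      show "continuous_on {0<..<1} (radial_integrand m t)" if "t \<in> {c<..}" for t
        using that c by (intro continuous_on_radial_integrand m) auto
      show "continuous_on {0<..<1} (radial_integrand m l)" by (intro continuous_on_radial_integrand m l)
      show "\<bar>radial_integrand m t r\<bar> \<le> C / (exp c - 1) ^ m" if "t \<in> {c<..}" "r \<in> {0<..<1}" for t r
      proof -
        have "\<bar>radial_integrand m t r\<bar> \<le> C / (exp t - 1) ^ m"
          using radial_integrand_le[OF C(2)] radial_integrand_pos[of r t m] that c m by simp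
        also have "\<dots> \<le> C / (exp c - 1) ^ m"
          using that c C by (intro divide_left_mono power_mono mult_pos_pos zero_less_power) auto
        finally show ?thesis .
      qed
      show "((\<lambda>t. radial_integrand m t r) \<longlongrightarrow> radial_integrand m l r) (at l within {c<..})" if "r \<in> {0<..<1}" for r
        unfolding radial_integrand_def using that l m
        by (intro tendsto_intros isCont_tendsto_compose[OF isCont_M] tendsto_endpoint endpoint_gt_1) auto
    qed auto
    then have "(?I \<longlongrightarrow> ?I l) (at l)"
      using c by (simp add: at_within_open[of l "{c<..}"])
    then show ?thesis
      unfolding isCont_def F_eq[OF m] by (intro tendsto_intros)
  qed
  then show ?thesis by (intro continuous_at_imp_continuous_on) auto
qed

section \<open>The limit of F at zero\<close>

text \<open>For \<open>b = endpoint r l\<close>,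
  \<open>(1 - r^2) * (b^2 - 1) = (exp l)^2 - 1\<close>. Hence \<open>l / (b - 1)\<close> is
  \<open>(1 - r^2) * (b + 1)\<close> times \<open>l / ((exp l)^2 - 1)\<close>, which tends to
  \<open>1 / 2\<close>.\<close>

lemma endpoint_at_0:
  assumes r: "0 < r" "r < 1"
  shows "filterlim (\<lambda>l. endpoint r l) (at_right 1) (at_right 0)"
    and "((\<lambda>l. l / (endpoint r l - 1)) \<longlongrightarrow> 1 - r\<^sup>2) (at_right 0)"
proof -
  note u = unit_sq[OF r]
  have "((\<lambda>l. endpoint r l) \<longlongrightarrow> endpoint r 0) (at_right 0)" by (rule tendsto_endpoint[OF r])
  then have w: "((\<lambda>l. endpoint r l) \<longlongrightarrow> 1) (at_right 0)" using u by (simp add: endpoint_def)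
  then show "filterlim (\<lambda>l. endpoint r l) (at_right 1) (at_right 0)"
    using endpoint_gt_1[OF r] by (intro tendsto_imp_filterlim_at_right) (auto simp: eventually_at_filter)
  have e: "((\<lambda>l::real. l / ((exp l)\<^sup>2 - 1)) \<longlongrightarrow> 1 / 2) (at_right 0)" by real_asymp
  have "((\<lambda>l. (1 - r\<^sup>2) * (endpoint r l + 1) * (l / ((exp l)\<^sup>2 - 1))) \<longlongrightarrow> (1 - r\<^sup>2) * (1 + 1) * (1 / 2)) (at_right 0)"
    by (intro tendsto_mult[OF _ e] tendsto_intros w)
  then have *: "((\<lambda>l. (1 - r\<^sup>2) * (endpoint r l + 1) * (l / ((exp l)\<^sup>2 - 1))) \<longlongrightarrow> 1 - r\<^sup>2) (at_right 0)"
    by (rule back_subst[where P="\<lambda>c. (_ \<longlongrightarrow> c) _"]) simp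
  have "\<forall>\<^sub>F l in at_right 0. (1 - r\<^sup>2) * (endpoint r l + 1) * (l / ((exp l)\<^sup>2 - 1)) = l / (endpoint r l - 1)"
    unfolding eventually_at_filter
  proof (intro always_eventually allI impI)
    fix l :: real assume "l \<in> {0<..}"
    then have l: "l > 0" by simp
    have w1: "endpoint r l > 1" by (rule endpoint_gt_1[OF r l])
    have "(endpoint r l - 1) * (endpoint r l + 1) = (endpoint r l)\<^sup>2 - 1" by (simp add: power2_eq_square algebra_simps)
    also have "\<dots> = ((exp l)\<^sup>2 - 1) / (1 - r\<^sup>2)"
      unfolding endpoint_sq[OF r l] using u by (simp add: field_simps)
    finally have "(exp l)\<^sup>2 - 1 = (1 - r\<^sup>2) * ((endpoint r l - 1) * (endpoint r l + 1))"
      using u by simp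
    then show "(1 - r\<^sup>2) * (endpoint r l + 1) * (l / ((exp l)\<^sup>2 - 1)) = l / (endpoint r l - 1)"
      using w1 u by simp
  qed
  from Lim_transform_eventually[OF * this]
  show "((\<lambda>l. l / (endpoint r l - 1)) \<longlongrightarrow> 1 - r\<^sup>2) (at_right 0)" .
qed

text \<open>\<open>l \<le> exp l - 1\<close> turns the uniform bound on the integrand into a
  constant majorant. Pointwise, \<open>(l / (b - 1)) ^ m\<close> contributes
  \<open>(1 - r^2) ^ m\<close>, and against the weight there remains
  \<open>sqrt (1 - r^2) ^ m\<close>.\<close>

lemma F_at_0_Beta:
  assumes m: "m \<ge> 1"
  shows "((\<lambda>l. l ^ m * F (m + 2) l) \<longlongrightarrow> sphere_factor m * (2 * P m 1 / (real m * real (m + 1)) *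
    (Beta (real m / 2) (real m / 2 + 1) / 2))) (at_right 0)"
proof -
  obtain C where C: "C > 0" "\<And>b. b > 1 \<Longrightarrow> (b - 1) ^ m * M (m + 2) b \<le> C"
    using M_upper_bound[OF m] by blast
  define K where "K = 2 * P m 1 / (real m * real (m + 1))"
  have "((\<lambda>l. LINT r:{0<..<1}|lborel. l ^ m * radial_integrand m l r) \<longlongrightarrow>
      (LINT r:{0<..<1}|lborel. K * (r ^ (m - 1) * sqrt (1 - r\<^sup>2) ^ m))) (at_right 0)"
  proof (rule set_integral_tendsto_at_within[OF _ _ _ set_integrable_const_Ioo])
    show "continuous_on {0<..<1} (\<lambda>r. t ^ m * radial_integrand m t r)" if "t \<in> {0<..}" for t
      using that by (intro continuous_intros continuous_on_radial_integrand m) auto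
    show "continuous_on {0<..<1} (\<lambda>r. K * (r ^ (m - 1) * sqrt (1 - r\<^sup>2) ^ m))"
      by (intro continuous_intros)
    show "\<bar>t ^ m * radial_integrand m t r\<bar> \<le> C" if "t \<in> {0<..}" "r \<in> {0<..<1}" for t r
    proof -
      have t: "t > 0" "t \<le> exp t - 1" using that exp_ge_add_one_self[of t] by (simp, linarith)
      have "\<bar>t ^ m * radial_integrand m t r\<bar> \<le> (exp t - 1) ^ m * (C / (exp t - 1) ^ m)"
        unfolding abs_mult using radial_integrand_le[OF C(2)] radial_integrand_pos[of r t m] that m t
        by (intro mult_mono) (auto intro!: power_mono)
      then show ?thesis using t by simp
    qed
    show "((\<lambda>t. t ^ m * radial_integrand m t r) \<longlongrightarrow> K * (r ^ (m - 1) * sqrt (1 - r\<^sup>2) ^ m)) (at_right 0)"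
      if "r \<in> {0<..<1}" for r
    proof -
      have r: "0 < r" "r < 1" using that by auto
      note u = unit_sq[OF r]
      have "((\<lambda>t. (endpoint r t - 1) ^ m * M (m + 2) (endpoint r t)) \<longlongrightarrow> K) (at_right 0)"
        unfolding K_def by (rule filterlim_compose[OF M_at_1[OF m] endpoint_at_0(1)[OF r]])
      then have "((\<lambda>t. r ^ (m - 1) / sqrt (1 - r\<^sup>2) ^ m * ((t / (endpoint r t - 1)) ^ m *
          ((endpoint r t - 1) ^ m * M (m + 2) (endpoint r t)))) \<longlongrightarrow>
          r ^ (m - 1) / sqrt (1 - r\<^sup>2) ^ m * ((1 - r\<^sup>2) ^ m * K)) (at_right 0)"
        by (intro tendsto_intros endpoint_at_0(2)[OF r])
      also have "r ^ (m - 1) / sqrt (1 - r\<^sup>2) ^ m * ((1 - r\<^sup>2) ^ m * K) = K * (r ^ (m - 1) * sqrt (1 - r\<^sup>2) ^ m)"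
      proof -
        have "(1 - r\<^sup>2) ^ m = sqrt (1 - r\<^sup>2) ^ m * sqrt (1 - r\<^sup>2) ^ m"
          using u(4) by (simp add: power_mult_distrib[symmetric] power2_eq_square)
        then show ?thesis using u(2) by simp
      qed
      finally have *: "((\<lambda>t. r ^ (m - 1) / sqrt (1 - r\<^sup>2) ^ m * ((t / (endpoint r t - 1)) ^ m *
          ((endpoint r t - 1) ^ m * M (m + 2) (endpoint r t)))) \<longlongrightarrow> K * (r ^ (m - 1) * sqrt (1 - r\<^sup>2) ^ m)) (at_right 0)" .
      have "\<forall>\<^sub>F t in at_right 0. r ^ (m - 1) / sqrt (1 - r\<^sup>2) ^ m * ((t / (endpoint r t - 1)) ^ m *
          ((endpoint r t - 1) ^ m * M (m + 2) (endpoint r t))) = t ^ m * radial_integrand m t r"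
        unfolding eventually_at_filter
      proof (intro always_eventually allI impI)
        fix t :: real assume "t \<in> {0<..}"
        then have "endpoint r t - 1 \<noteq> 0" using endpoint_gt_1[OF r, of t] by simp
        then show "r ^ (m - 1) / sqrt (1 - r\<^sup>2) ^ m * ((t / (endpoint r t - 1)) ^ m *
          ((endpoint r t - 1) ^ m * M (m + 2) (endpoint r t))) = t ^ m * radial_integrand m t r"
          unfolding radial_integrand_def power_divide by simp
      qed
      from Lim_transform_eventually[OF * this] show ?thesis .
    qed
  qed auto
  then have "((\<lambda>l. sphere_factor m * (l ^ m * (LINT r:{0<..<1}|lborel. radial_integrand m l r))) \<longlongrightarrow>
      sphere_factor m * (K * (Beta (real m / 2) (real m / 2 + 1) / 2))) (at_right 0)"
    unfolding set_integral_mult_right Beta_radial_integral[OF m] by (rule tendsto_mult_left)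
  then show ?thesis
    unfolding F_eq[OF m] K_def mult.left_commute[of "_ ^ m" "sphere_factor m"] .
qed

lemma F_at_0:
  assumes m: "m \<ge> 1"
  shows "((\<lambda>l. l ^ m * F (m + 2) l) \<longlongrightarrow>
    2 * pi powr ((real m - 1) / 2) * P m 1 * Gamma (real m / 2 + 2) * Gamma (real m / 2)
      / ((real m + 2) * Gamma ((real m + 3) / 2) * Gamma (real m + 1))) (at_right 0)"
proof -
  define x where "x = real m / 2"
  have x: "x > 0" "real m = 2 * x" using m by (auto simp: x_def)
  \<comment> \<open>\<open>Gamma_add_1\<close> reduces every \<open>Gamma\<close> value to one of
    these; treated as opaque positive numbers, they leave an identity of rational functions.\<close>
  define p A B C E where "p = pi powr ((2 * x - 1) / 2)" and "A = Gamma x" and "B = Gamma (x + 1 / 2)"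
    and "C = Gamma (x + 1)" and "E = Gamma (2 * x + 1)"
  note defs = p_def[symmetric] A_def[symmetric] B_def[symmetric] C_def[symmetric] E_def[symmetric]
  have G: "A > 0" "B > 0" "C > 0" "E > 0"
    using x by (auto simp: A_def B_def C_def E_def intro!: Gamma_real_pos)
  have g: "Gamma (x + 1 / 2 + 1) = (x + 1 / 2) * B" "Gamma (x + 1 + 1) = (x + 1) * C"
    unfolding B_def C_def using x by (intro Gamma_add_1; simp)+
  have e: "(2 * x + 1) / 2 = x + 1 / 2" "(2 * x + 3) / 2 = (x + 1 / 2) + 1" "x + 2 = (x + 1) + 1"
    "x + (x + 1) = 2 * x + 1" "real (m + 1) = 2 * x + 1"
    using x by auto
  have "sphere_factor m * (2 * P m 1 / (real m * real (m + 1)) * (Beta (real m / 2) (real m / 2 + 1) / 2)) =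
    2 * pi powr ((real m - 1) / 2) * P m 1 * Gamma (real m / 2 + 2) * Gamma (real m / 2)
      / ((real m + 2) * Gamma ((real m + 3) / 2) * Gamma (real m + 1))"
    unfolding sphere_factor_eq[OF m] Beta_def x_def[symmetric] e(5) unfolding x(2) e(1-4) g defs
    using x(1) G by (simp add: divide_simps) (simp add: algebra_simps)?
  then show ?thesis using F_at_0_Beta[OF m] by simp
qed

section \<open>The limit of F at infinity\<close>

lemma endpoint_at_top:
  assumes r: "0 < r" "r < 1"
  shows "filterlim (\<lambda>l. endpoint r l) at_top at_top"
    and "((\<lambda>l. ln (endpoint r l) / l) \<longlongrightarrow> 1) at_top"
    and "((\<lambda>l. exp l / endpoint r l) \<longlongrightarrow> sqrt (1 - r\<^sup>2)) at_top"
proof -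
  note u = unit_sq[OF r]
  define D c where "D = 1 - r\<^sup>2" and "c = r\<^sup>2"
  have D: "D > 0" using u by (simp add: D_def)
  have w: "endpoint r l = sqrt (((exp l)\<^sup>2 - c) / D)" for l
    by (simp add: endpoint_def D_def c_def)
  show "filterlim (\<lambda>l. endpoint r l) at_top at_top"
    unfolding w using D by real_asymp
  show "((\<lambda>l. ln (endpoint r l) / l) \<longlongrightarrow> 1) at_top"
    unfolding w using D by real_asymp
  have "((\<lambda>l. exp l / sqrt ((exp l)\<^sup>2 - c)) \<longlongrightarrow> 1) at_top"
    by real_asymp
  from tendsto_mult_right[OF this, of "sqrt D"]
  show "((\<lambda>l. exp l / endpoint r l) \<longlongrightarrow> sqrt (1 - r\<^sup>2)) at_top"
    unfolding w real_sqrt_divide D_def by simp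
qed

text \<open>From \<open>endpoint r l \<le> exp l / s\<close> the logarithm is at most
  \<open>l + ln (1 / s)\<close>, which is unbounded as \<open>r\<close> tends to 1. The factor
  \<open>s\<close> compensates, by \<open>ln (1 / s) \<le> 1 / s - 1\<close>.\<close>

lemma ln_endpoint_le:
  assumes r: "0 < r" "r < 1" and l: "l \<ge> 1"
  shows "sqrt (1 - r\<^sup>2) * (ln (endpoint r l) / l) \<le> 1"
proof -
  define s where "s = sqrt (1 - r\<^sup>2)"
  note u = unit_sq[OF r]
  have s: "0 < s" "s < 1" "s\<^sup>2 = 1 - r\<^sup>2" using u by (auto simp: s_def)
  have l0: "l > 0" using l by simp
  have "endpoint r l \<le> exp l / s"
    unfolding endpoint_def real_sqrt_divide s_def using u real_sqrt_le_mono[of "(exp l)\<^sup>2 - r\<^sup>2" "(exp l)\<^sup>2"]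
    by (intro divide_right_mono) auto
  then have "ln (endpoint r l) \<le> ln (exp l / s)"
    using endpoint_gt_1[OF r l0] by (intro ln_mono) auto
  also have "\<dots> = l + ln (1 / s)" using s by (simp add: ln_div)
  also have "\<dots> \<le> l + (1 / s - 1)" using ln_le_minus_one[of "1 / s"] s by simp
  also have "\<dots> \<le> l + l * (1 / s - 1)" using l s mult_right_mono[of 1 l "1 / s - 1"] by simp
  also have "\<dots> = l / s" by (simp add: algebra_simps)
  finally have "s * ln (endpoint r l) \<le> l" using s by (simp add: field_simps)
  then show ?thesis using l0 by (simp add: s_def)
qed

text \<open>For \<open>l \<ge> 1\<close>, \<open>a = exp l\<close> is at least 2, so
  \<open>a^2 - r^2 \<ge> (a / 2)^2\<close>; this is the origin of the constant 2.\<close>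

lemma exp_over_endpoint_le:
  assumes r: "0 < r" "r < 1" and l: "l \<ge> 1"
  shows "exp l / endpoint r l \<le> 2 * sqrt (1 - r\<^sup>2)"
proof -
  define a where "a = exp l"
  note u = unit_sq[OF r]
  have a: "a \<ge> 2" using exp_ge_add_one_self[of l] l unfolding a_def by linarith
  then have a2: "a\<^sup>2 \<ge> 4" using power_mono[of 2 a 2] by simp
  have "(a / 2)\<^sup>2 \<le> a\<^sup>2 - r\<^sup>2" using a2 u(1) by (simp add: power_divide)
  then have "a / 2 \<le> sqrt (a\<^sup>2 - r\<^sup>2)" by (rule real_le_rsqrt)
  moreover have "sqrt (a\<^sup>2 - r\<^sup>2) > 0" using a2 u(1) by simp
  ultimately have "a / sqrt (a\<^sup>2 - r\<^sup>2) * sqrt (1 - r\<^sup>2) \<le> 2 * sqrt (1 - r\<^sup>2)"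
    using u by (intro mult_right_mono) (auto simp: divide_le_eq)
  then show ?thesis
    unfolding endpoint_def real_sqrt_divide a_def[symmetric] by simp
qed

text \<open>The integrand factors into the normalised \<open>M\<close>, the ratio
  \<open>ln b / l\<close> and \<open>(exp l / b) ^ (m + 1)\<close>, where
  \<open>b = endpoint r l\<close>. The last is of order \<open>s ^ (m + 1)\<close> for
  \<open>s = sqrt (1 - r^2)\<close>. Against the weight \<open>1 / s ^ m\<close> one factor
  \<open>s\<close> remains; it pays for the logarithm in the majorant and yields the Beta parameter
  \<open>3 / 2\<close>.\<close>

lemma F_at_top_Beta:
  assumes m: "m \<ge> 1"
  shows "((\<lambda>l. exp (real (m + 1) * l) / l * F (m + 2) l) \<longlongrightarrow>
    sphere_factor m * (4 / real (m + 1) * (Beta (real m / 2) (3 / 2) / 2))) at_top"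
proof -
  define K where "K = 4 / real (m + 1)"
  have K: "K > 0" by (simp add: K_def)
  have "\<forall>\<^sub>F b in at_top. b ^ (m + 1) / ln b * M (m + 2) b < K + 1"
    using M_at_top[OF m] unfolding K_def by (rule order_tendstoD) simp
  then obtain b0 where b0: "\<And>b. b \<ge> b0 \<Longrightarrow> b ^ (m + 1) / ln b * M (m + 2) b < K + 1"
    by (auto simp: eventually_at_top_linorder)
  \<comment> \<open>\<open>endpoint r t \<ge> exp t \<ge> t \<ge> b0\<close> brings the argument of
    \<open>M\<close> into range, and \<open>t \<ge> 1\<close> is required by
    \<open>ln_endpoint_le\<close> and \<open>exp_over_endpoint_le\<close>.\<close>
  define T where "T = max 1 b0"
  define C where "C = (K + 1) * 2 ^ (m + 1)"
  have eq: "exp (real (m + 1) * t) / t * radial_integrand m t r = r ^ (m - 1) / sqrt (1 - r\<^sup>2) ^ m *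
      ((endpoint r t ^ (m + 1) / ln (endpoint r t) * M (m + 2) (endpoint r t)) *
       (ln (endpoint r t) / t) * (exp t / endpoint r t) ^ (m + 1))"
    if r: "0 < r" "r < 1" and t: "t > 0" for r t
  proof -
    have w: "endpoint r t > 1" by (rule endpoint_gt_1[OF r t])
    then have l: "ln (endpoint r t) > 0" by simp
    have "exp (real (m + 1) * t) = exp t ^ (m + 1)" by (rule exp_of_nat_mult)
    then show ?thesis
      unfolding radial_integrand_def power_divide using w l by (simp add: mult_ac)
  qed
  have "((\<lambda>l. LINT r:{0<..<1}|lborel. exp (real (m + 1) * l) / l * radial_integrand m l r) \<longlongrightarrow>
      (LINT r:{0<..<1}|lborel. K * (r ^ (m - 1) * sqrt (1 - r\<^sup>2) ^ 1))) at_top"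
  proof (rule set_integral_tendsto_at_top[OF _ _ _ set_integrable_const_Ioo])
    show "continuous_on {0<..<1} (\<lambda>r. exp (real (m + 1) * t) / t * radial_integrand m t r)" if "t \<ge> T" for t
      using that by (intro continuous_intros continuous_on_radial_integrand m) (auto simp: T_def)
    show "continuous_on {0<..<1} (\<lambda>r. K * (r ^ (m - 1) * sqrt (1 - r\<^sup>2) ^ 1))"
      by (intro continuous_intros)
    show "\<bar>exp (real (m + 1) * t) / t * radial_integrand m t r\<bar> \<le> C" if "t \<ge> T" "r \<in> {0<..<1}" for t r
    proof -
      have r: "0 < r" "r < 1" and t: "t \<ge> 1" "t > 0" "t \<ge> b0" using that by (auto simp: T_def)
      note u = unit_sq[OF r]
      define s where "s = sqrt (1 - r\<^sup>2)"
      have s: "0 < s" "s < 1" using u by (auto simp: s_def)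
      define w where "w = endpoint r t"
      have w: "w > 1" unfolding w_def by (rule endpoint_gt_1[OF r t(2)])
      have wb: "w \<ge> b0" using endpoint_ge[OF r t(2)] exp_ge_add_one_self[of t] t unfolding w_def by linarith
      have lw: "ln w > 0" using w by simp
      have A: "w ^ (m + 1) / ln w * M (m + 2) w \<le> K + 1" "0 \<le> w ^ (m + 1) / ln w * M (m + 2) w"
        using b0[OF wb] M_pos[OF w m] w lw by auto
      have B: "s * (ln w / t) \<le> 1" "0 \<le> s * (ln w / t)"
        using ln_endpoint_le[OF r t(1)] s lw t by (auto simp: s_def w_def)
      have E: "(exp t / w) ^ (m + 1) \<le> (2 * s) ^ (m + 1)" "0 \<le> (exp t / w) ^ (m + 1)"
        using exp_over_endpoint_le[OF r t(1)] w unfolding s_def w_def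
        by (intro power_mono zero_le_power; simp)+
      have "exp (real (m + 1) * t) / t * radial_integrand m t r = r ^ (m - 1) / s ^ m *
          ((w ^ (m + 1) / ln w * M (m + 2) w) * (ln w / t) * (exp t / w) ^ (m + 1))"
        unfolding eq[OF r t(2)] s_def w_def ..
      also have "\<dots> \<le> 1 / s ^ m * ((K + 1) * (ln w / t) * (2 * s) ^ (m + 1))"
      proof (rule mult_mono)
        show "r ^ (m - 1) / s ^ m \<le> 1 / s ^ m"
          using r s by (intro divide_right_mono power_le_one) auto
        have lt: "0 \<le> ln w / t" using lw t by simp
        show "w ^ (m + 1) / ln w * M (m + 2) w * (ln w / t) * (exp t / w) ^ (m + 1) \<le>
            (K + 1) * (ln w / t) * (2 * s) ^ (m + 1)"
          using K by (intro mult_mono[OF mult_right_mono[OF A(1) lt] E(1)] mult_nonneg_nonneg[OF _ lt] E(2)) simp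
        show "0 \<le> w ^ (m + 1) / ln w * M (m + 2) w * (ln w / t) * (exp t / w) ^ (m + 1)"
          by (rule mult_nonneg_nonneg[OF mult_nonneg_nonneg[OF A(2) lt] E(2)])
      qed (use s in auto)
      also have "\<dots> = C * (s * (ln w / t))"
        unfolding C_def power_mult_distrib using s by simp
      also have "\<dots> \<le> C * 1"
        using B K by (intro mult_left_mono) (auto simp: C_def)
      finally show ?thesis
        using radial_integrand_pos[OF r t(2) m] t by simp
    qed
    show "((\<lambda>t. exp (real (m + 1) * t) / t * radial_integrand m t r) \<longlongrightarrow> K * (r ^ (m - 1) * sqrt (1 - r\<^sup>2) ^ 1)) at_top"
      if "r \<in> {0<..<1}" for r
    proof -
      have r: "0 < r" "r < 1" using that by auto
      note u = unit_sq[OF r]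
      have "((\<lambda>t. endpoint r t ^ (m + 1) / ln (endpoint r t) * M (m + 2) (endpoint r t)) \<longlongrightarrow> K) at_top"
        unfolding K_def by (rule filterlim_compose[OF M_at_top[OF m] endpoint_at_top(1)[OF r]])
      from tendsto_mult_left[OF tendsto_mult[OF tendsto_mult[OF this endpoint_at_top(2)[OF r]]
            tendsto_power[OF endpoint_at_top(3)[OF r], of "m + 1"]], of "r ^ (m - 1) / sqrt (1 - r\<^sup>2) ^ m"]
      have "((\<lambda>t. r ^ (m - 1) / sqrt (1 - r\<^sup>2) ^ m *
        ((endpoint r t ^ (m + 1) / ln (endpoint r t) * M (m + 2) (endpoint r t)) *
         (ln (endpoint r t) / t) * (exp t / endpoint r t) ^ (m + 1))) \<longlongrightarrow>
         r ^ (m - 1) / sqrt (1 - r\<^sup>2) ^ m * (K * 1 * sqrt (1 - r\<^sup>2) ^ (m + 1))) at_top" .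
      moreover have "r ^ (m - 1) / sqrt (1 - r\<^sup>2) ^ m * (K * 1 * sqrt (1 - r\<^sup>2) ^ (m + 1)) =
          K * (r ^ (m - 1) * sqrt (1 - r\<^sup>2) ^ 1)"
        using u(2) by simp
      ultimately have *: "((\<lambda>t. r ^ (m - 1) / sqrt (1 - r\<^sup>2) ^ m *
        ((endpoint r t ^ (m + 1) / ln (endpoint r t) * M (m + 2) (endpoint r t)) *
         (ln (endpoint r t) / t) * (exp t / endpoint r t) ^ (m + 1))) \<longlongrightarrow> K * (r ^ (m - 1) * sqrt (1 - r\<^sup>2) ^ 1)) at_top"
        by (simp only:)
      have "\<forall>\<^sub>F t in at_top. r ^ (m - 1) / sqrt (1 - r\<^sup>2) ^ m *
        ((endpoint r t ^ (m + 1) / ln (endpoint r t) * M (m + 2) (endpoint r t)) *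
         (ln (endpoint r t) / t) * (exp t / endpoint r t) ^ (m + 1)) = exp (real (m + 1) * t) / t * radial_integrand m t r"
        using eventually_gt_at_top[of 0] by (rule eventually_mono) (rule eq[OF r, symmetric])
      from Lim_transform_eventually[OF * this] show ?thesis .
    qed
  qed auto
  then have "((\<lambda>l. sphere_factor m * (exp (real (m + 1) * l) / l * (LINT r:{0<..<1}|lborel. radial_integrand m l r))) \<longlongrightarrow>
      sphere_factor m * (K * (Beta (real m / 2) (real 1 / 2 + 1) / 2))) at_top"
    unfolding set_integral_mult_right Beta_radial_integral[OF m] by (rule tendsto_mult_left)
  then show ?thesis
    unfolding F_eq[OF m] K_def mult.left_commute[of "_ / _" "sphere_factor m"] by simp
qed

lemma F_at_top:
  assumes m: "m \<ge> 1"
  shows "((\<lambda>l. exp (real (m + 1) * l) / l * F (m + 2) l) \<longlongrightarrow>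
    real m * pi powr (real m / 2) * Gamma (real m / 2) / (Gamma ((real m + 3) / 2))\<^sup>2) at_top"
proof -
  define x where "x = real m / 2"
  have x: "x > 0" "real m = 2 * x" using m by (auto simp: x_def)
  define q s A B where "q = pi powr (x - 1 / 2)" and "s = sqrt pi" and "A = Gamma x" and "B = Gamma (x + 1 / 2)"
  note defs = q_def[symmetric] s_def[symmetric] A_def[symmetric] B_def[symmetric]
  have G: "A > 0" "B > 0" using x by (auto simp: A_def B_def intro!: Gamma_real_pos)
  have g1: "Gamma (x + 1 / 2 + 1) = (x + 1 / 2) * B"
    unfolding B_def using x by (intro Gamma_add_1; simp)
  have e: "(2 * x + 1) / 2 = x + 1 / 2" "(2 * x + 3) / 2 = (x + 1 / 2) + 1" "x + 3 / 2 = (x + 1 / 2) + 1"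
    "(2 * x - 1) / 2 = x - 1 / 2" "real (m + 1) = 2 * x + 1" "2 * x / 2 = x"
    using x by (auto simp: field_simps)
  \<comment> \<open>This \<open>sqrt pi\<close> raises the exponent of \<open>pi\<close> from
    \<open>(m - 1) / 2\<close> in \<open>sphere_factor\<close> to \<open>m / 2\<close>.\<close>
  have g: "Gamma (3 / 2 :: real) = sqrt pi / 2"
    using Gamma_add_1[of "1 / 2"] Gamma_one_half_real by simp
  have p: "pi powr x = pi powr (x - 1 / 2) * sqrt pi"
    using powr_add[of pi "x - 1 / 2" "1 / 2"] by (simp add: powr_half_sqrt)
  have "sphere_factor m * (4 / real (m + 1) * (Beta (real m / 2) (3 / 2) / 2)) =
    real m * pi powr (real m / 2) * Gamma (real m / 2) / (Gamma ((real m + 3) / 2))\<^sup>2"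
    unfolding sphere_factor_eq[OF m] Beta_def g e(5) unfolding x(2) e(1-4,6) p g1 defs
    using x(1) G by (simp add: divide_simps power2_eq_square) (simp add: algebra_simps)?
  then show ?thesis using F_at_top_Beta[OF m] by simp
qed

theorem lemma9:
  fixes n :: nat
  assumes "n \<ge> 3"
  shows "(\<forall>l>0. F n l > 0)
    \<and> (\<exists>C>0. \<forall>l>0. F n l \<le> C / (exp l - 1) ^ (n - 2))
    \<and> continuous_on {0<..} (F n)
    \<and> antimono_on {0<..} (F n)
    \<and> ((\<lambda>l. l ^ (n - 2) * F n l) \<longlongrightarrow>
          2 * pi powr ((real n - 3) / 2) * P (n - 2) 1 * Gamma (real n / 2 + 1) * Gamma (real n / 2 - 1)
            / (real n * Gamma ((real n + 1) / 2) * Gamma (real n - 1))) (at_right 0)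
    \<and> ((\<lambda>l. exp ((real n - 1) * l) / l * F n l) \<longlongrightarrow>
          (real n - 2) * pi powr ((real n - 2) / 2) * Gamma (real n / 2 - 1)
            / (Gamma ((real n + 1) / 2))\<^sup>2) at_top"
proof -
  define m where "m = n - 2"
  have m: "m \<ge> 1" and n: "n = m + 2" using assms by (auto simp: m_def)
  have r: "n - 2 = m" "real n - 3 = real m - 1" "real n / 2 + 1 = real m / 2 + 2" "real n / 2 - 1 = real m / 2"
    "real n + 1 = real m + 3" "real n - 1 = real m + 1" "real n - 2 = real m"
    by (simp_all add: n field_simps)
  have r': "real n = real m + 2" by (simp add: n)
  have "((\<lambda>l. exp ((real m + 1) * l) / l * F (m + 2) l) \<longlongrightarrow>
      real m * pi powr (real m / 2) * Gamma (real m / 2) / (Gamma ((real m + 3) / 2))\<^sup>2) at_top"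
    using F_at_top[OF m] by (simp add: add.commute)
  then show ?thesis
    unfolding r unfolding r' unfolding n
    by (intro conjI allI impI F_pos F_upper_bound F_continuous F_antimono F_at_0 m)
qed

end
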